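(* Let $\mathcal{A}$ be a non-trivial amenable family of functors into a category $\mathcal{C}$, let $B\in\operatorname{Ob}(\mathcal{C})$, and let $f_{12}-f_{02}+f_{01}$ be a $1$-shell in $C_1(\mathcal{A};B)$ with $\operatorname{supp}(f_{jk})=\{j<k\}$. Let $\alpha\in C_2(\mathcal{A};B)$ be a minimal $2$-chain with boundary $f_{12}-f_{02}+f_{01}$. (1) Assume $\alpha$ is of NR-type. Then $|\alpha|=1$ or $|\alpha|\ge5$. If $|\alpha|\geq5$, then any chain-walk in $\alpha$ from $f_{01}$ to $-f_{02}$ is of the form $\sum_{i=0}^{2n}(-1)^ia_i$ (with $a_i$ $2$-simplices), is as a chain equal to $\alpha$, and is such that $f_{12}=a_{2j}\restriction\mathcal{P}(\{1,2\})$ for some $1\le j\le n-1$. (2) $\alpha$ is of RN-type if and only if $\alpha$ is equivalent to a $2$-chain $$\alpha'=a_0+\sum_{i=1}^{2n-1}\epsilon_ia_i+a_{2n}\qquad(n\ge1,\ \epsilon_i=\pm1,\ a_i\ 2\text{-simplices})$$ which is a chain-walk from $f_{01}$ to $-f_{02}$ such that $\operatorname{supp}(a_{2n})=\{0,1,2\}$, $\partial^0a_{2n}=f_{12}$ and $\partial^1a_{2n}=f_{02}$.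
   Context: Primitive categories. For a finite $s\subset\omega$, a primitive category is a non-empty $X\subseteq\mathcal{P}(s)$ closed under subsets, viewed as a category with exactly one morphism $\iota_{u,v}:u\to v$ if $u\subseteq v$ and none otherwise. For a functor $f:X\to\mathcal{C}$, $f^u_v:=f(\iota_{u,v})$. For primitive $X,Y$: $X+Y=\{t\cup k: t\in X,k\in Y\}$. For $t\in X$: $X_t=\{k\in X: t\cap k=\emptyset\}$, $X|_t=\{k\in X_t: t\cup k\in X\}$; $X$ splits at $t$ if $X_t=X|_t$ (and $f$ splits at $t$ if its domain does). The localization $f|_t:X|_t\to\mathcal{C}$ is $f|_t(v)=f(t\cup v)$, $(f|_t)^u_v=f^{u\cup t}_{v\cup t}$. Functors $f:X\to\mathcal{C}$, $g:Y\to\mathcal{C}$ with $X\subseteq\mathcal{P}(s)$, $Y\subseteq\mathcal{P}(t)$ are isomorphic if there are an order-preserving bijection $\tau:s\to t$ with $Y=\{\tau(u):u\in X\}$ and isomorphisms $h_u:f(u)\to g(\tau(u))$ with $h_v\circ f^u_v=g^{\tau(u)}_{\tau(v)}\circ h_u$ for $u\subseteq v\in X$; they are permutations of each other, written $g=f\circ\sigma^{-1}$, if there is a bijection $\sigma:s\to t$ with $Y=\{\sigma(u):u\in X\}$ and $g(v)=f(\sigma^{-1}(v))$, $g^u_v=f^{\sigma^{-1}(u)}_{\sigma^{-1}(v)}$ for $u\subseteq v\in Y$. Amenable families. A non-empty family $\mathcal{A}$ of functors from primitive categories into $\mathcal{C}$ is amenable if: (1) it is closed under isomorphism and permutation; (2)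 a functor $f:X\to\mathcal{C}$ is in $\mathcal{A}$ iff $f\restriction\mathcal{P}(t)\in\mathcal{A}$ for every $t\in X$; (3) $f\in\mathcal{A}$ and $t\in X$ imply $f|_t\in\mathcal{A}$; (4) if $f:X\to\mathcal{C}$ in $\mathcal{A}$ splits at $t\in X$ and $f|_t$ extends to $g:Z\to\mathcal{C}$ in $\mathcal{A}$ with $t\cap\bigcup Z=\emptyset$, then $f$ extends to some $h:\mathcal{P}(t)+Z\to\mathcal{C}$ in $\mathcal{A}$ with $h|_t=g$. $\mathcal{A}$ is non-trivial if it has $1$-amalgamation (every functor in $\mathcal{A}$ with domain $\{\emptyset\}$ extends to one in $\mathcal{A}$ with domain $\mathcal{P}(\{0\})$) and strong $2$-amalgamation (any simplices $f:\mathcal{P}(s)\to\mathcal{C}$, $g:\mathcal{P}(t)\to\mathcal{C}$ in $\mathcal{A}$ agreeing on $\mathcal{P}(s\cap t)$ have a common extension $h:\mathcal{P}(s\cup t)\to\mathcal{C}$ in $\mathcal{A}$). Chains. An $n$-simplex over $B$ is $f\in\mathcal{A}$ with domain $\mathcal{P}(s)$, $|s|=n+1$, $f(\emptyset)=B$; $\operatorname{supp}(f)=s$. $C_n(\mathcal{A};B)$ is the free abelian group on these; its elements are $n$-chains. For $s=\{s_0<\dots<s_n\}$, $\partial^if=f\restriction\mathcal{P}(s\setminus\{s_i\})$ (extended linearly), $\partial=\sum_{i=0}^n(-1)^i\partial^i$. A chain in standard form is $c=\sum_{i=1}^kn_if_i$ with $n_i\ne0$ integers and distinct simplices $f_i$;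 then $|c|=\sum|n_i|$ and $\operatorname{supp}(c)=\bigcup_i\operatorname{supp}(f_i)$. A subchain (subsummand) of $c$ is $d=\sum_{i\in J}m_if_i$, $J\subseteq\{1,\dots,k\}$, with $n_im_i>0$, $|m_i|\le|n_i|$. Replacing the subsummand $d$ in $c$ by $d'$ means forming $c-d+d'$. For a chain $c$, $c^{j_0,\dots,j_k}$ is the subchain consisting of all terms $n_if_i$ with $\operatorname{supp}(f_i)=\{j_0,\dots,j_k\}$. A $1$-shell is a $1$-chain $\pm(f_0-f_1+f_2)$ with $f_i$ $1$-simplices and $\partial^if_j=\partial^{j-1}f_i$ for $0\le i<j\le2$. CR-operation. Let $w=\epsilon_1\alpha_1+\epsilon_2\alpha_2$ be a subsummand of a $2$-chain $v$, $\epsilon_i=\pm1$, $\alpha_i$ $2$-simplices with $\operatorname{supp}(\alpha_i)=\{\ell_1,\ell_2,k_i\}$ ($\ell_1,\ell_2,k_1,k_2$ distinct), agreeing on $\mathcal{P}(\{\ell_1,\ell_2\})$, such that the common restriction $\gamma=\alpha_i\restriction\mathcal{P}(\{\ell_1,\ell_2\})$ does not appear in $\partial(w)$ (its two occurrences cancel). Choose a $3$-simplex $\mu$ in $\mathcal{A}$ extending $\alpha_1$ and $\alpha_2$, and let $\beta_i=\mu\restriction\mathcal{P}(\{k_1,k_2,\ell_i\})$. The CR-operation replaces $w$ in $v$ by $w'$, where $w'=\epsilon_2\beta_1+\epsilon_1\beta_2$ if $\epsilon_1\epsilon_2=-1$ and the number of elements of $\{k_2,\ell_1\}$ lying strictly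 between $k_1$ and $\ell_2$ is not exactly one, and $w'=\epsilon_1\beta_1+\epsilon_2\beta_2$ otherwise; so $\partial(w')=\partial(w)$. RS-operation. A chain $d$ has a vanishing support $j$ (in its boundary) if $j\in\operatorname{supp}(d)$ and $j\notin\operatorname{supp}(\partial d)$. For a bijection $\sigma:\omega\to\omega$ and a chain $c=\sum_in_if_i$, set $\sigma^*(c)=\sum_in_i|\sigma_i|\,f_i\circ\sigma_i^{-1}$, where $\sigma_i=\sigma\restriction\operatorname{supp}(f_i)$ and, writing $\operatorname{supp}(f_i)=\{s_0<\dots<s_n\}$ and $\sigma(\operatorname{supp}(f_i))=\{t_0<\dots<t_n\}$, $|\sigma_i|$ is the sign of the permutation $\sigma_i'$ of $\{0,\dots,n\}$ with $\sigma(s_j)=t_{\sigma_i'(j)}$. If $d$ is a subsummand of $c$ with vanishing support $j$, $k\notin\operatorname{supp}(c)$, and $\sigma$ is a bijection of $\omega$ sending $j\mapsto k$ and fixing all other elements of $\operatorname{supp}(c)$, then replacing $d$ in $c$ by $\sigma^*(d)$ is an RS-operation. Types. A $2$-chain is proper if its length does not change after any finitely many applications of CR/RS-operations to its subsummands. Proper $2$-chains $c,c'$ are equivalent ($c\sim c'$) if $c$ can be obtained from $c'$ by finitely many applications of CR/RS-operations to subsummands. A $2$-chain $\alpha$ with a $1$-shell boundary is of RN-type if some subsummand of $\alpha$ has a vanishing support, otherwise it is of NR-type. It is minimal if it is proper and for every proper $\alpha'\sim\alpha$ there is no (nonzero) subsummand $\beta$ of $\alpha'$ with $\partial(\beta)=0$.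 Chain-walks. A subchain $\sum_{i=0}^m\epsilon_ib_i$ of a $2$-chain $\alpha$ ($\epsilon_i=\pm1$, $b_i$ $2$-simplices), taken with its order, is a chain-walk in $\alpha$ from $f_{01}$ to $-f_{02}$ if: (1) there are non-zero numbers $k_0,\dots,k_{m+1}$ (not necessarily distinct) with $k_0=1$, $k_{m+1}=2$ and $\operatorname{supp}(b_i)=\{k_i,k_{i+1},0\}$ for $i\le m$; (2) $(\partial\epsilon_0b_0)^{0,1}=f_{01}$ and $(\partial\epsilon_mb_m)^{0,2}=-f_{02}$; (3) $(\partial\epsilon_ib_i)^{0,k_{i+1}}+(\partial\epsilon_{i+1}b_{i+1})^{0,k_{i+1}}=0$ for $0\le i<m$. In (2) of the theorem, $\alpha'$ itself, with the displayed order, is a chain-walk (in $\alpha'$). *)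

theory Defs
  imports "HOL-Library.Poly_Mapping" "HOL-Combinatorics.Permutations"
begin

section \<open>Categories\<close>

record ('o, 'm) cat =
  Obj :: "'o set"
  Arr :: "'m set"
  Dom :: "'m \<Rightarrow> 'o"
  Cod :: "'m \<Rightarrow> 'o"
  Ide :: "'o \<Rightarrow> 'm"
  Cmp :: "'m \<Rightarrow> 'm \<Rightarrow> 'm"

definition Hom :: "('o, 'm) cat \<Rightarrow> 'o \<Rightarrow> 'o \<Rightarrow> 'm set" where
  "Hom C a b = {h \<in> Arr C. Dom C h = a \<and> Cod C h = b}"

text \<open>\<open>Cmp C g h\<close> is the composite \<open>g \<circ> h\<close>.\<close>

locale category =
  fixes C :: "('o, 'm) cat"
  assumes Dom_Obj: "h \<in> Arr C \<Longrightarrow> Dom C h \<in> Obj C"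
    and Cod_Obj: "h \<in> Arr C \<Longrightarrow> Cod C h \<in> Obj C"
    and Ide_Hom: "a \<in> Obj C \<Longrightarrow> Ide C a \<in> Hom C a a"
    and Cmp_Hom: "\<lbrakk>h \<in> Hom C a b; g \<in> Hom C b c\<rbrakk> \<Longrightarrow> Cmp C g h \<in> Hom C a c"
    and Cmp_Ide_right: "h \<in> Hom C a b \<Longrightarrow> Cmp C h (Ide C a) = h"
    and Cmp_Ide_left: "h \<in> Hom C a b \<Longrightarrow> Cmp C (Ide C b) h = h"
    and Cmp_assoc: "\<lbrakk>h \<in> Hom C a b; g \<in> Hom C b c; k \<in> Hom C c d\<rbrakk>
      \<Longrightarrow> Cmp C k (Cmp C g h) = Cmp C (Cmp C k g) h"

definition isomorphism :: "('o, 'm) cat \<Rightarrow> 'm \<Rightarrow> 'o \<Rightarrow> 'o \<Rightarrow> bool" where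
  "isomorphism C h a b \<longleftrightarrow> h \<in> Hom C a b \<and>
     (\<exists>g \<in> Hom C b a. Cmp C g h = Ide C a \<and> Cmp C h g = Ide C b)"


section \<open>Functors from primitive categories\<close>

definition primitive :: "nat set set \<Rightarrow> bool" where
  "primitive X \<longleftrightarrow> (\<exists>s. finite s \<and> X \<subseteq> Pow s) \<and> X \<noteq> {} \<and> (\<forall>u \<in> X. \<forall>v. v \<subseteq> u \<longrightarrow> v \<in> X)"

definition prim_sum :: "nat set set \<Rightarrow> nat set set \<Rightarrow> nat set set" where
  "prim_sum X Y = {t \<union> k | t k. t \<in> X \<and> k \<in> Y}"

definition disjoint_part :: "nat set set \<Rightarrow> nat set \<Rightarrow> nat set set" where
  "disjoint_part X t = {k \<in> X. t \<inter> k = {}}"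

definition local_part :: "nat set set \<Rightarrow> nat set \<Rightarrow> nat set set" where
  "local_part X t = {k \<in> disjoint_part X t. t \<union> k \<in> X}"

definition splits_at :: "nat set set \<Rightarrow> nat set \<Rightarrow> bool" where
  "splits_at X t \<longleftrightarrow> disjoint_part X t = local_part X t"

text \<open>
  A functor \<open>f : X \<rightarrow> C\<close> is stored together with its domain \<open>X = pdom f\<close>; \<open>pmor f u v\<close> is the value
  at the unique morphism \<open>u \<rightarrow> v\<close>. The functions take the value \<^term>\<open>undefined\<close> off the domain, so
  that equality of functors is equality of records.
\<close>

record ('o, 'm) pfun =
  pdom :: "nat set set"
  pob :: "nat set \<Rightarrow> 'o"
  pmor :: "nat set \<Rightarrow> nat set \<Rightarrow> 'm"

definition mk_pfun ::
  "nat set set \<Rightarrow> (nat set \<Rightarrow> 'o) \<Rightarrow> (nat set \<Rightarrow> nat set \<Rightarrow> 'm) \<Rightarrow> ('o, 'm) pfun" where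
  "mk_pfun X F M = \<lparr>pdom = X,
     pob = (\<lambda>u. if u \<in> X then F u else undefined),
     pmor = (\<lambda>u v. if u \<in> X \<and> v \<in> X \<and> u \<subseteq> v then M u v else undefined)\<rparr>"

definition prim_functor :: "('o, 'm) cat \<Rightarrow> ('o, 'm) pfun \<Rightarrow> bool" where
  "prim_functor C f \<longleftrightarrow>
     primitive (pdom f) \<and>
     f = mk_pfun (pdom f) (pob f) (pmor f) \<and>
     (\<forall>u \<in> pdom f. pob f u \<in> Obj C) \<and>
     (\<forall>u \<in> pdom f. \<forall>v \<in> pdom f. u \<subseteq> v \<longrightarrow> pmor f u v \<in> Hom C (pob f u) (pob f v)) \<and>
     (\<forall>u \<in> pdom f. pmor f u u = Ide C (pob f u)) \<and>
     (\<forall>u \<in> pdom f. \<forall>v \<in> pdom f. \<forall>w \<in> pdom f. u \<subseteq> v \<longrightarrow> v \<subseteq> w \<longrightarrow>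
        pmor f u w = Cmp C (pmor f v w) (pmor f u v))"

definition restr :: "('o, 'm) pfun \<Rightarrow> nat set set \<Rightarrow> ('o, 'm) pfun" where
  "restr f Y = mk_pfun (pdom f \<inter> Y) (pob f) (pmor f)"

definition extends :: "('o, 'm) pfun \<Rightarrow> ('o, 'm) pfun \<Rightarrow> bool" where
  "extends g f \<longleftrightarrow> pdom f \<subseteq> pdom g \<and> restr g (pdom f) = f"

definition localization :: "('o, 'm) pfun \<Rightarrow> nat set \<Rightarrow> ('o, 'm) pfun" where
  "localization f t = mk_pfun (local_part (pdom f) t)
     (\<lambda>v. pob f (t \<union> v)) (\<lambda>u v. pmor f (u \<union> t) (v \<union> t))"

definition functor_isomorphic :: "('o, 'm) cat \<Rightarrow> ('o, 'm) pfun \<Rightarrow> ('o, 'm) pfun \<Rightarrow> bool" where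
  "functor_isomorphic C f g \<longleftrightarrow>
     (\<exists>s t \<tau> h. finite s \<and> finite t \<and> pdom f \<subseteq> Pow s \<and> pdom g \<subseteq> Pow t \<and>
        bij_betw \<tau> s t \<and> strict_mono_on s \<tau> \<and>
        pdom g = (\<lambda>u. \<tau> ` u) ` pdom f \<and>
        (\<forall>u \<in> pdom f. isomorphism C (h u) (pob f u) (pob g (\<tau> ` u))) \<and>
        (\<forall>u \<in> pdom f. \<forall>v \<in> pdom f. u \<subseteq> v \<longrightarrow>
           Cmp C (h v) (pmor f u v) = Cmp C (pmor g (\<tau> ` u) (\<tau> ` v)) (h u)))"

text \<open>\<open>permute s \<sigma> f\<close> is \<open>f \<circ> \<sigma>\<^sup>-\<^sup>1\<close> for a map \<open>\<sigma>\<close> that is injective on \<open>s\<close>, where \<open>pdom f \<subseteq> Pow s\<close>.\<close>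

definition permute :: "nat set \<Rightarrow> (nat \<Rightarrow> nat) \<Rightarrow> ('o, 'm) pfun \<Rightarrow> ('o, 'm) pfun" where
  "permute s \<sigma> f = mk_pfun ((\<lambda>u. \<sigma> ` u) ` pdom f)
     (\<lambda>v. pob f (inv_into s \<sigma> ` v)) (\<lambda>u v. pmor f (inv_into s \<sigma> ` u) (inv_into s \<sigma> ` v))"

definition is_permutation :: "('o, 'm) pfun \<Rightarrow> ('o, 'm) pfun \<Rightarrow> bool" where
  "is_permutation f g \<longleftrightarrow>
     (\<exists>s t \<sigma>. finite s \<and> finite t \<and> pdom f \<subseteq> Pow s \<and> pdom g \<subseteq> Pow t \<and>
        bij_betw \<sigma> s t \<and> g = permute s \<sigma> f)"


section \<open>Amenable families\<close>

locale amenable_family = category C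
  for C :: "('o, 'm) cat" +
  fixes A :: "('o, 'm) pfun set"
  assumes nonempty: "A \<noteq> {}"
    and functors: "f \<in> A \<Longrightarrow> prim_functor C f"
    and closed_iso: "\<lbrakk>f \<in> A; prim_functor C g; functor_isomorphic C f g\<rbrakk> \<Longrightarrow> g \<in> A"
    and closed_permutation: "\<lbrakk>f \<in> A; prim_functor C g; is_permutation f g\<rbrakk> \<Longrightarrow> g \<in> A"
    and local_character: "prim_functor C f \<Longrightarrow> f \<in> A \<longleftrightarrow> (\<forall>t \<in> pdom f. restr f (Pow t) \<in> A)"
    and closed_localization: "\<lbrakk>f \<in> A; t \<in> pdom f\<rbrakk> \<Longrightarrow> localization f t \<in> A"
    and de_localization:
      "\<lbrakk>f \<in> A; t \<in> pdom f; splits_at (pdom f) t; g \<in> A; extends g (localization f t);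
        t \<inter> \<Union>(pdom g) = {}\<rbrakk>
       \<Longrightarrow> \<exists>h \<in> A. pdom h = prim_sum (Pow t) (pdom g) \<and> extends h f \<and> localization h t = g"

locale nontrivial_amenable_family = amenable_family +
  assumes one_amalgamation:
      "\<lbrakk>f \<in> A; pdom f = {{}}\<rbrakk> \<Longrightarrow> \<exists>g \<in> A. pdom g = Pow {0} \<and> extends g f"
    and strong_two_amalgamation:
      "\<lbrakk>finite s; finite t; f \<in> A; pdom f = Pow s; g \<in> A; pdom g = Pow t;
        restr f (Pow (s \<inter> t)) = restr g (Pow (s \<inter> t))\<rbrakk>
       \<Longrightarrow> \<exists>h \<in> A. pdom h = Pow (s \<union> t) \<and> extends h f \<and> extends h g"


section \<open>Chains\<close>

definition psupp :: "('o, 'm) pfun \<Rightarrow> nat set" where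
  "psupp f = \<Union>(pdom f)"

definition simplices :: "('o, 'm) pfun set \<Rightarrow> 'o \<Rightarrow> nat \<Rightarrow> ('o, 'm) pfun set" where
  "simplices A B n = {f \<in> A. (\<exists>s. card s = n + 1 \<and> pdom f = Pow s) \<and> pob f {} = B}"

type_synonym ('o, 'm) chain = "('o, 'm) pfun \<Rightarrow>\<^sub>0 int"

definition chain_group :: "('o, 'm) pfun set \<Rightarrow> 'o \<Rightarrow> nat \<Rightarrow> ('o, 'm) chain set" where
  "chain_group A B n = {c. Poly_Mapping.keys c \<subseteq> simplices A B n}"

definition face :: "nat \<Rightarrow> ('o, 'm) pfun \<Rightarrow> ('o, 'm) pfun" where
  "face i f = restr f (Pow (psupp f - {sorted_list_of_set (psupp f) ! i}))"

definition boundary :: "('o, 'm) chain \<Rightarrow> ('o, 'm) chain" where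
  "boundary = frag_extend (\<lambda>f. \<Sum>i<card (psupp f). frag_cmul ((-1) ^ i) (frag_of (face i f)))"

definition chain_length :: "('o, 'm) chain \<Rightarrow> nat" where
  "chain_length c = (\<Sum>f \<in> Poly_Mapping.keys c. nat \<bar>Poly_Mapping.lookup c f\<bar>)"

definition csupp :: "('o, 'm) chain \<Rightarrow> nat set" where
  "csupp c = (\<Union>f \<in> Poly_Mapping.keys c. psupp f)"

definition subchain :: "('o, 'm) chain \<Rightarrow> ('o, 'm) chain \<Rightarrow> bool" where
  "subchain d c \<longleftrightarrow> Poly_Mapping.keys d \<subseteq> Poly_Mapping.keys c \<and>
     (\<forall>f \<in> Poly_Mapping.keys d. Poly_Mapping.lookup c f * Poly_Mapping.lookup d f > 0 \<and>
        \<bar>Poly_Mapping.lookup d f\<bar> \<le> \<bar>Poly_Mapping.lookup c f\<bar>)"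

definition part_on :: "('o, 'm) chain \<Rightarrow> nat set \<Rightarrow> ('o, 'm) chain" where
  "part_on c s = frag_extend (\<lambda>f. if psupp f = s then frag_of f else 0) c"

definition one_shell :: "('o, 'm) pfun set \<Rightarrow> 'o \<Rightarrow> ('o, 'm) chain \<Rightarrow> bool" where
  "one_shell A B c \<longleftrightarrow>
     (\<exists>e f. e \<in> {1, -1} \<and> (\<forall>i\<le>2. f i \<in> simplices A B 1) \<and>
        (\<forall>i j. i < j \<and> j \<le> 2 \<longrightarrow> face i (f j) = face (j - 1) (f i)) \<and>
        c = frag_cmul e (frag_of (f 0) - frag_of (f 1) + frag_of (f 2)))"


section \<open>The CR-operation and the RS-operation\<close>

definition CR_result ::
  "nat \<Rightarrow> nat \<Rightarrow> nat \<Rightarrow> nat \<Rightarrow> int \<Rightarrow> int \<Rightarrow> ('o, 'm) pfun \<Rightarrow> ('o, 'm) chain" where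
  "CR_result l1 l2 k1 k2 e1 e2 \<mu> =
     (let \<beta>1 = restr \<mu> (Pow {k1, k2, l1}); \<beta>2 = restr \<mu> (Pow {k1, k2, l2}) in
      if e1 * e2 = -1 \<and> card {x \<in> {k2, l1}. min k1 l2 < x \<and> x < max k1 l2} \<noteq> 1
      then frag_cmul e2 (frag_of \<beta>1) + frag_cmul e1 (frag_of \<beta>2)
      else frag_cmul e1 (frag_of \<beta>1) + frag_cmul e2 (frag_of \<beta>2))"

definition CR_step :: "('o, 'm) pfun set \<Rightarrow> 'o \<Rightarrow> ('o, 'm) chain \<Rightarrow> ('o, 'm) chain \<Rightarrow> bool" where
  "CR_step A B v v' \<longleftrightarrow>
     (\<exists>w \<alpha>1 \<alpha>2 e1 e2 l1 l2 k1 k2 \<mu>.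
        e1 \<in> {1, -1} \<and> e2 \<in> {1, -1} \<and>
        \<alpha>1 \<in> simplices A B 2 \<and> \<alpha>2 \<in> simplices A B 2 \<and>
        distinct [l1, l2, k1, k2] \<and>
        psupp \<alpha>1 = {l1, l2, k1} \<and> psupp \<alpha>2 = {l1, l2, k2} \<and>
        w = frag_cmul e1 (frag_of \<alpha>1) + frag_cmul e2 (frag_of \<alpha>2) \<and>
        subchain w v \<and>
        restr \<alpha>1 (Pow {l1, l2}) = restr \<alpha>2 (Pow {l1, l2}) \<and>
        restr \<alpha>1 (Pow {l1, l2}) \<notin> Poly_Mapping.keys (boundary w) \<and>
        \<mu> \<in> simplices A B 3 \<and> extends \<mu> \<alpha>1 \<and> extends \<mu> \<alpha>2 \<and>
        v' = v - w + CR_result l1 l2 k1 k2 e1 e2 \<mu>)"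

definition vanishing_support :: "('o, 'm) chain \<Rightarrow> nat \<Rightarrow> bool" where
  "vanishing_support d j \<longleftrightarrow> j \<in> csupp d \<and> j \<notin> csupp (boundary d)"

text \<open>\<open>relabel_sign \<sigma> s\<close> is \<open>|\<sigma> \<restriction> s|\<close>: the bijection \<open>\<sigma> : s \<rightarrow> \<sigma> ` s\<close> read as a permutation of indices
  through the increasing enumerations of \<open>s\<close> and \<open>\<sigma> ` s\<close>.\<close>

definition relabel_sign :: "(nat \<Rightarrow> nat) \<Rightarrow> nat set \<Rightarrow> int" where
  "relabel_sign \<sigma> s = sign (THE p. p permutes {..<card s} \<and>
     (\<forall>j<card s. \<sigma> (sorted_list_of_set s ! j) = sorted_list_of_set (\<sigma> ` s) ! p j))"

definition relabel_chain :: "(nat \<Rightarrow> nat) \<Rightarrow> ('o, 'm) chain \<Rightarrow> ('o, 'm) chain" where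
  "relabel_chain \<sigma> = frag_extend
     (\<lambda>f. frag_cmul (relabel_sign \<sigma> (psupp f)) (frag_of (permute (psupp f) \<sigma> f)))"

definition RS_step :: "('o, 'm) chain \<Rightarrow> ('o, 'm) chain \<Rightarrow> bool" where
  "RS_step c c' \<longleftrightarrow>
     (\<exists>d j k \<sigma>. subchain d c \<and> vanishing_support d j \<and> k \<notin> csupp c \<and>
        bij \<sigma> \<and> \<sigma> j = k \<and> (\<forall>x \<in> csupp c - {j}. \<sigma> x = x) \<and>
        c' = c - d + relabel_chain \<sigma> d)"

definition CRRS_step :: "('o, 'm) pfun set \<Rightarrow> 'o \<Rightarrow> ('o, 'm) chain \<Rightarrow> ('o, 'm) chain \<Rightarrow> bool" where
  "CRRS_step A B c c' \<longleftrightarrow> CR_step A B c c' \<or> RS_step c c'"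


section \<open>Types of 2-chains\<close>

definition proper_chain :: "('o, 'm) pfun set \<Rightarrow> 'o \<Rightarrow> ('o, 'm) chain \<Rightarrow> bool" where
  "proper_chain A B c \<longleftrightarrow> c \<in> chain_group A B 2 \<and>
     (\<forall>c'. (CRRS_step A B)\<^sup>*\<^sup>* c c' \<longrightarrow> chain_length c' = chain_length c)"

text \<open>Argument order matters: \<open>chain_equiv A B c c'\<close> says that \<open>c\<close> is obtained from \<open>c'\<close>. An
  RS-operation that moves only some of the terms containing \<open>j\<close> to the fresh index \<open>k\<close> cannot
  be undone, because the index an RS-operation moves to must be fresh.\<close>

definition chain_equiv :: "('o, 'm) pfun set \<Rightarrow> 'o \<Rightarrow> ('o, 'm) chain \<Rightarrow> ('o, 'm) chain \<Rightarrow> bool" where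
  "chain_equiv A B c c' \<longleftrightarrow>
     proper_chain A B c \<and> proper_chain A B c' \<and> (CRRS_step A B)\<^sup>*\<^sup>* c' c"

definition shell_bounded :: "('o, 'm) pfun set \<Rightarrow> 'o \<Rightarrow> ('o, 'm) chain \<Rightarrow> bool" where
  "shell_bounded A B \<alpha> \<longleftrightarrow> \<alpha> \<in> chain_group A B 2 \<and> one_shell A B (boundary \<alpha>)"

definition RN_type :: "('o, 'm) pfun set \<Rightarrow> 'o \<Rightarrow> ('o, 'm) chain \<Rightarrow> bool" where
  "RN_type A B \<alpha> \<longleftrightarrow> shell_bounded A B \<alpha> \<and> (\<exists>d j. subchain d \<alpha> \<and> vanishing_support d j)"

definition NR_type :: "('o, 'm) pfun set \<Rightarrow> 'o \<Rightarrow> ('o, 'm) chain \<Rightarrow> bool" where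
  "NR_type A B \<alpha> \<longleftrightarrow> shell_bounded A B \<alpha> \<and> \<not> RN_type A B \<alpha>"

definition minimal_chain :: "('o, 'm) pfun set \<Rightarrow> 'o \<Rightarrow> ('o, 'm) chain \<Rightarrow> bool" where
  "minimal_chain A B \<alpha> \<longleftrightarrow> shell_bounded A B \<alpha> \<and> proper_chain A B \<alpha> \<and>
     (\<forall>\<alpha>'. chain_equiv A B \<alpha>' \<alpha> \<longrightarrow>
        \<not> (\<exists>\<beta>. \<beta> \<noteq> 0 \<and> subchain \<beta> \<alpha>' \<and> boundary \<beta> = 0))"


section \<open>Chain-walks\<close>

text \<open>The ordered sum \<open>\<epsilon> 0 b 0 + \<dots> + \<epsilon> m b m\<close> is a chain-walk in \<open>\<alpha>\<close> from \<open>f01\<close> to \<open>-f02\<close>. A simplex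
  may occur several times among the \<open>b i\<close>; the condition on the length says that the displayed
  terms do not cancel, so that they really are \<open>m + 1\<close> terms of \<open>\<alpha>\<close>.\<close>

definition chain_walk ::
  "('o, 'm) pfun set \<Rightarrow> 'o \<Rightarrow> ('o, 'm) chain \<Rightarrow> ('o, 'm) pfun \<Rightarrow> ('o, 'm) pfun \<Rightarrow>
   nat \<Rightarrow> (nat \<Rightarrow> int) \<Rightarrow> (nat \<Rightarrow> ('o, 'm) pfun) \<Rightarrow> bool" where
  "chain_walk A B \<alpha> f01 f02 m \<epsilon> b \<longleftrightarrow>
     (\<forall>i\<le>m. \<epsilon> i \<in> {1, -1} \<and> b i \<in> simplices A B 2) \<and>
     subchain (\<Sum>i\<le>m. frag_cmul (\<epsilon> i) (frag_of (b i))) \<alpha> \<and>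
     chain_length (\<Sum>i\<le>m. frag_cmul (\<epsilon> i) (frag_of (b i))) = m + 1 \<and>
     (\<exists>k :: nat \<Rightarrow> nat.
        (\<forall>i\<le>m + 1. k i \<noteq> 0) \<and> k 0 = 1 \<and> k (m + 1) = 2 \<and>
        (\<forall>i\<le>m. psupp (b i) = {k i, k (i + 1), 0}) \<and>
        part_on (boundary (frag_cmul (\<epsilon> 0) (frag_of (b 0)))) {0, 1} = frag_of f01 \<and>
        part_on (boundary (frag_cmul (\<epsilon> m) (frag_of (b m)))) {0, 2} = - frag_of f02 \<and>
        (\<forall>i<m. part_on (boundary (frag_cmul (\<epsilon> i) (frag_of (b i)))) {0, k (i + 1)} +
           part_on (boundary (frag_cmul (\<epsilon> (i + 1)) (frag_of (b (i + 1))))) {0, k (i + 1)} = 0))"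

end

theory Submission
  imports Defs
begin

text \<open>Orient every triangle of a chain. The triangles at a vertex \<open>v\<close> then form a directed graph on the
  edges at \<open>v\<close>, and the boundary of the chain says where its directed walks (\<open>fans\<close>) begin and end.

  If no support vanishes, all triangles live on \<open>{0, 1, 2}\<close>, and every non-empty piece of the chain has a
  boundary that meets 0, 1 and 2; this forces the walk around 0 to be the whole chain and \<open>f12\<close> to lie
  on an inner triangle. No CR- or RS-operation applies to such a chain, so its equivalence class is
  trivial.

  If some support vanishes, an RS-operation provides an index outside \<open>{0, 1, 2}\<close>. By minimality the
  part outside a fan is not a cycle, so it shares an outer edge with the fan, and a CR-operation (a flip
  of that edge) moves a triangle into the fan; should \<open>v\<close> itself be the opposite vertex, it is renamed
  beforehand in the part outside. So fans grow to the whole chain. Flips of the inner edges at \<open>v\<close>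
  conversely shorten a fan. Growing and shortening the fan around 2 isolates the corner triangle at 2,
  and growing the fan around 0 that ends with it gives the required walk.\<close>

text \<open>Chains live in a free abelian group, so a display as a sum over a list says little until
  cancellation is excluded. Properness does this: all chains reached from \<alpha> have the same
  length, and a display with as many units as that length cannot cancel. Hence nearly every
  statement below carries an equation between lengths.

  The sign rule of the CR-operation, given by betweenness of indices, becomes uniform once a
  triangle on a, b, c is weighted by the sign of the order a, b, c: one diagonal of an oriented
  quadrilateral replaces the other.

  Equivalence is directed, since an RS-operation need not be reversible; all constructions therefore
  run forward from \<alpha>. A flip needs four distinct indices. So shortening the fan around 2 to
  its corner requires an index outside {0, 1} in it, and the presence of a triangle off {0, 1, 2}
  (\<open>wide\<close>) has to be carried through the growth of that fan. The corner triangle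
  survives the later growth around 0 because its outer edge is \<open>f12\<close>, the only edge of
  the shell that misses 0, and growth flips other edges only.\<close>

abbreviation (input) coeff :: "('a \<Rightarrow>\<^sub>0 int) \<Rightarrow> 'a \<Rightarrow> int" where "coeff \<equiv> Poly_Mapping.lookup"
abbreviation (input) terms :: "('a \<Rightarrow>\<^sub>0 int) \<Rightarrow> 'a set" where "terms \<equiv> Poly_Mapping.keys"
abbreviation (input) sterm :: "int \<Rightarrow> 'a \<Rightarrow> 'a \<Rightarrow>\<^sub>0 int" where "sterm e f \<equiv> frag_cmul e (frag_of f)"

subsection \<open>Lengths, subchains and functionals\<close>

lemma chain_length_superset:
  assumes "finite S" "terms c \<subseteq> S"
  shows "chain_length c = (\<Sum>f\<in>S. nat \<bar>coeff c f\<bar>)"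
  unfolding chain_length_def
  by (rule sum.mono_neutral_left) (use assms in \<open>auto simp: in_keys_iff\<close>)

lemma chain_length_eq_0 [simp]: "chain_length c = 0 \<longleftrightarrow> c = 0"
  by (auto simp: chain_length_def in_keys_iff simp flip: keys_eq_empty)

lemma chain_length_sterm [simp]: "chain_length (sterm e f) = nat \<bar>e\<bar>"
  by (subst chain_length_superset[of "{f}"]) auto

lemma chain_length_frag_of [simp]: "chain_length (frag_of f) = 1"
  using chain_length_sterm[of 1 f] by simp

lemma chain_length_add_le: "chain_length (c + d) \<le> chain_length c + chain_length d"
proof -
  let ?S = "terms c \<union> terms d"
  have "chain_length (c + d) = (\<Sum>f\<in>?S. nat \<bar>coeff c f + coeff d f\<bar>)"
    using keys_add[of c d] by (subst chain_length_superset[of ?S]) (auto simp: lookup_add)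
  also have "\<dots> \<le> (\<Sum>f\<in>?S. nat \<bar>coeff c f\<bar> + nat \<bar>coeff d f\<bar>)"
    by (rule sum_mono) auto
  also have "\<dots> = chain_length c + chain_length d"
    by (simp add: sum.distrib chain_length_superset[of ?S])
  finally show ?thesis .
qed

lemma nat_abs_split_iff:
  "nat \<bar>x\<bar> = nat \<bar>y\<bar> + nat \<bar>x - y\<bar> \<longleftrightarrow> y = 0 \<or> (x * y > 0 \<and> \<bar>y\<bar> \<le> \<bar>x\<bar>)" for x y :: int
proof -
  have "nat \<bar>x\<bar> = nat \<bar>y\<bar> + nat \<bar>x - y\<bar> \<longleftrightarrow> \<bar>x\<bar> = \<bar>y\<bar> + \<bar>x - y\<bar>"
    using nat_add_distrib[of "\<bar>y\<bar>" "\<bar>x - y\<bar>"] eq_nat_nat_iff[of "\<bar>x\<bar>" "\<bar>y\<bar> + \<bar>x - y\<bar>"]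
      abs_ge_zero add_nonneg_nonneg by metis
  also have "\<dots> \<longleftrightarrow> y = 0 \<or> (x * y > 0 \<and> \<bar>y\<bar> \<le> \<bar>x\<bar>)"
  proof (cases "y < 0")
    case True
    then show ?thesis unfolding zero_less_mult_iff by (cases "x < y") (simp_all, linarith)
  next
    case False
    then show ?thesis unfolding zero_less_mult_iff
      by (cases "x < y"; cases "y = 0"; cases "x < 0") simp_all
  qed
  finally show ?thesis .
qed

text \<open>The triangle inequality holds coefficient by coefficient, and the sums agree only if it
  is an equality at every coefficient, that is, if \<open>d\<close> takes a part of each coefficient
  of \<open>c\<close> with the same sign. Absence of cancellation thereby becomes linear arithmetic
  on lengths.\<close>

lemma subchain_iff_length:
  "subchain d c \<longleftrightarrow> chain_length c = chain_length d + chain_length (c - d)"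
proof -
  let ?S = "terms c \<union> terms d"
  let ?l = "\<lambda>f. nat \<bar>coeff c f\<bar>"
  let ?r = "\<lambda>f. nat \<bar>coeff d f\<bar> + nat \<bar>coeff c f - coeff d f\<bar>"
  have sub: "terms (c - d) \<subseteq> ?S" using keys_diff[of c d] by auto
  have lc: "chain_length c = (\<Sum>f\<in>?S. ?l f)"
    by (rule chain_length_superset) auto
  have ld: "chain_length d + chain_length (c - d) = (\<Sum>f\<in>?S. ?r f)"
    by (simp add: sum.distrib chain_length_superset[OF _ sub] chain_length_superset[of ?S d]
        lookup_minus)
  have le: "?l f \<le> ?r f" for f
    using abs_triangle_ineq[of "coeff d f" "coeff c f - coeff d f"]
    by (simp flip: nat_add_distrib)
  have "chain_length c = chain_length d + chain_length (c - d) \<longleftrightarrow> (\<forall>f\<in>?S. ?l f = ?r f)"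
  proof
    assume "chain_length c = chain_length d + chain_length (c - d)"
    then have eq: "(\<Sum>f\<in>?S. ?l f) = (\<Sum>f\<in>?S. ?r f)"
      unfolding lc ld .
    show "\<forall>f\<in>?S. ?l f = ?r f"
    proof
      fix f assume f: "f \<in> ?S"
      show "?l f = ?r f"
        by (rule sum_mono_inv[where f = ?l and g = ?r and I = ?S, OF eq le f]) simp
    qed
  next
    assume "\<forall>f\<in>?S. ?l f = ?r f"
    then show "chain_length c = chain_length d + chain_length (c - d)"
      unfolding lc ld by (intro sum.cong) auto
  qed
  also have "\<dots> \<longleftrightarrow> (\<forall>f\<in>?S. coeff d f = 0 \<or>
      (coeff c f * coeff d f > 0 \<and> \<bar>coeff d f\<bar> \<le> \<bar>coeff c f\<bar>))"
    unfolding nat_abs_split_iff ..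
  also have "\<dots> \<longleftrightarrow> subchain d c"
  proof -
    have "f \<in> terms c" if "coeff c f * coeff d f > 0" for f
      using that by (cases "coeff c f = 0") (simp_all add: in_keys_iff)
    then show ?thesis
      unfolding subchain_def subset_iff Ball_def Un_iff in_keys_iff by blast
  qed
  finally show ?thesis ..
qed

lemma subchain_diff: "subchain d c \<Longrightarrow> subchain (c - d) c"
  by (simp add: subchain_iff_length)

lemma subchain_add:
  "chain_length (c + d) = chain_length c + chain_length d \<Longrightarrow> subchain c (c + d)"
  "chain_length (c + d) = chain_length c + chain_length d \<Longrightarrow> subchain d (c + d)"
  by (auto simp: subchain_iff_length)

lemma subchain_refl: "subchain c c"
  by (auto simp: subchain_def in_keys_iff zero_less_mult_iff)

lemma subchain_terms: "subchain d c \<Longrightarrow> terms d \<subseteq> terms c"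
  by (simp add: subchain_def)

lemma subchain_group: "subchain d c \<Longrightarrow> c \<in> chain_group A B n \<Longrightarrow> d \<in> chain_group A B n"
  unfolding chain_group_def using subchain_terms by blast

lemma subchain_csupp: "subchain d c \<Longrightarrow> csupp d \<subseteq> csupp c"
  unfolding csupp_def using subchain_terms by blast

lemma subchain_sterm:
  assumes "coeff c f * e > 0" "\<bar>e\<bar> = 1"
  shows "subchain (sterm e f) c"
  using assms by (auto simp: subchain_def zero_less_mult_iff in_keys_iff split: if_splits)

lemma chain_group_add:
  "c \<in> chain_group A B n \<Longrightarrow> d \<in> chain_group A B n \<Longrightarrow> c + d \<in> chain_group A B n"
  using keys_add[of c d] by (auto simp: chain_group_def)

lemma chain_group_diff:
  "c \<in> chain_group A B n \<Longrightarrow> d \<in> chain_group A B n \<Longrightarrow> c - d \<in> chain_group A B n"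
  using keys_diff[of c d] by (auto simp: chain_group_def)

lemma chain_group_sterm:
  "f \<in> simplices A B n \<Longrightarrow> sterm e f \<in> chain_group A B n"
  by (auto simp: chain_group_def)

text \<open>The linear extension of a weight on simplices to chains. Two weights matter later: the
  constant 1, for parity, and the signed incidence with a vertex.\<close>

definition pairing :: "('a \<Rightarrow> int) \<Rightarrow> ('a \<Rightarrow>\<^sub>0 int) \<Rightarrow> int" where
  "pairing \<phi> c = (\<Sum>f\<in>terms c. coeff c f * \<phi> f)"

lemma pairing_superset:
  assumes "finite S" "terms c \<subseteq> S"
  shows "pairing \<phi> c = (\<Sum>f\<in>S. coeff c f * \<phi> f)"
  unfolding pairing_def
  by (rule sum.mono_neutral_left) (use assms in \<open>auto simp: in_keys_iff\<close>)

lemma pairing_0 [simp]: "pairing \<phi> 0 = 0"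
  by (simp add: pairing_def)

lemma pairing_frag_of [simp]: "pairing \<phi> (frag_of f) = \<phi> f"
  by (simp add: pairing_def)

lemma pairing_add [simp]: "pairing \<phi> (c + d) = pairing \<phi> c + pairing \<phi> d"
proof -
  let ?S = "terms c \<union> terms d"
  have "pairing \<phi> (c + d) = (\<Sum>f\<in>?S. coeff (c + d) f * \<phi> f)"
    using keys_add[of c d] by (subst pairing_superset[of ?S]) auto
  then show ?thesis
    by (simp add: lookup_add algebra_simps sum.distrib pairing_superset[of ?S])
qed

lemma pairing_cmul [simp]: "pairing \<phi> (frag_cmul e c) = e * pairing \<phi> c"
proof -
  have "pairing \<phi> (frag_cmul e c) = (\<Sum>f\<in>terms c. coeff (frag_cmul e c) f * \<phi> f)"
    using keys_cmul[of e c] by (subst pairing_superset[of "terms c"]) auto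
  then show ?thesis by (simp add: pairing_def sum_distrib_left algebra_simps)
qed

lemma pairing_minus [simp]: "pairing \<phi> (- c) = - pairing \<phi> c"
  using pairing_cmul[of \<phi> "-1" c] by simp

lemma pairing_diff [simp]: "pairing \<phi> (c - d) = pairing \<phi> c - pairing \<phi> d"
  unfolding diff_conv_add_uminus[of c d] pairing_add pairing_minus by simp

lemma pairing_frag_extend:
  "pairing \<phi> (frag_extend b c) = (\<Sum>f\<in>terms c. coeff c f * pairing \<phi> (b f))"
proof -
  have "pairing \<phi> (sum g S) = (\<Sum>i\<in>S. pairing \<phi> (g i))" if "finite S" for g and S :: "'b set"
    using that by induction auto
  then show ?thesis by (simp add: frag_extend_def)
qed

lemma coeff_frag_extend: "coeff (frag_extend b c) e = (\<Sum>f\<in>terms c. coeff c f * coeff (b f) e)"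
  by (simp add: frag_extend_def lookup_sum)

section \<open>Linearity and coefficients of the boundary\<close>

lemma boundary_add: "boundary (c + d) = boundary c + boundary d"
  by (simp add: boundary_def frag_extend_add)

lemma boundary_diff: "boundary (c - d) = boundary c - boundary d"
  by (simp add: boundary_def frag_extend_diff)

lemma boundary_cmul: "boundary (frag_cmul e c) = frag_cmul e (boundary c)"
  by (simp add: boundary_def frag_extend_cmul)

lemma boundary_0 [simp]: "boundary 0 = 0"
  by (simp add: boundary_def)

lemma boundary_pairing:
  "pairing \<phi> (boundary c) = (\<Sum>f\<in>terms c. coeff c f * pairing \<phi> (boundary (frag_of f)))"
  by (simp add: boundary_def pairing_frag_extend)

lemma boundary_coeff:
  "coeff (boundary c) e = (\<Sum>f\<in>terms c. coeff c f * coeff (boundary (frag_of f)) e)"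
  by (simp add: boundary_def coeff_frag_extend)

lemma terms_boundary: "terms (boundary c) \<subseteq> (\<Union>f\<in>terms c. terms (boundary (frag_of f)))"
  unfolding boundary_def frag_extend_of by (rule keys_frag_extend)

text \<open>A positive sum has a positive summand. The factor \<open>s\<close> carries a sign, so
  that positive and negative coefficients are treated at once.\<close>

lemma boundary_term:
  assumes "coeff (boundary c) e * s > 0"
  obtains f where "f \<in> terms c" "coeff c f * coeff (boundary (frag_of f)) e * s > 0"
proof -
  let ?g = "\<lambda>f. coeff c f * coeff (boundary (frag_of f)) e * s"
  have "coeff (boundary c) e * s = sum ?g (terms c)"
    by (subst boundary_coeff) (rule sum_distrib_right)
  then have "\<not> (\<forall>f\<in>terms c. ?g f \<le> 0)"
    using assms sum_nonpos[of "terms c" ?g] by (metis not_less)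
  then show thesis using that by (meson not_less)
qed

subsection \<open>Oriented triangles\<close>

definition ort :: "nat \<Rightarrow> nat \<Rightarrow> int" where
  "ort a b = (if a < b then 1 else -1)"

text \<open>For distinct arguments the product of the three comparison signs is -1 to the number of
  inversions, hence the sign of the permutation that sorts \<open>a\<close>, \<open>b\<close>,
  \<open>c\<close>.\<close>

definition ort3 :: "nat \<Rightarrow> nat \<Rightarrow> nat \<Rightarrow> int" where
  "ort3 a b c = ort a b * ort b c * ort a c"

lemma ort_unit [simp]: "\<bar>ort a b\<bar> = 1" "ort a b * ort a b = 1" "ort a b \<noteq> 0" "ort a b * (ort a b * x) = x"
  by (auto simp: ort_def)

lemma ort3_unit [simp]: "\<bar>ort3 a b c\<bar> = 1" "ort3 a b c * ort3 a b c = 1" "ort3 a b c \<noteq> 0"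
    "ort3 a b c * (ort3 a b c * x) = x"
  by (auto simp: ort3_def ort_def)

lemma ort3_swap:
  assumes "a \<noteq> b" "b \<noteq> c" "a \<noteq> c"
  shows "ort3 b a c = - ort3 a b c" "ort3 a c b = - ort3 a b c" "ort3 c b a = - ort3 a b c"
    "ort3 b c a = ort3 a b c" "ort3 c a b = ort3 a b c"
  using assms by (auto simp: ort3_def ort_def)

definition edge :: "('o, 'm) pfun \<Rightarrow> nat \<Rightarrow> nat \<Rightarrow> ('o, 'm) pfun" where
  "edge f a b = restr f (Pow {a, b})"

lemma edge_commute: "edge f a b = edge f b a"
  by (simp add: edge_def insert_commute)

lemma boundary_triangle_sorted:
  assumes "psupp f = {a, b, c}" "a < b" "b < c"
  shows "face 0 f = edge f b c" "face 1 f = edge f a c" "face 2 f = edge f a b"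
    "boundary (frag_of f) = frag_of (edge f b c) - frag_of (edge f a c) + frag_of (edge f a b)"
proof -
  have sl: "sorted_list_of_set {a, b, c} = [a, b, c]"
    using assms by (simp add: sorted_list_of_set_nonempty)
  have d: "{a, b, c} - {a} = {b, c}" "{a, b, c} - {b} = {a, c}" "{a, b, c} - {c} = {a, b}"
    using assms by auto
  show f: "face 0 f = edge f b c" "face 1 f = edge f a c" "face 2 f = edge f a b"
    by (simp_all add: face_def edge_def assms(1) sl d eval_nat_numeral del: insert_Diff_single)
  have "card (psupp f) = 3" using assms by simp
  then show "boundary (frag_of f) = frag_of (edge f b c) - frag_of (edge f a c) + frag_of (edge f a b)"
    using f by (simp add: boundary_def eval_nat_numeral)
qed

text \<open>Exchanging two vertices changes the sign of \<open>ort3\<close> and of the bracket, so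
  the formula for the increasing order persists for every order. As \<open>ort3\<close> squares to
  1, the coefficient \<open>ort3 a b c\<close> turns \<open>f\<close> into the oriented triangle
  \<open>a\<close>, \<open>b\<close>, \<open>c\<close>.\<close>

lemma boundary_triangle:
  assumes "psupp f = {a, b, c}" "a \<noteq> b" "b \<noteq> c" "a \<noteq> c"
  shows "boundary (frag_of f) = frag_cmul (ort3 a b c)
    (sterm (ort b c) (edge f b c) - sterm (ort a c) (edge f a c) + sterm (ort a b) (edge f a b))"
proof -
  have perm: "psupp f = {a, c, b}" "psupp f = {b, a, c}" "psupp f = {b, c, a}"
      "psupp f = {c, a, b}" "psupp f = {c, b, a}"
    using assms(1) by auto
  note ib = boundary_triangle_sorted(4)
  consider "a < b" "b < c" | "a < c" "c < b" | "b < a" "a < c" | "b < c" "c < a"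
    | "c < a" "a < b" | "c < b" "b < a"
    using assms(2-4) by (metis linorder_neqE_nat)
  then show ?thesis
  proof cases
    case 1
    then show ?thesis
      unfolding ib[OF assms(1) 1] by (simp add: ort3_def ort_def)
  next
    case 2
    then show ?thesis
      unfolding ib[OF perm(1) 2] edge_commute[of f c b] by (simp add: ort3_def ort_def)
  next
    case 3
    then show ?thesis
      unfolding ib[OF perm(2) 3] edge_commute[of f b a] by (simp add: ort3_def ort_def)
  next
    case 4
    then show ?thesis
      unfolding ib[OF perm(3) 4] edge_commute[of f b a] edge_commute[of f c a]
      by (simp add: ort3_def ort_def)
  next
    case 5
    then show ?thesis
      unfolding ib[OF perm(4) 5] edge_commute[of f c b] edge_commute[of f c a]
      by (simp add: ort3_def ort_def)
  next
    case 6
    then show ?thesis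
      unfolding ib[OF perm(5) 6] edge_commute[of f c b] edge_commute[of f b a]
        edge_commute[of f c a]
      by (simp add: ort3_def ort_def)
  qed
qed

subsection \<open>Restrictions and flips\<close>

lemma pdom_mk_pfun [simp]: "pdom (mk_pfun X F M) = X"
  by (simp add: mk_pfun_def)

lemma pob_mk_pfun [simp]: "u \<in> X \<Longrightarrow> pob (mk_pfun X F M) u = F u"
  by (simp add: mk_pfun_def)

lemma pmor_mk_pfun [simp]:
  "u \<in> X \<Longrightarrow> v \<in> X \<Longrightarrow> u \<subseteq> v \<Longrightarrow> pmor (mk_pfun X F M) u v = M u v"
  by (simp add: mk_pfun_def)

lemma mk_pfun_cong:
  assumes "X = Y" "\<And>u. u \<in> X \<Longrightarrow> F u = G u"
    "\<And>u v. u \<in> X \<Longrightarrow> v \<in> X \<Longrightarrow> u \<subseteq> v \<Longrightarrow> M u v = N u v"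
  shows "mk_pfun X F M = mk_pfun Y G N"
  using assms by (auto simp: mk_pfun_def fun_eq_iff)

lemma restr_restr: "restr (restr f X) Y = restr f (X \<inter> Y)"
  unfolding restr_def by (rule mk_pfun_cong) auto

lemma restr_Pow: "t \<subseteq> s \<Longrightarrow> restr (restr f (Pow s)) (Pow t) = restr f (Pow t)"
  by (simp add: restr_restr Int_absorb1 flip: Pow_Int_eq)

lemma psupp_Pow: "pdom f = Pow s \<Longrightarrow> psupp f = s"
  by (simp add: psupp_def)

lemma pdom_restr_Pow: "pdom f = Pow s \<Longrightarrow> t \<subseteq> s \<Longrightarrow> pdom (restr f (Pow t)) = Pow t"
  by (auto simp: restr_def)

lemma psupp_restr_Pow: "pdom f = Pow s \<Longrightarrow> t \<subseteq> s \<Longrightarrow> psupp (restr f (Pow t)) = t"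
  by (intro psupp_Pow pdom_restr_Pow)

lemma simplexD:
  assumes "f \<in> simplices A B n"
  shows "f \<in> A" "pdom f = Pow (psupp f)" "card (psupp f) = n + 1" "finite (psupp f)" "pob f {} = B"
proof -
  obtain s where s: "card s = n + 1" "pdom f = Pow s"
    using assms unfolding simplices_def by blast
  have p: "psupp f = s" using s(2) by (rule psupp_Pow)
  show "f \<in> A" "pob f {} = B" using assms unfolding simplices_def by blast+
  show "pdom f = Pow (psupp f)" "card (psupp f) = n + 1" using s p by simp_all
  then show "finite (psupp f)" by (metis Suc_eq_plus1 card.infinite nat.distinct(1))
qed

lemma simplexI:
  "f \<in> A \<Longrightarrow> pdom f = Pow s \<Longrightarrow> card s = n + 1 \<Longrightarrow> pob f {} = B \<Longrightarrow> f \<in> simplices A B n"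
  unfolding simplices_def by blast

lemma triangle_with_vertex:
  assumes f: "f \<in> simplices A B 2" and v: "v \<in> psupp f"
  obtains x y where "psupp f = {v, x, y}" "v \<noteq> x" "x \<noteq> y" "v \<noteq> y"
proof -
  have "card (psupp f - {v}) = 2" using simplexD(3,4)[OF f] v by simp
  then obtain x y where xy: "psupp f - {v} = {x, y}" "x \<noteq> y" by (meson card_2_iff)
  then have "psupp f = {v, x, y}" "v \<noteq> x" "v \<noteq> y" using v by blast+
  then show thesis using that xy(2) by blast
qed

lemma edge_extends:
  assumes "extends g f" "pdom f = Pow s" "{a, b} \<subseteq> s"
  shows "edge g a b = edge f a b"
proof -
  have f: "f = restr g (Pow s)" using assms(1,2) unfolding extends_def by simp
  show ?thesis unfolding edge_def by (subst f) (rule restr_Pow[OF assms(3), symmetric])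
qed

lemma edge_restr: "{a, b} \<subseteq> t \<Longrightarrow> edge (restr f (Pow t)) a b = edge f a b"
  unfolding edge_def by (rule restr_Pow)

lemma psupp_edge: "f \<in> simplices A B n \<Longrightarrow> {a, b} \<subseteq> psupp f \<Longrightarrow> psupp (edge f a b) = {a, b}"
  unfolding edge_def by (rule psupp_restr_Pow[OF simplexD(2)])

section \<open>CR-operations as flips of oriented quadrilaterals\<close>

lemma card_filter_pair_ne_1:
  "a \<noteq> b \<Longrightarrow> card {x \<in> {a, b}. P x} \<noteq> 1 \<longleftrightarrow> (P a \<longleftrightarrow> P b)"
proof -
  assume "a \<noteq> b"
  moreover have "{x \<in> {a, b}. P x} = (if P a then {a} else {}) \<union> (if P b then {b} else {})" by auto
  ultimately show ?thesis by auto
qed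

text \<open>The letters \<open>a\<close> to \<open>f\<close> are the truth values of l1 < l2, l1 <
  k1, l1 < k2, l2 < k1, l2 < k2 and k1 < k2. The eight implications are transitivity of < and of its
  negation on the four triples; the remaining patterns are checked one by one.\<close>

lemma CR_sign_bool:
  fixes s :: "bool \<Rightarrow> int"
  assumes s: "\<And>x. s x = (if x then 1 else -1)"
    and "a \<and> d \<longrightarrow> b" "b \<longrightarrow> a \<or> d" "a \<and> e \<longrightarrow> c" "c \<longrightarrow> a \<or> e"
      "b \<and> f \<longrightarrow> c" "c \<longrightarrow> b \<or> f" "d \<and> f \<longrightarrow> e" "e \<longrightarrow> d \<or> f"
    and "e1 = 1 \<or> e1 = (-1 :: int)" "e2 = - (e1 * (s a * s d * s b) * (s a * s e * s c))"
  shows "(if e1 * e2 = -1 \<and> ((f \<and> \<not> e \<or> e \<and> \<not> f) \<longleftrightarrow> (\<not> b \<and> a \<or> \<not> a \<and> b)) then (e2, e1) else (e1, e2))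
    = (- (e1 * (s a * s d * s b) * (s b * s f * s c)), e1 * (s a * s d * s b) * (s d * s f * s e))"
  using assms(2-10) unfolding assms(11) s
  by (elim disjE; cases a; cases b; cases c; cases d; cases e; cases f) simp_all

text \<open>The last hypothesis says that the common edge is traversed in opposite directions, so
  that it cancels. Then the betweenness condition of the definition only decides which old sign goes
  to which new triangle, and it always picks the signs that orient the new triangles consistently
  with the old ones.\<close>

lemma CR_result_oriented:
  assumes "distinct [l1, l2, k1, k2]" "e1 \<in> {1, -1}" "e2 \<in> {1, -1}"
    "e1 * ort3 l1 l2 k1 = - (e2 * ort3 l1 l2 k2)"
  shows "CR_result l1 l2 k1 k2 e1 e2 \<mu> =
     sterm (- (e1 * ort3 l1 l2 k1 * ort3 l1 k1 k2)) (restr \<mu> (Pow {k1, k2, l1})) +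
     sterm (e1 * ort3 l1 l2 k1 * ort3 l2 k1 k2) (restr \<mu> (Pow {k1, k2, l2}))"
proof -
  let ?P = "\<lambda>x. min k1 l2 < x \<and> x < max k1 l2"
  have ne: "l1 \<noteq> l2" "l1 \<noteq> k1" "l1 \<noteq> k2" "l2 \<noteq> k1" "l2 \<noteq> k2" "k1 \<noteq> k2" using assms(1) by auto
  have e: "e1 = 1 \<or> e1 = -1" "e2 = 1 \<or> e2 = -1" using assms(2,3) by auto
  have P: "?P k2 \<longleftrightarrow> (k1 < k2 \<and> \<not> l2 < k2 \<or> l2 < k2 \<and> \<not> k1 < k2)"
    "?P l1 \<longleftrightarrow> (\<not> l1 < k1 \<and> l1 < l2 \<or> \<not> l1 < l2 \<and> l1 < k1)"
    using ne by (auto simp: min_def max_def)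
  have c: "card {x \<in> {k2, l1}. ?P x} \<noteq> 1 \<longleftrightarrow> (?P k2 \<longleftrightarrow> ?P l1)"
    by (rule card_filter_pair_ne_1) (use ne in auto)
  have tr: "x < y \<and> y < z \<longrightarrow> x < z" "x < z \<longrightarrow> x < y \<or> y < z" for x y z :: nat by auto
  have e2: "e2 = - (e1 * ort3 l1 l2 k1 * ort3 l1 l2 k2)" using assms(4) by (simp add: mult.assoc)
  have key: "(if e1 * e2 = -1 \<and> (?P k2 \<longleftrightarrow> ?P l1) then (e2, e1) else (e1, e2)) =
      (- (e1 * ort3 l1 l2 k1 * ort3 l1 k1 k2), e1 * ort3 l1 l2 k1 * ort3 l2 k1 k2)"
    using CR_sign_bool[where s = "\<lambda>x. if x then 1 else -1" and a = "l1 < l2" and b = "l1 < k1"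
        and c = "l1 < k2" and d = "l2 < k1" and e = "l2 < k2" and f = "k1 < k2",
        OF refl tr(1) tr(2) tr(1) tr(2) tr(1) tr(2) tr(1) tr(2) e(1) e2[unfolded ort3_def ort_def]]
    unfolding P ort3_def ort_def .
  define Q where "Q \<longleftrightarrow> e1 * e2 = -1 \<and> (?P k2 \<longleftrightarrow> ?P l1)"
  define X Y where "X = - (e1 * ort3 l1 l2 k1 * ort3 l1 k1 k2)" "Y = e1 * ort3 l1 l2 k1 * ort3 l2 k1 k2"
  have "(if Q then (e2, e1) else (e1, e2)) = (X, Y)"
    using key unfolding Q_def X_Y_def .
  then show ?thesis
    unfolding CR_result_def Let_def c Q_def[symmetric] X_Y_def[symmetric] by (cases Q) simp_all
qed

context amenable_family
begin

lemma simplex_eq_mk_pfun: "f \<in> simplices A B n \<Longrightarrow> f = mk_pfun (pdom f) (pob f) (pmor f)"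
  using functors[OF simplexD(1)] unfolding prim_functor_def by blast

lemma restr_simplex:
  assumes f: "f \<in> simplices A B n" and t: "t \<subseteq> psupp f" "card t = m + 1"
  shows "restr f (Pow t) \<in> simplices A B m"
proof (rule simplexI)
  show "restr f (Pow t) \<in> A"
    using local_character[OF functors[OF simplexD(1)[OF f]]] simplexD(1)[OF f] simplexD(2)[OF f] t(1)
    by blast
  show "pdom (restr f (Pow t)) = Pow t" by (rule pdom_restr_Pow[OF simplexD(2)[OF f] t(1)])
  show "pob (restr f (Pow t)) {} = B"
    using simplexD(2,5)[OF f] unfolding restr_def by simp
qed (rule t(2))

lemma edge_simplex:
  "f \<in> simplices A B n \<Longrightarrow> {a, b} \<subseteq> psupp f \<Longrightarrow> a \<noteq> b \<Longrightarrow> edge f a b \<in> simplices A B 1"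
  unfolding edge_def by (rule restr_simplex) auto

end

context nontrivial_amenable_family
begin

lemma amalgamate_triangles:
  assumes f: "f \<in> simplices A B 2" "psupp f = {p, q, v}"
    and g: "g \<in> simplices A B 2" "psupp g = {p, q, w}"
    and d: "distinct [p, q, v, w]" and eq: "edge f p q = edge g p q"
  obtains \<mu> where "\<mu> \<in> simplices A B 3" "psupp \<mu> = {p, q, v, w}" "extends \<mu> f" "extends \<mu> g"
proof -
  have s: "{p, q, v} \<inter> {p, q, w} = {p, q}" "{p, q, v} \<union> {p, q, w} = {p, q, v, w}" using d by auto
  have df: "pdom f = Pow {p, q, v}" "pdom g = Pow {p, q, w}"
    using simplexD(2)[OF f(1)] simplexD(2)[OF g(1)] f(2) g(2) by simp_all
  obtain h where h: "h \<in> A" "pdom h = Pow {p, q, v, w}" "extends h f" "extends h g"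
    using strong_two_amalgamation[of "{p, q, v}" "{p, q, w}" f g] df
      simplexD(1)[OF f(1)] simplexD(1)[OF g(1)] eq unfolding s edge_def by auto
  have "pob h {} = pob (restr h (pdom f)) {}" unfolding df restr_def h(2) by simp
  also have "\<dots> = B" using h(3) simplexD(5)[OF f(1)] unfolding extends_def by simp
  finally have "h \<in> simplices A B 3" using h(1,2) d by (intro simplexI) auto
  then show thesis using that h(2-4) psupp_Pow by blast
qed

text \<open>The triangles \<open>f\<close> and \<open>g\<close> fill a quadrilateral with sides
  \<open>qv\<close>, \<open>pv\<close>, \<open>qw\<close>, \<open>pw\<close> along the diagonal
  \<open>pq\<close>. A 3-simplex amalgamating them has two further faces, which fill it along
  \<open>vw\<close>. The four sides stay the same as functors, hence so does the boundary. The sign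
  \<open>\<epsilon>\<close> tells in which direction the quadrilateral is traversed.\<close>

lemma CR_flip:
  assumes c: "c \<in> chain_group A B 2"
    and f: "f \<in> simplices A B 2" "psupp f = {p, q, v}"
    and g: "g \<in> simplices A B 2" "psupp g = {p, q, w}"
    and d: "distinct [p, q, v, w]" and eq: "edge f p q = edge g p q"
    and e: "e \<in> {1, -1}" "e' \<in> {1, -1}" "e * ort3 p q v = - (e' * ort3 p q w)"
    and sub: "subchain (sterm e f + sterm e' g) c"
    and \<epsilon>: "\<epsilon> = e * ort3 p q v"
  obtains h h' where "h \<in> simplices A B 2" "psupp h = {q, v, w}"
    "h' \<in> simplices A B 2" "psupp h' = {p, v, w}"
    "edge h q v = edge f q v" "edge h q w = edge g q w"
    "edge h' p v = edge f p v" "edge h' p w = edge g p w" "edge h v w = edge h' v w"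
    "CR_step A B c (c - (sterm e f + sterm e' g) +
       (sterm (\<epsilon> * ort3 q v w) h - sterm (\<epsilon> * ort3 p v w) h'))"
    "boundary (sterm (\<epsilon> * ort3 q v w) h - sterm (\<epsilon> * ort3 p v w) h')
      = boundary (sterm e f + sterm e' g)"
proof -
  obtain \<mu> where \<mu>: "\<mu> \<in> simplices A B 3" "psupp \<mu> = {p, q, v, w}" "extends \<mu> f" "extends \<mu> g"
    using amalgamate_triangles[OF f g d eq] .
  define h where "h = restr \<mu> (Pow {v, w, q})"
  define h' where "h' = restr \<mu> (Pow {v, w, p})"
  have ne: "p \<noteq> q" "p \<noteq> v" "p \<noteq> w" "q \<noteq> v" "q \<noteq> w" "v \<noteq> w" using d by auto
  have pd: "pdom f = Pow {p, q, v}" "pdom g = Pow {p, q, w}" "pdom \<mu> = Pow {p, q, v, w}"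
    using simplexD(2)[OF f(1)] simplexD(2)[OF g(1)] simplexD(2)[OF \<mu>(1)] f(2) g(2) \<mu>(2) by simp_all
  have h: "h \<in> simplices A B 2" "psupp h = {q, v, w}"
    unfolding h_def using restr_simplex[OF \<mu>(1), of "{v, w, q}" 2] psupp_restr_Pow[OF pd(3), of "{v, w, q}"]
      \<mu>(2) ne by auto
  have h': "h' \<in> simplices A B 2" "psupp h' = {p, v, w}"
    unfolding h'_def using restr_simplex[OF \<mu>(1), of "{v, w, p}" 2] psupp_restr_Pow[OF pd(3), of "{v, w, p}"]
      \<mu>(2) ne by auto
  have E: "edge \<mu> a b = edge f a b" if "{a, b} \<subseteq> {p, q, v}" for a b
    by (rule edge_extends[OF \<mu>(3) pd(1) that])
  have E': "edge \<mu> a b = edge g a b" if "{a, b} \<subseteq> {p, q, w}" for a b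
    by (rule edge_extends[OF \<mu>(4) pd(2) that])
  have H: "edge h a b = edge \<mu> a b" if "{a, b} \<subseteq> {v, w, q}" for a b
    unfolding h_def by (rule edge_restr[OF that])
  have H': "edge h' a b = edge \<mu> a b" if "{a, b} \<subseteq> {v, w, p}" for a b
    unfolding h'_def by (rule edge_restr[OF that])
  have ee: "\<epsilon> = - (e' * ort3 p q w)" using \<epsilon> e(3) by simp
  have R: "CR_result p q v w e e' \<mu> = sterm (\<epsilon> * ort3 q v w) h - sterm (\<epsilon> * ort3 p v w) h'"
    unfolding CR_result_oriented[OF d e] h_def h'_def \<epsilon>
    unfolding diff_conv_add_uminus minus_frag_cmul by (rule add.commute)
  have bf: "boundary (sterm e f) = frag_cmul \<epsilon>
     (sterm (ort q v) (edge \<mu> q v) - sterm (ort p v) (edge \<mu> p v) + sterm (ort p q) (edge \<mu> p q))"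
    unfolding boundary_cmul boundary_triangle[OF f(2) ne(1,4,2)] \<epsilon> by (simp add: E)
  have bg: "boundary (sterm e' g) = - frag_cmul \<epsilon>
     (sterm (ort q w) (edge \<mu> q w) - sterm (ort p w) (edge \<mu> p w) + sterm (ort p q) (edge \<mu> p q))"
    unfolding boundary_cmul boundary_triangle[OF g(2) ne(1,5,3)] ee by (simp add: E')
  have bh: "boundary (sterm (\<epsilon> * ort3 q v w) h) = frag_cmul \<epsilon>
     (sterm (ort v w) (edge \<mu> v w) - sterm (ort q w) (edge \<mu> q w) + sterm (ort q v) (edge \<mu> q v))"
    unfolding boundary_cmul boundary_triangle[OF h(2) ne(4,6,5)] by (simp add: H mult.assoc)
  have bh': "boundary (sterm (\<epsilon> * ort3 p v w) h') = frag_cmul \<epsilon>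
     (sterm (ort v w) (edge \<mu> v w) - sterm (ort p w) (edge \<mu> p w) + sterm (ort p v) (edge \<mu> p v))"
    unfolding boundary_cmul boundary_triangle[OF h'(2) ne(2,6,3)] by (simp add: H' mult.assoc)
  have bw: "boundary (sterm e f + sterm e' g) = frag_cmul \<epsilon>
     (sterm (ort q v) (edge \<mu> q v) - sterm (ort p v) (edge \<mu> p v)
      - sterm (ort q w) (edge \<mu> q w) + sterm (ort p w) (edge \<mu> p w))"
    unfolding boundary_add bf bg
    by (rule poly_mapping_eqI) (simp add: lookup_add lookup_minus algebra_simps del: lookup_frag_of)
  have bd: "boundary (sterm (\<epsilon> * ort3 q v w) h - sterm (\<epsilon> * ort3 p v w) h')
      = boundary (sterm e f + sterm e' g)"
    unfolding boundary_diff bh bh' bw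
    by (rule poly_mapping_eqI) (simp add: lookup_add lookup_minus algebra_simps del: lookup_frag_of)
  have ps: "psupp (edge \<mu> a b) = {a, b}" if "{a, b} \<subseteq> {p, q, v, w}" for a b
    using psupp_edge[OF \<mu>(1)] that \<mu>(2) by simp
  \<comment> \<open>Edges are told apart by their supports alone, so the diagonal differs from all
    four sides. This gives the side condition that the common edge is absent from the
    boundary.\<close>
  have psne: "edge \<mu> p q \<noteq> edge \<mu> a b" if "{a, b} \<subseteq> {p, q, v, w}" "{a, b} \<noteq> {p, q}" for a b
  proof
    assume "edge \<mu> p q = edge \<mu> a b"
    then have "{p, q} = {a, b}" using ps[OF that(1)] ps[of p q] by simp
    with that(2) show False by simp
  qed
  have ni: "edge f p q \<notin> terms (boundary (sterm e f + sterm e' g))"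
  proof -
    have "coeff (boundary (sterm e f + sterm e' g)) (edge \<mu> p q) = 0"
      unfolding bw using psne[of q v] psne[of p v] psne[of q w] psne[of p w] ne
      by (simp add: lookup_add lookup_minus doubleton_eq_iff)
    then show ?thesis using E[of p q] by (simp add: in_keys_iff)
  qed
  have st: "CR_step A B c (c - (sterm e f + sterm e' g) +
       (sterm (\<epsilon> * ort3 q v w) h - sterm (\<epsilon> * ort3 p v w) h'))"
    unfolding CR_step_def
    apply (rule exI[of _ "sterm e f + sterm e' g"])
    apply (rule exI[of _ f], rule exI[of _ g], rule exI[of _ e], rule exI[of _ e'])
    apply (rule exI[of _ p], rule exI[of _ q], rule exI[of _ v], rule exI[of _ w], rule exI[of _ \<mu>])
    using e(1,2) f g d sub eq ni \<mu>(1,3,4) R unfolding edge_def by (intro conjI refl) simp_all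
  show thesis
  proof (rule that[of h h'])
    show "edge h q v = edge f q v" "edge h q w = edge g q w" "edge h' p v = edge f p v"
      "edge h' p w = edge g p w" "edge h v w = edge h' v w"
      using H H' E E' by auto
  qed (fact h h' st bd)+
qed

end

subsection \<open>Relabelling\<close>

lemma sorted_list_of_set_3:
  "a < b \<Longrightarrow> b < c \<Longrightarrow> sorted_list_of_set {a, b, c} = [a, b, c :: nat]"
  by (simp add: sorted_list_of_set_nonempty)

text \<open>The definite description in \<open>relabel_sign\<close> has at most one solution because
  the increasing enumeration of the image lists no index twice. Hence exhibiting one permutation is
  enough.\<close>

lemma relabel_sign_eqI:
  assumes inj: "inj_on \<sigma> s" and q: "q permutes {..<card s}"
    and eq: "\<And>j. j < card s \<Longrightarrow> \<sigma> (sorted_list_of_set s ! j) = sorted_list_of_set (\<sigma> ` s) ! q j"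
  shows "relabel_sign \<sigma> s = sign q"
proof -
  have card: "card (\<sigma> ` s) = card s" using inj by (rule card_image)
  have "p = q" if p: "p permutes {..<card s}"
    "\<forall>j<card s. \<sigma> (sorted_list_of_set s ! j) = sorted_list_of_set (\<sigma> ` s) ! p j" for p
  proof
    fix j
    show "p j = q j"
    proof (cases "j < card s")
      case True
      have "p j < card s" "q j < card s"
        using permutes_in_image[OF p(1), of j] permutes_in_image[OF q, of j] True by simp_all
      moreover have "sorted_list_of_set (\<sigma> ` s) ! p j = sorted_list_of_set (\<sigma> ` s) ! q j"
        using p(2) eq True by metis
      ultimately show ?thesis
        using nth_eq_iff_index_eq[of "sorted_list_of_set (\<sigma> ` s)" "p j" "q j"] card by simp
    next
      case False
      then show ?thesis using permutes_not_in[OF p(1)] permutes_not_in[OF q] by simp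
    qed
  qed
  then have "(THE p. p permutes {..<card s} \<and>
      (\<forall>j<card s. \<sigma> (sorted_list_of_set s ! j) = sorted_list_of_set (\<sigma> ` s) ! p j)) = q"
    using q eq by (intro the_equality) blast+
  then show ?thesis unfolding relabel_sign_def by simp
qed

lemma relabel_sign_sorted:
  assumes lt: "a < b" "b < c" and inj: "inj_on \<sigma> {a, b, c}"
  shows "relabel_sign \<sigma> {a, b, c} = ort3 (\<sigma> a) (\<sigma> b) (\<sigma> c)"
proof -
  have c3: "card {a, b, c} = 3" using lt by simp
  have sl: "sorted_list_of_set {a, b, c} = [a, b, c]" by (rule sorted_list_of_set_3[OF lt])
  have ne: "\<sigma> a \<noteq> \<sigma> b" "\<sigma> b \<noteq> \<sigma> c" "\<sigma> a \<noteq> \<sigma> c" using inj lt by (auto simp: inj_on_def)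
  have main: "relabel_sign \<sigma> {a, b, c} = sign q"
    if "q permutes {..<3}" "sorted_list_of_set (\<sigma> ` {a, b, c}) = t"
      "\<sigma> a = t ! q 0" "\<sigma> b = t ! q 1" "\<sigma> c = t ! q 2" for q t
  proof (rule relabel_sign_eqI[OF inj])
    show "q permutes {..<card {a, b, c}}" unfolding c3 by (rule that(1))
    fix j assume "j < card {a, b, c}"
    then have "j = 0 \<or> j = 1 \<or> j = 2" unfolding c3 by auto
    then show "\<sigma> (sorted_list_of_set {a, b, c} ! j) = sorted_list_of_set (\<sigma> ` {a, b, c}) ! q j"
      unfolding sl that(2) using that(3-5) by auto
  qed
  have tr: "Transposition.transpose i j permutes {..<3}" if "i < 3" "j < 3" for i j :: nat
    by (rule permutes_swap_id) (use that in auto)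
  have p: "permutation (Transposition.transpose i j)" for i j :: nat
    by (rule permutation_swap_id)
  consider "\<sigma> a < \<sigma> b" "\<sigma> b < \<sigma> c" | "\<sigma> a < \<sigma> c" "\<sigma> c < \<sigma> b" | "\<sigma> b < \<sigma> a" "\<sigma> a < \<sigma> c"
    | "\<sigma> b < \<sigma> c" "\<sigma> c < \<sigma> a" | "\<sigma> c < \<sigma> a" "\<sigma> a < \<sigma> b" | "\<sigma> c < \<sigma> b" "\<sigma> b < \<sigma> a"
    using ne by (metis linorder_neqE_nat)
  then show ?thesis
  proof cases
    case 1
    have "sorted_list_of_set (\<sigma> ` {a, b, c}) = [\<sigma> a, \<sigma> b, \<sigma> c]"
      using sorted_list_of_set_3[OF 1] by simp
    from main[OF permutes_id this] show ?thesis using 1 by (simp add: ort3_def ort_def sign_id)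
  next
    case 2
    have "sorted_list_of_set (\<sigma> ` {a, b, c}) = [\<sigma> a, \<sigma> c, \<sigma> b]"
      using sorted_list_of_set_3[OF 2] by (simp add: insert_commute)
    from main[OF tr[of 1 2] this] show ?thesis using 2
      by (simp add: ort3_def ort_def sign_swap_id transpose_def)
  next
    case 3
    have "sorted_list_of_set (\<sigma> ` {a, b, c}) = [\<sigma> b, \<sigma> a, \<sigma> c]"
      using sorted_list_of_set_3[OF 3] by (simp add: insert_commute)
    from main[OF tr[of 0 1] this] show ?thesis using 3
      by (simp add: ort3_def ort_def sign_swap_id transpose_def)
  next
    case 4
    have "sorted_list_of_set (\<sigma> ` {a, b, c}) = [\<sigma> b, \<sigma> c, \<sigma> a]"
      using sorted_list_of_set_3[OF 4] by (simp add: insert_commute)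
    from main[OF permutes_compose[OF tr[of 0 2] tr[of 0 1]] this] show ?thesis using 4
      by (simp add: ort3_def ort_def sign_swap_id transpose_def sign_compose[OF p p])
  next
    case 5
    have "sorted_list_of_set (\<sigma> ` {a, b, c}) = [\<sigma> c, \<sigma> a, \<sigma> b]"
      using sorted_list_of_set_3[OF 5] by (simp add: insert_commute)
    from main[OF permutes_compose[OF tr[of 0 1] tr[of 0 2]] this] show ?thesis using 5
      by (simp add: ort3_def ort_def sign_swap_id transpose_def sign_compose[OF p p])
  next
    case 6
    have "sorted_list_of_set (\<sigma> ` {a, b, c}) = [\<sigma> c, \<sigma> b, \<sigma> a]"
      using sorted_list_of_set_3[OF 6] by (simp add: insert_commute)
    from main[OF tr[of 0 2] this] show ?thesis using 6
      by (simp add: ort3_def ort_def sign_swap_id transpose_def)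
  qed
qed

text \<open>Both enumerations in the definition of the sign are increasing, so it compares the
  sorting permutations before and after relabelling. Consequently a relabelling carries the oriented
  triangle \<open>a\<close>, \<open>b\<close>, \<open>c\<close> to the oriented triangle of the
  images, whatever the order of the indices.\<close>

lemma relabel_sign_oriented:
  assumes ne: "a \<noteq> b" "b \<noteq> c" "a \<noteq> c" and inj: "inj \<sigma>"
  shows "relabel_sign \<sigma> {a, b, c} = ort3 a b c * ort3 (\<sigma> a) (\<sigma> b) (\<sigma> c)"
proof -
  have ne': "\<sigma> a \<noteq> \<sigma> b" "\<sigma> b \<noteq> \<sigma> c" "\<sigma> a \<noteq> \<sigma> c" using ne inj by (auto simp: inj_def)
  note s = relabel_sign_sorted[OF _ _ inj_on_subset[OF inj subset_UNIV]]
  note sw = ort3_swap[OF ne] ort3_swap[OF ne']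
  have one: "ort3 x y z = 1" if "x < y" "y < z" for x y z using that by (simp add: ort3_def ort_def)
  have perm: "{a, b, c} = {a, c, b}" "{a, b, c} = {b, a, c}" "{a, b, c} = {b, c, a}"
      "{a, b, c} = {c, a, b}" "{a, b, c} = {c, b, a}"
    by auto
  consider "a < b" "b < c" | "a < c" "c < b" | "b < a" "a < c" | "b < c" "c < a"
    | "c < a" "a < b" | "c < b" "b < a"
    using ne by (metis linorder_neqE_nat)
  then show ?thesis
  proof cases
    case 1 show ?thesis unfolding s[OF 1] using one[OF 1] by simp
  next
    case 2 show ?thesis unfolding perm(1) s[OF 2] using one[OF 2] sw by simp
  next
    case 3 show ?thesis unfolding perm(2) s[OF 3] using one[OF 3] sw by simp
  next
    case 4 show ?thesis unfolding perm(3) s[OF 4] using one[OF 4] sw by simp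
  next
    case 5 show ?thesis unfolding perm(4) s[OF 5] using one[OF 5] sw by simp
  next
    case 6 show ?thesis unfolding perm(5) s[OF 6] using one[OF 6] sw by simp
  qed
qed

lemma inv_into_image_subset:
  assumes "inj_on \<sigma> s" "u \<subseteq> \<sigma> ` t" "t \<subseteq> s"
  shows "inv_into s \<sigma> ` u = inv_into t \<sigma> ` u" "inv_into t \<sigma> ` u \<subseteq> t"
proof -
  obtain w where w: "w \<subseteq> t" "u = \<sigma> ` w" using assms(2) by (meson subset_imageE)
  then show "inv_into s \<sigma> ` u = inv_into t \<sigma> ` u" "inv_into t \<sigma> ` u \<subseteq> t"
    using inv_into_image_cancel[OF assms(1), of w]
      inv_into_image_cancel[OF inj_on_subset[OF assms(1,3)], of w] assms(3) by auto
qed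

lemma pdom_permute: "pdom f = Pow s \<Longrightarrow> pdom (permute t \<sigma> f) = Pow (\<sigma> ` s)"
  by (simp add: permute_def image_Pow_surj)

text \<open>The inverse of \<open>\<sigma>\<close> is formed on \<open>s\<close> on one side and on
  \<open>t\<close> on the other; by injectivity both give the same preimage for every subset of the
  image of \<open>t\<close>.\<close>

lemma restr_permute:
  assumes f: "pdom f = Pow s" and inj: "inj_on \<sigma> s" and t: "t \<subseteq> s"
  shows "restr (permute s \<sigma> f) (Pow (\<sigma> ` t)) = permute t \<sigma> (restr f (Pow t))"
proof -
  note dp = pdom_permute[OF f, of s \<sigma>] pdom_permute[OF pdom_restr_Pow[OF f t], of t \<sigma>]
  have dd: "(`) \<sigma> ` pdom (restr f (Pow t)) = Pow (\<sigma> ` t)"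
    using pdom_restr_Pow[OF f t] by (simp add: image_Pow_surj)
  have tt: "\<sigma> ` t \<subseteq> \<sigma> ` s" using t by (rule image_mono)
  then have st: "Pow (\<sigma> ` s) \<inter> Pow (\<sigma> ` t) = Pow (\<sigma> ` t)" by blast
  have ds: "(`) \<sigma> ` pdom f = Pow (\<sigma> ` s)" using f by (simp add: image_Pow_surj)
  have m: "u \<subseteq> \<sigma> ` s" if "u \<in> Pow (\<sigma> ` t)" for u using that tt by blast
  note iv = inv_into_image_subset[OF inj _ t]
  show ?thesis
    unfolding restr_def[of "permute s \<sigma> f"] dp st permute_def[of t] dd
  proof (rule mk_pfun_cong[OF refl])
    fix u assume u: "u \<in> Pow (\<sigma> ` t)"
    have "inv_into t \<sigma> ` u \<subseteq> t" "inv_into s \<sigma> ` u = inv_into t \<sigma> ` u" using iv u by auto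
    then show "pob (permute s \<sigma> f) u = pob (restr f (Pow t)) (inv_into t \<sigma> ` u)"
      unfolding permute_def ds restr_def f using m[OF u] t by (simp add: image_Pow_surj)
  next
    fix u v assume uv: "u \<in> Pow (\<sigma> ` t)" "v \<in> Pow (\<sigma> ` t)" "u \<subseteq> v"
    have "inv_into t \<sigma> ` v \<subseteq> t" "inv_into s \<sigma> ` v = inv_into t \<sigma> ` v"
      "inv_into t \<sigma> ` u \<subseteq> t" "inv_into s \<sigma> ` u = inv_into t \<sigma> ` u" using iv uv by auto
    then show "pmor (permute s \<sigma> f) u v = pmor (restr f (Pow t)) (inv_into t \<sigma> ` u) (inv_into t \<sigma> ` v)"
      unfolding permute_def ds restr_def f using m[OF uv(1)] m[OF uv(2)] t uv(3)
      by (simp add: image_mono image_Pow_surj)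
  qed
qed

lemma edge_permute:
  assumes "f \<in> simplices A B n" "inj \<sigma>" "{a, b} \<subseteq> psupp f"
  shows "edge (permute (psupp f) \<sigma> f) (\<sigma> a) (\<sigma> b) = permute {a, b} \<sigma> (edge f a b)"
  using restr_permute[OF simplexD(2)[OF assms(1)] inj_on_subset[OF assms(2)] assms(3)]
  by (simp add: edge_def)

text \<open>The companion of \<open>relabel_chain\<close> in dimension one, made to express that
  relabelling commutes with the boundary. For the increasing pair Min, Max the sign is simply
  \<open>ort\<close> of the images, so no permutation has to be described.\<close>

definition relabel_edges :: "(nat \<Rightarrow> nat) \<Rightarrow> ('o, 'm) chain \<Rightarrow> ('o, 'm) chain" where
  "relabel_edges \<sigma> = frag_extend (\<lambda>e. sterm (ort (\<sigma> (Min (psupp e))) (\<sigma> (Max (psupp e))))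
     (permute (psupp e) \<sigma> e))"

lemma relabel_edges_oriented:
  assumes "psupp e = {a, b}" "a \<noteq> b" "inj \<sigma>"
  shows "relabel_edges \<sigma> (sterm (ort a b) e) = sterm (ort (\<sigma> a) (\<sigma> b)) (permute {a, b} \<sigma> e)"
proof -
  have "\<sigma> a \<noteq> \<sigma> b" using assms(2,3) by (auto simp: inj_def)
  then show ?thesis
    unfolding relabel_edges_def frag_extend_cmul frag_extend_of assms(1)
    using assms(2) by (cases "a < b") (auto simp: ort_def)
qed

context amenable_family
begin

text \<open>Closure under permutation applies only to what is already known to be a functor. The
  functor laws of the permuted simplex are those of \<open>f\<close> at the preimages.\<close>

lemma permute_simplex:
  assumes f: "f \<in> simplices A B n" and inj: "inj_on \<sigma> (psupp f)"
  shows "permute (psupp f) \<sigma> f \<in> simplices A B n" "psupp (permute (psupp f) \<sigma> f) = \<sigma> ` psupp f"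
proof -
  let ?s = "psupp f" and ?g = "permute (psupp f) \<sigma> f"
  let ?i = "\<lambda>u. inv_into ?s \<sigma> ` u"
  have fin: "finite ?s" by (rule simplexD(4)[OF f])
  have df: "pdom f = Pow ?s" by (rule simplexD(2)[OF f])
  have dg: "pdom ?g = Pow (\<sigma> ` ?s)" by (rule pdom_permute[OF df])
  have pf: "prim_functor C f" by (rule functors[OF simplexD(1)[OF f]])
  have ob: "pob ?g u = pob f (?i u)" if "u \<subseteq> \<sigma> ` ?s" for u
    using that df unfolding permute_def by (simp add: image_Pow_surj)
  have mor: "pmor ?g u v = pmor f (?i u) (?i v)" if "u \<subseteq> v" "v \<subseteq> \<sigma> ` ?s" for u v
    using that df unfolding permute_def by (simp add: image_Pow_surj)
  have i: "?i u \<subseteq> ?s" if "u \<subseteq> \<sigma> ` ?s" for u using inv_into_image_subset(2)[OF inj that] by simp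
  have i_mono: "?i u \<subseteq> ?i v" if "u \<subseteq> v" for u v using that by (rule image_mono)
  have pg: "prim_functor C ?g"
    unfolding prim_functor_def
  proof (intro conjI ballI impI)
    show "primitive (pdom ?g)" unfolding dg primitive_def using fin by blast
    show "?g = mk_pfun (pdom ?g) (pob ?g) (pmor ?g)"
      unfolding permute_def mk_pfun_def by (simp add: fun_eq_iff)
  next
    fix u assume u: "u \<in> pdom ?g"
    then have us: "u \<subseteq> \<sigma> ` ?s" using dg by simp
    show "pob ?g u \<in> Obj C"
      using pf i[OF us] unfolding ob[OF us] prim_functor_def df by blast
    show "pmor ?g u u = Ide C (pob ?g u)"
      using pf i[OF us] unfolding ob[OF us] mor[OF subset_refl us] prim_functor_def df by blast
    fix v assume v: "v \<in> pdom ?g" and uv: "u \<subseteq> v"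
    then have vs: "v \<subseteq> \<sigma> ` ?s" using dg by simp
    show "pmor ?g u v \<in> Hom C (pob ?g u) (pob ?g v)"
      using pf i[OF us] i[OF vs] i_mono[OF uv]
      unfolding ob[OF us] ob[OF vs] mor[OF uv vs] prim_functor_def df by blast
    fix w assume w: "w \<in> pdom ?g" and vw: "v \<subseteq> w"
    then have ws: "w \<subseteq> \<sigma> ` ?s" using dg by simp
    show "pmor ?g u w = Cmp C (pmor ?g v w) (pmor ?g u v)"
      using pf i[OF us] i[OF vs] i[OF ws] i_mono[OF uv] i_mono[OF vw]
      unfolding mor[OF uv vs] mor[OF vw ws] mor[OF order_trans[OF uv vw] ws] prim_functor_def df
      by blast
  qed
  have "is_permutation f ?g"
    unfolding is_permutation_def
    by (rule exI[of _ ?s], rule exI[of _ "\<sigma> ` ?s"], rule exI[of _ \<sigma>])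
       (use fin df dg inj in \<open>simp add: inj_on_imp_bij_betw\<close>)
  then have "?g \<in> A" using closed_permutation[OF simplexD(1)[OF f] pg] by blast
  moreover have "pob ?g {} = B" using ob[of "{}"] simplexD(5)[OF f] by simp
  moreover have "card (\<sigma> ` ?s) = n + 1" using card_image[OF inj] simplexD(3)[OF f] by simp
  ultimately show "?g \<in> simplices A B n" using dg by (intro simplexI)
  show "psupp ?g = \<sigma> ` ?s" by (rule psupp_Pow[OF dg])
qed

lemma permute_fixed:
  assumes f: "f \<in> simplices A B n" and fixd: "\<And>x. x \<in> psupp f \<Longrightarrow> \<sigma> x = x"
  shows "permute (psupp f) \<sigma> f = f"
proof -
  let ?s = "psupp f"
  have df: "pdom f = Pow ?s" by (rule simplexD(2)[OF f])
  have im: "\<sigma> ` u = u" if "u \<subseteq> ?s" for u using that fixd by (force simp: image_def)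
  have inj: "inj_on \<sigma> ?s" using fixd by (simp add: inj_on_def)
  have iv: "inv_into ?s \<sigma> ` u = u" if "u \<subseteq> ?s" for u
    using inv_into_image_cancel[OF inj that] im[OF that] by simp
  have dom: "(`) \<sigma> ` Pow ?s = Pow ?s" using im[of ?s] by (simp add: image_Pow_surj)
  have "permute ?s \<sigma> f = mk_pfun (Pow ?s) (pob f) (pmor f)"
    unfolding permute_def df dom by (rule mk_pfun_cong) (simp_all add: iv)
  then show ?thesis using simplex_eq_mk_pfun[OF f] df by simp
qed

lemma boundary_triangle_terms:
  assumes f: "f \<in> simplices A B 2" and e: "e \<in> terms (boundary (frag_of f))"
  obtains x y where "x \<noteq> y" "{x, y} \<subseteq> psupp f" "e = edge f x y"
proof -
  obtain v where "v \<in> psupp f" using simplexD(3)[OF f] by fastforce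
  from triangle_with_vertex[OF f this] obtain x y where
    p: "psupp f = {v, x, y}" "v \<noteq> x" "x \<noteq> y" "v \<noteq> y" .
  have "coeff (boundary (frag_of f)) e = 0" if "e \<noteq> edge f x y" "e \<noteq> edge f v y" "e \<noteq> edge f v x"
    unfolding boundary_triangle[OF p] using that by (simp add: lookup_add lookup_minus)
  then consider "e = edge f x y" | "e = edge f v y" | "e = edge f v x"
    using e by (auto simp: in_keys_iff)
  then show thesis
    by cases (use p that in blast)+
qed

lemma boundary_chain_group:
  assumes "d \<in> chain_group A B 2"
  shows "boundary d \<in> chain_group A B 1"
  unfolding chain_group_def
proof (intro CollectI subsetI)
  fix e assume "e \<in> terms (boundary d)"
  then obtain f where f: "f \<in> terms d" "e \<in> terms (boundary (frag_of f))"
    using terms_boundary by blast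
  then have fs: "f \<in> simplices A B 2" using assms unfolding chain_group_def by blast
  show "e \<in> simplices A B 1"
    by (rule boundary_triangle_terms[OF fs f(2)]) (use edge_simplex[OF fs] in blast)
qed

lemma boundary_relabel_simplex:
  assumes f: "f \<in> simplices A B 2" and inj: "inj \<sigma>"
  shows "boundary (relabel_chain \<sigma> (frag_of f)) = relabel_edges \<sigma> (boundary (frag_of f))"
proof -
  obtain v where "v \<in> psupp f" using simplexD(3)[OF f] by fastforce
  from triangle_with_vertex[OF f this] obtain x y where
    p: "psupp f = {v, x, y}" "v \<noteq> x" "x \<noteq> y" "v \<noteq> y" .
  have ne: "\<sigma> v \<noteq> \<sigma> x" "\<sigma> x \<noteq> \<sigma> y" "\<sigma> v \<noteq> \<sigma> y" using p(2-4) inj by (auto simp: inj_def)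
  let ?g = "permute (psupp f) \<sigma> f"
  have ps: "psupp ?g = {\<sigma> v, \<sigma> x, \<sigma> y}"
    using permute_simplex(2)[OF f inj_on_subset[OF inj subset_UNIV]] p(1) by simp
  have e: "relabel_edges \<sigma> (sterm (ort a b) (edge f a b)) = sterm (ort (\<sigma> a) (\<sigma> b)) (edge ?g (\<sigma> a) (\<sigma> b))"
    if "{a, b} \<subseteq> psupp f" "a \<noteq> b" for a b
    unfolding edge_permute[OF f inj that(1)]
    by (rule relabel_edges_oriented[OF psupp_edge[OF f that(1)] that(2) inj])
  have lin: "relabel_edges \<sigma> (frag_cmul k (a - b + c)) =
     frag_cmul k (relabel_edges \<sigma> a - relabel_edges \<sigma> b + relabel_edges \<sigma> c)" for k a b c
    unfolding relabel_edges_def frag_extend_cmul frag_extend_add frag_extend_diff ..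
  have "relabel_edges \<sigma> (boundary (frag_of f)) = frag_cmul (ort3 v x y)
     (sterm (ort (\<sigma> x) (\<sigma> y)) (edge ?g (\<sigma> x) (\<sigma> y)) - sterm (ort (\<sigma> v) (\<sigma> y)) (edge ?g (\<sigma> v) (\<sigma> y))
       + sterm (ort (\<sigma> v) (\<sigma> x)) (edge ?g (\<sigma> v) (\<sigma> x)))"
    unfolding boundary_triangle[OF p] lin using e[of x y] e[of v y] e[of v x] p by simp
  moreover have "boundary (relabel_chain \<sigma> (frag_of f)) =
      frag_cmul (ort3 v x y * ort3 (\<sigma> v) (\<sigma> x) (\<sigma> y)) (boundary (frag_of ?g))"
    unfolding relabel_chain_def frag_extend_of boundary_cmul p(1)
      relabel_sign_oriented[OF p(2-4) inj] ..
  ultimately show ?thesis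
    unfolding boundary_triangle[OF ps ne] by (simp add: mult.assoc)
qed

text \<open>Relabelling commutes with the boundary on triangles, hence on \<open>d\<close> by
  linearity, and \<open>\<sigma>\<close> fixes all indices of the edges that survive in the
  boundary. This is why moving a vanishing support does not change the boundary.\<close>

lemma boundary_relabel_chain:
  assumes d: "d \<in> chain_group A B 2" and inj: "inj \<sigma>"
    and fixd: "\<And>x. x \<in> csupp (boundary d) \<Longrightarrow> \<sigma> x = x"
  shows "boundary (relabel_chain \<sigma> d) = boundary d"
proof -
  have "terms d \<subseteq> simplices A B 2" using d unfolding chain_group_def by simp
  then have "boundary (relabel_chain \<sigma> d) = relabel_edges \<sigma> (boundary d)"
  proof (induction rule: frag_induction)
    case zero
    then show ?case by (simp add: relabel_chain_def relabel_edges_def)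
  next
    case (one f)
    then show ?case using boundary_relabel_simplex[OF _ inj] by simp
  next
    case (diff a b)
    then show ?case
      unfolding boundary_diff relabel_chain_def relabel_edges_def frag_extend_diff by simp
  qed
  also have "\<dots> = frag_extend frag_of (boundary d)"
    unfolding relabel_edges_def
  proof (rule frag_extend_eq)
    fix e assume e: "e \<in> terms (boundary d)"
    then have es: "e \<in> simplices A B 1" using boundary_chain_group[OF d] unfolding chain_group_def by blast
    have "psupp e \<subseteq> csupp (boundary d)" using e unfolding csupp_def by blast
    then have fx: "\<sigma> x = x" if "x \<in> psupp e" for x using that fixd by blast
    have "card (psupp e) = 2" using simplexD(3)[OF es] by simp
    then obtain a b where ab: "psupp e = {a, b}" "a \<noteq> b" by (meson card_2_iff)
    then have "Min (psupp e) < Max (psupp e)" "Min (psupp e) \<in> psupp e" "Max (psupp e) \<in> psupp e"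
      by (auto simp: min_def max_def)
    then have "ort (\<sigma> (Min (psupp e))) (\<sigma> (Max (psupp e))) = 1" using fx by (simp add: ort_def)
    then show "sterm (ort (\<sigma> (Min (psupp e))) (\<sigma> (Max (psupp e)))) (permute (psupp e) \<sigma> e) = frag_of e"
      using permute_fixed[OF es fx] by simp
  qed
  also have "\<dots> = boundary d" by (rule frag_expansion[symmetric])
  finally show ?thesis .
qed

end

subsection \<open>Steps of minimal chains\<close>

lemma chain_length_sum_le: "finite I \<Longrightarrow> chain_length (\<Sum>i\<in>I. c i) \<le> (\<Sum>i\<in>I. chain_length (c i))"
proof (induction I rule: finite_induct)
  case (insert i I)
  then show ?case using chain_length_add_le[of "c i" "sum c I"] by simp
qed simp

text \<open>For a general \<open>\<sigma>\<close> different terms may have the same image, hence an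
  inequality. It suffices later, where properness fixes the lengths.\<close>

lemma chain_length_relabel_le: "chain_length (relabel_chain \<sigma> d) \<le> chain_length d"
proof -
  have unit: "nat \<bar>k * relabel_sign \<sigma> s\<bar> = nat \<bar>k\<bar>" for k s
    by (simp add: relabel_sign_def sign_def abs_mult)
  have "chain_length (relabel_chain \<sigma> d) \<le> (\<Sum>f\<in>terms d. chain_length
      (frag_cmul (coeff d f) (sterm (relabel_sign \<sigma> (psupp f)) (permute (psupp f) \<sigma> f))))"
    unfolding relabel_chain_def frag_extend_def by (rule chain_length_sum_le) simp
  also have "\<dots> = chain_length d"
    unfolding frag_cmul_cmul chain_length_sterm unit by (simp only: chain_length_def)
  finally show ?thesis .
qed

lemma subchain_sterm_length:
  assumes "coeff c f * e > 0" "\<bar>e\<bar> = 1"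
  shows "chain_length c = Suc (chain_length (c - sterm e f))"
  using subchain_sterm[OF assms] assms(2) unfolding subchain_iff_length by simp

lemma finite_csupp: "c \<in> chain_group A B n \<Longrightarrow> finite (csupp c)"
  unfolding csupp_def chain_group_def by (intro finite_UN_I finite_keys) (auto dest: simplexD(4))

text \<open>In the decisive use \<open>S\<close> is {0, 1, 2}. A triangle off this set is what
  provides the inner index needed to shorten a fan around 2.\<close>

definition wide :: "nat set \<Rightarrow> ('o, 'm) chain \<Rightarrow> bool" where
  "wide S c \<longleftrightarrow> (\<exists>f\<in>terms c. psupp f \<noteq> S)"

lemma chain_equiv_group: "chain_equiv A B c c' \<Longrightarrow> c \<in> chain_group A B 2"
  unfolding chain_equiv_def proper_chain_def by blast

lemma chain_equiv_refl: "proper_chain A B c \<Longrightarrow> chain_equiv A B c c"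
  unfolding chain_equiv_def by simp

lemma chain_equiv_length:
  "chain_equiv A B c c' \<Longrightarrow> chain_length c = chain_length c'"
  unfolding chain_equiv_def proper_chain_def by blast

text \<open>Whatever is reachable from \<open>c'\<close> is reachable from \<open>c\<close>, so
  properness is inherited. The equality of lengths obtained here is the source of the later
  conclusions that nothing cancels.\<close>

lemma chain_equiv_step:
  assumes "chain_equiv A B c c0" "CRRS_step A B c c'" "c' \<in> chain_group A B 2"
  shows "chain_equiv A B c' c0" "chain_length c' = chain_length c"
proof -
  have p: "proper_chain A B c" using assms(1) unfolding chain_equiv_def by blast
  then show l: "chain_length c' = chain_length c"
    using assms(2) unfolding proper_chain_def by (meson r_into_rtranclp)
  have "chain_length d = chain_length c'" if "(CRRS_step A B)\<^sup>*\<^sup>* c' d" for d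
    using p that assms(2) l unfolding proper_chain_def by (metis converse_rtranclp_into_rtranclp)
  then have "proper_chain A B c'" using assms(3) unfolding proper_chain_def by blast
  then show "chain_equiv A B c' c0"
    using assms(1,2) unfolding chain_equiv_def by (meson rtranclp.rtrancl_into_rtrancl)
qed

lemma minimal_no_cycle:
  "\<lbrakk>minimal_chain A B \<alpha>; chain_equiv A B c \<alpha>; subchain d c; boundary d = 0\<rbrakk> \<Longrightarrow> d = 0"
  unfolding minimal_chain_def by blast

context amenable_family
begin

lemma csupp_boundary:
  assumes d: "d \<in> chain_group A B 2"
  shows "csupp (boundary d) \<subseteq> csupp d"
proof
  fix x assume "x \<in> csupp (boundary d)"
  then obtain e where e: "e \<in> terms (boundary d)" "x \<in> psupp e" unfolding csupp_def by blast
  then obtain f where f: "f \<in> terms d" "e \<in> terms (boundary (frag_of f))"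
    using terms_boundary by blast
  then have fs: "f \<in> simplices A B 2" using d unfolding chain_group_def by blast
  obtain a b where "{a, b} \<subseteq> psupp f" "e = edge f a b"
    using boundary_triangle_terms[OF fs f(2)] by metis
  then have "x \<in> psupp f" using e(2) psupp_edge[OF fs] by blast
  then show "x \<in> csupp d" using f(1) unfolding csupp_def by blast
qed

text \<open>The transposition of \<open>j\<close> with a fresh \<open>k\<close> is used; neither
  index lies in the boundary of \<open>d\<close>, so the boundary is kept. The last clause is
  conditional because the equality of lengths comes from properness of \<open>c\<close>, which is
  available only to the callers.\<close>

lemma RS_relabel:
  assumes c: "c \<in> chain_group A B 2" and sub: "subchain d c" and j: "vanishing_support d j"
  obtains k d' where "k \<notin> csupp c" "RS_step c (c - d + d')" "d' \<in> chain_group A B 2"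
    "boundary d' = boundary d" "j \<notin> csupp d'" "chain_length d' \<le> chain_length d"
    "chain_length (c - d + d') = chain_length c \<Longrightarrow> k \<in> csupp (c - d + d')"
proof -
  obtain k where k: "k \<notin> csupp c" using ex_new_if_finite[OF infinite_UNIV_nat finite_csupp[OF c]] by blast
  define \<sigma> where "\<sigma> = Transposition.transpose j k"
  have d: "d \<in> chain_group A B 2" by (rule subchain_group[OF sub c])
  have jd: "j \<in> csupp d" "j \<notin> csupp (boundary d)" using j unfolding vanishing_support_def by auto
  have inj: "inj \<sigma>" unfolding \<sigma>_def by (rule inj_on_transpose)
  have cs: "csupp d \<subseteq> csupp c" by (rule subchain_csupp[OF sub])
  have \<sigma>: "\<sigma> j = k" "\<sigma> k = j" "\<And>x. x \<noteq> j \<Longrightarrow> x \<noteq> k \<Longrightarrow> \<sigma> x = x"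
    unfolding \<sigma>_def by (simp_all add: transpose_def)
  let ?d = "relabel_chain \<sigma> d"
  have term_d: "\<exists>f\<in>terms d. g = permute (psupp f) \<sigma> f" if "g \<in> terms ?d" for g
  proof -
    have "g \<in> (\<Union>f\<in>terms d. terms (sterm (relabel_sign \<sigma> (psupp f)) (permute (psupp f) \<sigma> f)))"
      using subsetD[OF keys_frag_extend that[unfolded relabel_chain_def]] .
    then obtain f where "f \<in> terms d"
      "g \<in> terms (sterm (relabel_sign \<sigma> (psupp f)) (permute (psupp f) \<sigma> f))" by blast
    then show ?thesis by (metis keys_cmul_iff keys_frag_of singletonD)
  qed
  have sd: "f \<in> simplices A B 2" if "f \<in> terms d" for f
    using that d unfolding chain_group_def by blast
  note perm = permute_simplex[OF sd inj_on_subset[OF inj subset_UNIV]]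
  have grp: "?d \<in> chain_group A B 2"
    unfolding chain_group_def using term_d perm(1) by blast
  have bd: "boundary ?d = boundary d"
  proof (rule boundary_relabel_chain[OF d inj])
    fix x assume x: "x \<in> csupp (boundary d)"
    then have "x \<noteq> j" "x \<noteq> k" using jd(2) csupp_boundary[OF d] cs k by blast+
    then show "\<sigma> x = x" by (rule \<sigma>(3))
  qed
  have nj: "j \<notin> csupp ?d"
  proof
    assume "j \<in> csupp ?d"
    then obtain g where g: "g \<in> terms ?d" "j \<in> psupp g" unfolding csupp_def by blast
    then obtain f where f: "f \<in> terms d" "g = permute (psupp f) \<sigma> f" using term_d by blast
    then obtain x where "x \<in> psupp f" "j = \<sigma> x" using g(2) perm(2)[OF f(1)] by auto
    then have "k \<in> psupp f" using \<sigma>(2) inj by (metis injD)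
    then show False using f(1) cs k unfolding csupp_def by blast
  qed
  have rs: "RS_step c (c - d + ?d)"
    unfolding RS_step_def
  proof (intro exI conjI)
    show "bij \<sigma>" unfolding \<sigma>_def by simp
    show "\<forall>x\<in>csupp c - {j}. \<sigma> x = x" using \<sigma>(3) k by blast
  qed (fact sub j k \<sigma>(1) refl)+
  have "k \<in> csupp (c - d + ?d)" if l: "chain_length (c - d + ?d) = chain_length c"
  proof -
    obtain f where f: "f \<in> terms d" "j \<in> psupp f" using jd(1) unfolding csupp_def by blast
    define e where "e = sgn (coeff d f)"
    define g where "g = permute (psupp f) \<sigma> f"
    have e: "coeff d f * e > 0" "\<bar>e\<bar> = 1" using f(1) unfolding e_def
      by (simp_all add: in_keys_iff abs_sgn_eq flip: abs_sgn)
    \<comment> \<open>One unit of a term through \<open>j\<close> is split off. What remains after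
      relabelling is shorter than \<open>c\<close>, so if the length is preserved, adding the image
      of that unit must lengthen it. Hence the image, which contains \<open>k\<close>, is not
      cancelled.\<close>
    define d1 where "d1 = d - sterm e f"
    have l1: "chain_length d = Suc (chain_length d1)"
      unfolding d1_def by (rule subchain_sterm_length[OF e])
    let ?k = "e * relabel_sign \<sigma> (psupp f)"
    have unit: "\<bar>?k\<bar> = 1" using e(2) by (simp add: relabel_sign_def sign_def abs_mult)
    have rd: "?d = relabel_chain \<sigma> d1 + sterm ?k g"
      unfolding d1_def relabel_chain_def frag_extend_diff frag_extend_cmul frag_extend_of g_def by simp
    let ?r = "c - d + relabel_chain \<sigma> d1"
    have "chain_length ?r \<le> chain_length (c - d) + chain_length d1"
      using chain_length_add_le[of "c - d" "relabel_chain \<sigma> d1"] chain_length_relabel_le[of \<sigma> d1] by simp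
    moreover have "chain_length c = chain_length d + chain_length (c - d)"
      using sub unfolding subchain_iff_length .
    ultimately have "chain_length (?r + sterm ?k g) \<ge> chain_length ?r + chain_length (sterm ?k g)"
      using l l1 unit unfolding rd by (simp add: add.assoc)
    then have "chain_length (?r + sterm ?k g) = chain_length ?r + chain_length (sterm ?k g)"
      using chain_length_add_le le_antisym by blast
    from subchain_terms[OF subchain_add(2)[OF this]] have "g \<in> terms (c - d + ?d)"
      using unit unfolding rd by (auto simp: add.assoc)
    moreover have "k \<in> psupp g" using perm(2)[OF f(1)] f(2) \<sigma>(1) unfolding g_def by blast
    ultimately show ?thesis unfolding csupp_def by blast
  qed
  from that[OF k rs grp bd nj chain_length_relabel_le this] show thesis .
qed

text \<open>Up to sign this is the coefficient at the vertex \<open>a\<close> of the boundary of the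
  boundary, with the functor values at \<open>a\<close> forgotten. The two edges at \<open>a\<close>
  of a triangle contribute opposite amounts.\<close>

lemma vertex_pairing_boundary:
  fixes a :: nat
  defines "\<phi> \<equiv> \<lambda>e. if a \<in> psupp e then (if a = Min (psupp e) then 1 else -1) else (0 :: int)"
  assumes d: "d \<in> chain_group A B 2"
  shows "pairing \<phi> (boundary d) = 0"
proof -
  have \<phi>: "\<phi> e = ort a b" if "psupp e = {a, b}" "a \<noteq> b" for e b
    using that unfolding \<phi>_def ort_def by (auto simp: min_def)
  have "pairing \<phi> (boundary (frag_of f)) = 0" if f: "f \<in> simplices A B 2" for f
  proof (cases "a \<in> psupp f")
    case True
    from triangle_with_vertex[OF f True] obtain x y where
      p: "psupp f = {a, x, y}" "a \<noteq> x" "x \<noteq> y" "a \<noteq> y" .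
    have ps: "psupp (edge f a x) = {a, x}" "psupp (edge f a y) = {a, y}" "psupp (edge f x y) = {x, y}"
      using psupp_edge[OF f] p(1) by auto
    have "\<phi> (edge f x y) = 0" unfolding \<phi>_def ps using p by simp
    then show ?thesis unfolding boundary_triangle[OF p]
      using \<phi>[OF ps(1) p(2)] \<phi>[OF ps(2) p(4)] by simp
  next
    case False
    have "\<phi> e = 0" if "e \<in> terms (boundary (frag_of f))" for e
      using boundary_triangle_terms[OF f that] psupp_edge[OF f] False unfolding \<phi>_def by (metis subsetD)
    then show ?thesis unfolding pairing_def by simp
  qed
  then show ?thesis
    unfolding boundary_pairing[of \<phi> d] using d unfolding chain_group_def by (intro sum.neutral) auto
qed

text \<open>A multiple of a single edge has non-zero signed incidence with its end points, whereas a
  boundary has incidence 0 with every vertex. Therefore a non-zero boundary contains an edge besides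
  a prescribed \<open>u\<close>.\<close>

lemma boundary_not_single_edge:
  assumes d: "d \<in> chain_group A B 2" and u: "u \<in> simplices A B 1" and nz: "boundary d \<noteq> 0"
  obtains e where "e \<in> terms (boundary d)" "e \<noteq> u"
proof (rule ccontr)
  assume "\<not> thesis"
  then have t: "terms (boundary d) \<subseteq> {u}" using that by blast
  have "card (psupp u) = 2" using simplexD(3)[OF u] by simp
  then obtain a where a: "a \<in> psupp u" by fastforce
  let ?\<phi> = "\<lambda>e. if a \<in> psupp e then (if a = Min (psupp e) then 1 else -1) else (0 :: int)"
  have "0 = pairing ?\<phi> (boundary d)" by (rule vertex_pairing_boundary[OF d, symmetric])
  also have "\<dots> = coeff (boundary d) u * ?\<phi> u"
    using t by (subst pairing_superset[of "{u}"]) auto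
  finally have "coeff (boundary d) u = 0" using a by (auto split: if_splits)
  then have "boundary d = 0" using t by (metis in_keys_iff keys_eq_empty subset_singletonD singletonI)
  with nz show False ..
qed

lemma boundary_edge_coeff:
  assumes f: "f \<in> simplices A B 2" "psupp f = {a, b, z}" "a \<noteq> b" "b \<noteq> z" "a \<noteq> z"
  shows "coeff (boundary (frag_of f)) (edge f a b) = ort3 a b z * ort a b"
proof -
  have ps: "psupp (edge f a b) = {a, b}" "psupp (edge f a z) = {a, z}" "psupp (edge f b z) = {b, z}"
    using psupp_edge[OF f(1)] f(2) by auto
  have "{a, b} \<noteq> {a, z}" "{a, b} \<noteq> {b, z}" using f(3-5) by (auto simp: doubleton_eq_iff)
  then have "edge f a b \<noteq> edge f a z" "edge f a b \<noteq> edge f b z" using ps by metis+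
  then show ?thesis unfolding boundary_triangle[OF f(2-5)] by (simp add: lookup_add lookup_minus)
qed

text \<open>The sign is kept because the triangle found will be removed from \<open>d\<close> with a
  prescribed orientation, which is a subchain only if its coefficient has the right sign.\<close>

lemma boundary_edge_term:
  assumes d: "d \<in> chain_group A B 2" and e: "psupp e = {a, b}" "a \<noteq> b"
    and pos: "coeff (boundary d) e * s > 0"
  obtains f z where "f \<in> simplices A B 2" "psupp f = {a, b, z}" "distinct [a, b, z]" "edge f a b = e"
    "f \<in> terms d" "coeff d f * (ort3 a b z * ort a b) * s > 0"
proof -
  obtain f where f: "f \<in> terms d" "coeff d f * coeff (boundary (frag_of f)) e * s > 0"
    by (rule boundary_term[OF pos])
  have fs: "f \<in> simplices A B 2" using d f(1) unfolding chain_group_def by blast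
  have "e \<in> terms (boundary (frag_of f))" using f(2) by (auto simp: in_keys_iff)
  from boundary_triangle_terms[OF fs this] obtain x y where
    xy: "x \<noteq> y" "{x, y} \<subseteq> psupp f" "e = edge f x y" .
  then have "{x, y} = {a, b}" using psupp_edge[OF fs] e(1) by metis
  then have ab: "{a, b} \<subseteq> psupp f" "e = edge f a b" using xy(2,3) unfolding edge_def by simp_all
  then obtain x' y' where p': "psupp f = {a, x', y'}" "a \<noteq> x'" "x' \<noteq> y'" "a \<noteq> y'"
    using triangle_with_vertex[OF fs, of a] by blast
  then obtain z where p: "psupp f = {a, b, z}" "b \<noteq> z" "a \<noteq> z"
    using ab(1) e(2) by (metis insert_commute insertE insert_subset singletonD)
  have "coeff (boundary (frag_of f)) e = ort3 a b z * ort a b"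
    unfolding ab(2) by (rule boundary_edge_coeff[OF fs p(1) e(2) p(2,3)])
  then show thesis using that[OF fs p(1) _ ab(2)[symmetric] f(1)] f(2) e(2) p(2,3) by simp
qed

end

subsection \<open>Fans around a vertex\<close>

text \<open>A triple \<open>(p, q, f)\<close> stands for the triangle \<open>f\<close> on \<open>{v, p, q}\<close>, taken with the sign of the
  orientation \<open>v, p, q\<close>; with this sign its boundary has the parts \<open>vp\<close>, \<open>pq\<close> and \<open>-vq\<close>.\<close>

type_synonym ('o, 'm) sector = "nat \<times> nat \<times> ('o, 'm) pfun"

definition sector_chain :: "nat \<Rightarrow> ('o, 'm) sector \<Rightarrow> ('o, 'm) chain" where
  "sector_chain v = (\<lambda>(p, q, f). sterm (ort3 v p q) f)"

definition fan_chain :: "nat \<Rightarrow> ('o, 'm) sector list \<Rightarrow> ('o, 'm) chain" where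
  "fan_chain v ts = sum_list (map (sector_chain v) ts)"

text \<open>The path traced opposite to the centre, oriented in the direction of the walk. Its edges
  may cancel each other.\<close>

definition outer_chain :: "('o, 'm) sector list \<Rightarrow> ('o, 'm) chain" where
  "outer_chain ts = sum_list (map (\<lambda>(p, q, f). sterm (ort p q) (edge f p q)) ts)"

text \<open>The edges at \<open>v\<close> are compared as functors and not only through their
  indices: several functors may have the same support, and only equal ones cancel in a boundary.
  Indices and sectors may be repeated.\<close>

fun fan :: "('o, 'm) pfun set \<Rightarrow> 'o \<Rightarrow> nat \<Rightarrow> nat \<Rightarrow> ('o, 'm) pfun \<Rightarrow> ('o, 'm) sector list \<Rightarrow>
    nat \<Rightarrow> ('o, 'm) pfun \<Rightarrow> bool" where
  "fan A B v x g [] y h \<longleftrightarrow> x = y \<and> g = h"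
| "fan A B v x g ((p, q, f) # ts) y h \<longleftrightarrow>
     p = x \<and> f \<in> simplices A B 2 \<and> psupp f = {v, p, q} \<and> distinct [v, p, q] \<and> edge f v p = g \<and>
     fan A B v q (edge f v q) ts y h"

lemma fan_chain_simps [simp]:
  "fan_chain v [] = 0" "fan_chain v (t # ts) = sector_chain v t + fan_chain v ts"
  "fan_chain v (ts @ us) = fan_chain v ts + fan_chain v us"
  by (simp_all add: fan_chain_def)

lemma outer_chain_simps [simp]:
  "outer_chain [] = 0" "outer_chain ((p, q, f) # ts) = sterm (ort p q) (edge f p q) + outer_chain ts"
  by (simp_all add: outer_chain_def)

lemma chain_length_sector [simp]: "chain_length (sector_chain v t) = 1"
  by (cases t) (simp add: sector_chain_def)

text \<open>Sectors can cancel, so the list gives only an upper bound. Equality is carried as a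
  separate hypothesis wherever the list has to display its chain faithfully.\<close>

lemma chain_length_fan_le: "chain_length (fan_chain v ts) \<le> length ts"
proof (induction ts)
  case (Cons t ts)
  then show ?case using chain_length_add_le[of "sector_chain v t" "fan_chain v ts"] by simp
qed simp

lemma fan_append:
  "fan A B v x g (ts @ us) y h \<longleftrightarrow> (\<exists>z k. fan A B v x g ts z k \<and> fan A B v z k us y h)"
proof (induction ts arbitrary: x g)
  case (Cons t ts)
  then show ?case by (cases t) simp
qed simp

lemma fan_sector:
  assumes "fan A B v x g ts y h" "(p, q, f) \<in> set ts"
  shows "f \<in> simplices A B 2" "psupp f = {v, p, q}" "distinct [v, p, q]"
proof -
  obtain us ws where ts: "ts = us @ (p, q, f) # ws" using assms(2) by (meson split_list)
  then show "f \<in> simplices A B 2" "psupp f = {v, p, q}" "distinct [v, p, q]"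
    using assms(1) unfolding ts fan_append by auto
qed

lemma fan_vertices:
  assumes "fan A B v x g ts y h" "(p, q, f) \<in> set ts"
  shows "q = y \<or> q \<in> fst ` set ts"
proof -
  obtain us ws where ts: "ts = us @ (p, q, f) # ws" using assms(2) by (meson split_list)
  obtain k where "fan A B v q k ws y h" using assms(1) unfolding ts fan_append by auto
  then show ?thesis unfolding ts by (cases ws) auto
qed

lemma fan_chain_group: "fan A B v x g ts y h \<Longrightarrow> fan_chain v ts \<in> chain_group A B 2"
proof (induction ts arbitrary: x g)
  case Nil
  then show ?case by (simp add: chain_group_def)
next
  case (Cons t ts)
  obtain p q f where t: "t = (p, q, f)" by (cases t)
  have "fan_chain v ts \<in> chain_group A B 2" using Cons unfolding t by auto
  moreover have "sector_chain v t \<in> chain_group A B 2"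
    using Cons.prems chain_group_sterm unfolding t sector_chain_def by auto
  ultimately show ?case using chain_group_add by auto
qed

lemma sector_boundary:
  assumes "psupp f = {v, p, q}" "distinct [v, p, q]"
  shows "boundary (sector_chain v (p, q, f)) =
    sterm (ort p q) (edge f p q) - sterm (ort v q) (edge f v q) + sterm (ort v p) (edge f v p)"
  using boundary_triangle[OF assms(1)] assms(2)
  by (simp add: sector_chain_def boundary_cmul)

text \<open>Each inner edge at \<open>v\<close> ends one sector and begins the next, so the
  contributions at \<open>v\<close> telescope to the two end edges.\<close>

lemma fan_boundary:
  "fan A B v x g ts y h \<Longrightarrow>
    boundary (fan_chain v ts) = sterm (ort v x) g - sterm (ort v y) h + outer_chain ts"
proof (induction ts arbitrary: x g)
  case (Cons t ts)
  obtain p q f where t: "t = (p, q, f)" by (cases t)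
  have s: "boundary (sector_chain v t) =
      sterm (ort p q) (edge f p q) - sterm (ort v q) (edge f v q) + sterm (ort v p) (edge f v p)"
    unfolding t by (rule sector_boundary) (use Cons.prems t in auto)
  have "boundary (fan_chain v ts) = sterm (ort v q) (edge f v q) - sterm (ort v y) h + outer_chain ts"
    by (rule Cons.IH) (use Cons.prems t in auto)
  moreover have "p = x" "edge f v x = g" using Cons.prems unfolding t by auto
  ultimately show ?case
    unfolding t fan_chain_simps boundary_add s[unfolded t] outer_chain_simps
    by (simp del: minus_frag_cmul)
qed simp

lemma outer_chain_coeff:
  assumes "coeff (outer_chain ts) e * s > 0"
  obtains p q f where "(p, q, f) \<in> set ts" "edge f p q = e" "ort p q * s > 0"
proof -
  have "\<exists>p q f. (p, q, f) \<in> set ts \<and> edge f p q = e \<and> ort p q * s > 0"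
    using assms
  proof (induction ts)
    case (Cons t ts)
    obtain p q f where t: "t = (p, q, f)" by (cases t)
    have eq: "coeff (outer_chain (t # ts)) e * s =
        (if edge f p q = e then ort p q * s else 0) + coeff (outer_chain ts) e * s"
      unfolding t by (simp add: lookup_add algebra_simps)
    show ?case
    proof (cases "edge f p q = e \<and> ort p q * s > 0")
      case True
      then show ?thesis unfolding t by auto
    next
      case False
      then have "coeff (outer_chain ts) e * s > 0" using Cons.prems unfolding eq by (auto split: if_splits)
      then show ?thesis using Cons.IH by auto
    qed
  qed simp
  then show thesis using that by blast
qed

lemma outer_chain_terms:
  assumes "e \<in> terms (outer_chain ts)"
  obtains p q f where "(p, q, f) \<in> set ts" "edge f p q = e"
proof -
  have "coeff (outer_chain ts) e * sgn (coeff (outer_chain ts) e) > 0"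
    using assms by (simp add: in_keys_iff flip: abs_sgn)
  then show thesis using that by (rule outer_chain_coeff)
qed

context amenable_family
begin

text \<open>Used in this way: if a fan accounts for all boundary edges at \<open>v\<close>, then
  \<open>v\<close> is absent from the boundary of the part outside the fan.\<close>

lemma fan_outer_psupp:
  assumes "fan A B v x g ts y h" "e \<in> terms (outer_chain ts)"
  shows "v \<notin> psupp e"
proof -
  obtain p q f where t: "(p, q, f) \<in> set ts" "edge f p q = e" using outer_chain_terms[OF assms(2)] .
  note s = fan_sector[OF assms(1) t(1)]
  have "psupp e = {p, q}" unfolding t(2)[symmetric] by (rule psupp_edge[OF s(1)]) (use s(2) in blast)
  then show ?thesis using s(3) by auto
qed

text \<open>Around \<open>v\<close> every triangle leads from one edge at \<open>v\<close> to another, and all edges but the two end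
  points are left as often as they are entered.\<close>

lemma fan_trail:
  assumes "D \<in> chain_group A B 2" "psupp g = {v, x}" "psupp h = {v, y}" "v \<noteq> x" "v \<noteq> y"
    and "\<And>e. v \<in> psupp e \<Longrightarrow> coeff (boundary D) e = coeff (sterm (ort v x) g - sterm (ort v y) h) e"
  shows "\<exists>ts D'. fan A B v x g ts y h \<and> D = fan_chain v ts + D' \<and> D' \<in> chain_group A B 2 \<and>
    chain_length D = length ts + chain_length D'"
  using assms
proof (induction "chain_length D" arbitrary: D x g rule: less_induct)
  case less
  note D = less.prems(1) and pg = less.prems(2) and ph = less.prems(3)
    and vx = less.prems(4) and vy = less.prems(5) and bd = less.prems(6)
  show ?case
  proof (cases "g = h")
    \<comment> \<open>The walk stops as soon as the target edge is reached; closed walks around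
      \<open>v\<close> stay in the rest \<open>D'\<close>.\<close>
    case True
    then have "x = y" using pg ph vx vy by (metis doubleton_eq_iff)
    then have "fan A B v x g [] y h \<and> D = fan_chain v [] + D \<and> D \<in> chain_group A B 2 \<and>
        chain_length D = length ([] :: ('a, 'b) sector list) + chain_length D"
      using True D by simp
    then show ?thesis by blast
  next
    case False
    \<comment> \<open>Being different from the target, \<open>g\<close> is left once more than it is
      entered, so some triangle of \<open>D\<close> starts from it in the right direction.\<close>
    have "coeff (boundary D) g = ort v x" using bd[of g] pg False by (simp add: lookup_minus)
    then have "coeff (boundary D) g * ort v x > 0" by simp
    from boundary_edge_term[OF D pg vx this] obtain f z where
      f: "f \<in> simplices A B 2" "psupp f = {v, x, z}" "distinct [v, x, z]" "edge f v x = g"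
        "f \<in> terms D" "coeff D f * (ort3 v x z * ort v x) * ort v x > 0" .
    define D1 where "D1 = D - sterm (ort3 v x z) f"
    have pos: "coeff D f * ort3 v x z > 0" using f(6) by (simp add: mult.assoc)
    have len: "chain_length D = Suc (chain_length D1)"
      unfolding D1_def by (rule subchain_sterm_length[OF pos]) simp
    have D1: "D1 \<in> chain_group A B 2"
      unfolding D1_def by (rule chain_group_diff[OF D chain_group_sterm[OF f(1)]])
    have pz: "psupp (edge f v z) = {v, z}" "psupp (edge f x z) = {x, z}"
      using psupp_edge[OF f(1)] f(2) by auto
    have s: "sector_chain v (x, z, f) = sterm (ort3 v x z) f" by (simp add: sector_chain_def)
    have b1: "boundary D1 = boundary D -
        (sterm (ort x z) (edge f x z) - sterm (ort v z) (edge f v z) + sterm (ort v x) g)"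
      unfolding D1_def boundary_diff s[symmetric] sector_boundary[OF f(2,3)] f(4) ..
    \<comment> \<open>The third edge of the removed triangle misses \<open>v\<close>. At
      \<open>v\<close> the removal therefore only moves the starting edge from \<open>g\<close> to
      the other edge of the triangle.\<close>
    have "coeff (boundary D1) e = coeff (sterm (ort v z) (edge f v z) - sterm (ort v y) h) e"
      if e: "v \<in> psupp e" for e
    proof -
      have "e \<noteq> edge f x z" using e pz(2) f(3) by auto
      then show ?thesis unfolding b1 lookup_minus bd[OF e] lookup_add by simp
    qed
    with less.hyps[OF _ D1 pz(1) ph _ vy] len f(3) obtain ts D' where
      ts: "fan A B v z (edge f v z) ts y h" "D1 = fan_chain v ts + D'" "D' \<in> chain_group A B 2"
        "chain_length D1 = length ts + chain_length D'" by auto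
    have "fan A B v x g ((x, z, f) # ts) y h" using ts(1) f(1-4) by simp
    moreover have "D = fan_chain v ((x, z, f) # ts) + D'"
      using ts(2) s unfolding D1_def by (simp add: algebra_simps)
    moreover have "chain_length D = length ((x, z, f) # ts) + chain_length D'" using ts(4) len by simp
    ultimately show ?thesis using ts(3) by blast
  qed
qed

end

text \<open>Two triangles with different supports cannot both lie on \<open>S\<close>. Equality of
  the lengths ensures that neither of them is cancelled by the rest of the chain.\<close>

lemma wide_flip:
  assumes l: "chain_length (c - w + (sterm a h - sterm b h')) = chain_length c"
    and w: "chain_length c = chain_length w + chain_length (c - w)" "chain_length w = 2"
    and ab: "\<bar>a\<bar> = 1" "\<bar>b\<bar> = 1" and ne: "psupp h \<noteq> psupp h'"
  shows "wide S (c - w + (sterm a h - sterm b h'))"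
proof -
  have hh: "h \<noteq> h'" using ne by blast
  let ?d = "sterm a h - sterm b h'"
  have "chain_length ?d \<le> 2"
    using chain_length_add_le[of "sterm a h" "sterm (- b) h'"] ab
    unfolding diff_conv_add_uminus minus_frag_cmul by simp
  then have "chain_length (c - w + ?d) = chain_length (c - w) + chain_length ?d"
    using chain_length_add_le[of "c - w" ?d] l w by linarith
  then have "terms ?d \<subseteq> terms (c - w + ?d)" by (intro subchain_terms subchain_add(2))
  moreover have "h \<in> terms ?d" "h' \<in> terms ?d"
    using hh ab by (auto simp: in_keys_iff lookup_minus)
  ultimately have "h \<in> terms (c - w + ?d)" "h' \<in> terms (c - w + ?d)" by blast+
  then show ?thesis using ne unfolding wide_def by (cases "psupp h = S") auto
qed

section \<open>Growing a fan by flips of its outer edges\<close>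

context nontrivial_amenable_family
begin

text \<open>As long as the fan does not exhaust the chain, minimality provides a triangle \<open>\<tau>\<close> of the rest that
  shares an outer edge with the fan; flipping that edge moves \<open>\<tau>\<close> into the fan.\<close>

lemma fan_extend_disjoint:
  assumes min: "minimal_chain A B \<alpha>" and u: "u \<in> simplices A B 1"
  shows "\<lbrakk>chain_equiv A B (fan_chain v ts + D) \<alpha>; fan A B v x g ts y h; D \<in> chain_group A B 2;
      chain_length (fan_chain v ts + D) = length ts + chain_length D; v \<notin> csupp D;
      boundary (fan_chain v ts + D) = sterm (ort v x) g - sterm (ort v y) h + frag_of u\<rbrakk>
    \<Longrightarrow> \<exists>ts'. chain_equiv A B (fan_chain v ts') \<alpha> \<and> fan A B v x g ts' y h \<and>
      chain_length (fan_chain v ts') = length ts' \<and>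
      boundary (fan_chain v ts') = boundary (fan_chain v ts + D) \<and>
      (wide S (fan_chain v ts + D) \<longrightarrow> wide S (fan_chain v ts')) \<and>
      (\<forall>us p q f. ts = us @ [(p, q, f)] \<and> edge f p q = u \<longrightarrow> (\<exists>us'. ts' = us' @ [(p, q, f)]))"
proof (induction "chain_length D" arbitrary: D ts rule: less_induct)
  case less
  note eqv = less.prems(1) and fan = less.prems(2) and D = less.prems(3) and len = less.prems(4)
    and vD = less.prems(5) and bd = less.prems(6)
  show ?case
  proof (cases "D = 0")
    case True
    then have "chain_length (fan_chain v ts) = length ts" using len by simp
    then show ?thesis using eqv fan True by (intro exI[of _ ts]) auto
  next
    case False
    have "chain_length (fan_chain v ts + D) = chain_length (fan_chain v ts) + chain_length D"
      using len chain_length_fan_le[of v ts] chain_length_add_le[of "fan_chain v ts" D] by linarith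
    then have "subchain D (fan_chain v ts + D)" by (rule subchain_add(2))
    then have "boundary D \<noteq> 0" using minimal_no_cycle[OF min eqv] False by blast
    \<comment> \<open>The edge \<open>u\<close> is the part of the total boundary opposite to
      \<open>v\<close>. Any other edge in the boundary of \<open>D\<close> has to be compensated by
      an outer edge of the fan.\<close>
    then obtain e where e: "e \<in> terms (boundary D)" "e \<noteq> u" by (rule boundary_not_single_edge[OF D u])
    \<comment> \<open>Only the sign of \<open>K\<close> matters: \<open>e\<close> occurs in the
      outer chain with the sign opposite to the one it has in the boundary of
      \<open>D\<close>.\<close>
    define K where "K = coeff (boundary D) e"
    have K0: "K \<noteq> 0" using e(1) unfolding K_def by (simp add: in_keys_iff)
    have "boundary D = frag_of u - outer_chain ts"
      using bd unfolding boundary_add fan_boundary[OF fan] by (simp add: algebra_simps)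
    then have "K = - coeff (outer_chain ts) e" using e(2) unfolding K_def by (simp add: lookup_minus)
    moreover have sq: "K * K > 0" using K0 by (auto simp: zero_less_mult_iff linorder_neq_iff)
    ultimately have "coeff (outer_chain ts) e * (- K) > 0" by simp
    then obtain p q f where t: "(p, q, f) \<in> set ts" "edge f p q = e" "ort p q * (- K) > 0"
      by (rule outer_chain_coeff)
    obtain us ws where ts: "ts = us @ (p, q, f) # ws" using t(1) by (meson split_list)
    note s = fan_sector[OF fan t(1)]
    have pe: "psupp e = {p, q}" unfolding t(2)[symmetric] by (rule psupp_edge[OF s(1)]) (use s(2) in blast)
    have pq: "p \<noteq> q" using s(3) by simp
    have "coeff (boundary D) e * K > 0" using sq unfolding K_def .
    from boundary_edge_term[OF D pe pq this] obtain \<tau> w where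
      \<tau>: "\<tau> \<in> simplices A B 2" "psupp \<tau> = {p, q, w}" "distinct [p, q, w]" "edge \<tau> p q = e"
        "\<tau> \<in> terms D" "coeff D \<tau> * (ort3 p q w * ort p q) * K > 0" .
    \<comment> \<open>The flip needs four distinct indices; the absence of \<open>v\<close> from
      \<open>D\<close> is used here.\<close>
    have wv: "w \<noteq> v" using vD \<tau>(2,5) unfolding csupp_def by blast
    have pos: "coeff D \<tau> * (- ort3 p q w) > 0"
    proof -
      have "(coeff D \<tau> * ort3 p q w) * (ort p q * K) > 0" using \<tau>(6) by (simp add: mult_ac)
      moreover have "ort p q * K < 0" using t(3) by simp
      ultimately have "coeff D \<tau> * ort3 p q w < 0"
        using zero_less_mult_iff[of "coeff D \<tau> * ort3 p q w" "ort p q * K"] by linarith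
      then show ?thesis by simp
    qed
    define D1 where "D1 = D - sterm (- ort3 p q w) \<tau>"
    define c where "c = fan_chain v ts + D"
    define w0 where "w0 = sterm (ort3 v p q) f + sterm (- ort3 p q w) \<tau>"
    have lD: "chain_length D = Suc (chain_length D1)"
      unfolding D1_def by (rule subchain_sterm_length[OF pos]) simp
    have cw: "c - w0 = fan_chain v (us @ ws) + D1"
      unfolding c_def w0_def D1_def ts by (simp add: sector_chain_def algebra_simps)
    have "chain_length (c - w0) \<le> length (us @ ws) + chain_length D1"
      unfolding cw using chain_length_add_le[of "fan_chain v (us @ ws)" D1]
        chain_length_fan_le[of v "us @ ws"] by linarith
    moreover have "chain_length w0 \<le> 2"
      unfolding w0_def using chain_length_add_le[of "sterm (ort3 v p q) f" "sterm (- ort3 p q w) \<tau>"] by simp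
    moreover have "chain_length c \<le> chain_length w0 + chain_length (c - w0)"
      using chain_length_add_le[of w0 "c - w0"] by simp
    moreover have lc: "chain_length c = Suc (Suc (length (us @ ws) + chain_length D1))"
    proof -
      have "length ts = Suc (length (us @ ws))" unfolding ts by simp
      then show ?thesis using len lD unfolding c_def by linarith
    qed
    ultimately have lw: "chain_length c = chain_length w0 + chain_length (c - w0)" "chain_length w0 = 2"
      by linarith+
    then have sub: "subchain w0 c" unfolding subchain_iff_length by simp
    have c: "c \<in> chain_group A B 2" using eqv unfolding c_def by (rule chain_equiv_group)
    have s2: "psupp f = {p, q, v}" using s(2) by blast
    have dist: "distinct [p, q, v, w]" using s(3) \<tau>(3) wv by auto
    have rot: "ort3 p q v = ort3 v p q" "ort3 q v w = ort3 v w q" "ort3 p v w = - ort3 v p w"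
      using ort3_swap(4)[of v p q] ort3_swap(5)[of v w q] ort3_swap(1)[of v p w] dist by auto
    have \<epsilon>: "1 = ort3 v p q * ort3 p q v" unfolding rot by simp
    have sg: "ort3 v p q * ort3 p q v = - (- ort3 p q w * ort3 p q w)" unfolding \<epsilon>[symmetric] by simp
    have units: "ort3 v p q \<in> {1, -1}" "- ort3 p q w \<in> {1, -1}" by (auto simp: ort3_def ort_def)
    obtain k k' where k: "k \<in> simplices A B 2" "psupp k = {q, v, w}"
      "k' \<in> simplices A B 2" "psupp k' = {p, v, w}"
      "edge k q v = edge f q v" "edge k q w = edge \<tau> q w"
      "edge k' p v = edge f p v" "edge k' p w = edge \<tau> p w" "edge k v w = edge k' v w"
      "CR_step A B c (c - w0 + (sterm (1 * ort3 q v w) k - sterm (1 * ort3 p v w) k'))"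
      "boundary (sterm (1 * ort3 q v w) k - sterm (1 * ort3 p v w) k') = boundary w0"
      unfolding w0_def
      by (rule CR_flip[OF c s(1) s2 \<tau>(1,2) dist _ units sg sub[unfolded w0_def] \<epsilon>])
         (use t(2) \<tau>(4) in simp)
    \<comment> \<open>The sector from \<open>p\<close> to \<open>q\<close> is replaced by two
      sectors through \<open>w\<close>. The fan gains one sector while \<open>D\<close> loses one
      unit, so the total length is again the displayed one.\<close>
    define ts' where "ts' = us @ [(p, w, k'), (w, q, k)] @ ws"
    let ?c' = "c - w0 + (sterm (1 * ort3 q v w) k - sterm (1 * ort3 p v w) k')"
    have c': "?c' = fan_chain v ts' + D1"
      unfolding cw ts'_def rot by (simp add: sector_chain_def algebra_simps flip: minus_frag_cmul)
    have D1: "D1 \<in> chain_group A B 2"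
      unfolding D1_def by (rule chain_group_diff[OF D chain_group_sterm[OF \<tau>(1)]])
    have fan': "fan A B v x g ts' y h"
      using fan k(1-9) dist unfolding ts ts'_def fan_append
      by (auto simp: insert_commute edge_commute[of _ v p] edge_commute[of _ v q])
    have c'g: "?c' \<in> chain_group A B 2"
      unfolding c' by (rule chain_group_add[OF fan_chain_group[OF fan'] D1])
    have crrs: "CRRS_step A B c ?c'" using k(10) unfolding CRRS_step_def by blast
    note eq' = chain_equiv_step[OF eqv[folded c_def] crrs c'g]
    have len': "chain_length (fan_chain v ts' + D1) = length ts' + chain_length D1"
      using eq'(2) lc unfolding c' ts'_def by simp
    have bd': "boundary (fan_chain v ts' + D1) = boundary c"
      unfolding c'[symmetric] using k(11) by (simp add: boundary_add boundary_diff)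
    have vD1: "v \<notin> csupp D1"
      using vD subchain_csupp[OF subchain_diff[OF subchain_sterm[OF pos]]] unfolding D1_def by auto
    have "q \<in> psupp k" "q \<notin> psupp k'" using k(2,4) dist by auto
    then have "psupp k \<noteq> psupp k'" by blast
    then have wide: "wide S (fan_chain v ts' + D1)"
      unfolding c'[symmetric] by (intro wide_flip[OF eq'(2) lw]) simp_all
    have bdu: "boundary (fan_chain v ts' + D1) = sterm (ort v x) g - sterm (ort v y) h + frag_of u"
      unfolding bd' c_def by (rule bd)
    from less.hyps[OF _ eq'(1)[unfolded c'] fan' D1 len' vD1 bdu] lD obtain ts2 where
      ts2: "chain_equiv A B (fan_chain v ts2) \<alpha>" "fan A B v x g ts2 y h"
      "chain_length (fan_chain v ts2) = length ts2"
      "boundary (fan_chain v ts2) = boundary (fan_chain v ts' + D1)"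
      "wide S (fan_chain v ts2)"
      "\<forall>us p q f. ts' = us @ [(p, q, f)] \<and> edge f p q = u \<longrightarrow> (\<exists>us'. ts2 = us' @ [(p, q, f)])"
      using wide by auto
    \<comment> \<open>The flipped sector has an outer edge other than \<open>u\<close>. A last
      sector with outer edge \<open>u\<close> therefore lies in \<open>ws\<close> and is
      kept.\<close>
    have last: "\<exists>us'. ts2 = us' @ [(p0, q0, f0)]"
      if "ts = us0 @ [(p0, q0, f0)]" "edge f0 p0 q0 = u" for us0 p0 q0 f0
    proof -
      have "ws \<noteq> []"
      proof
        assume "ws = []"
        then have "(p, q, f) = (p0, q0, f0)" using that(1) unfolding ts by simp
        then show False using t(2) e(2) that(2) by simp
      qed
      moreover have "last ts = (p0, q0, f0)" using that(1) by simp
      ultimately have "ws = butlast ws @ [(p0, q0, f0)]"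
        unfolding ts by (metis append_butlast_last_id last.simps last_appendR list.distinct(1))
      then obtain ws' where "ws = ws' @ [(p0, q0, f0)]" by blast
      then have "ts' = (us @ [(p, w, k'), (w, q, k)] @ ws') @ [(p0, q0, f0)]" unfolding ts'_def by simp
      then show ?thesis using ts2(6) that(2) by blast
    qed
    show ?thesis
      using ts2(1-3,5) ts2(4)[unfolded bd' c_def] last by (intro exI[of _ ts2]) blast
  qed
qed

end

context nontrivial_amenable_family
begin

text \<open>If \<open>v\<close> occurs in \<open>D\<close>, it vanishes there, because
  \<open>u\<close> and the outer edges avoid it, so an RS-operation reduces to a rest without
  \<open>v\<close>. The fresh index is outside \<open>S\<close>, as \<open>S\<close> lies in the
  support of the chain; thus the renaming makes the chain wide if it was not.\<close>

lemma fan_extend: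
  assumes min: "minimal_chain A B \<alpha>" and u: "u \<in> simplices A B 1" "v \<notin> psupp u"
    and eqv: "chain_equiv A B (fan_chain v ts + D) \<alpha>"
    and fan: "fan A B v x g ts y h" and D: "D \<in> chain_group A B 2"
    and len: "chain_length (fan_chain v ts + D) = length ts + chain_length D"
    and bd: "boundary (fan_chain v ts + D) = sterm (ort v x) g - sterm (ort v y) h + frag_of u"
    and S: "S \<subseteq> csupp (boundary (fan_chain v ts + D))"
  obtains ts' where "chain_equiv A B (fan_chain v ts') \<alpha>" "fan A B v x g ts' y h"
    "chain_length (fan_chain v ts') = length ts'"
    "boundary (fan_chain v ts') = boundary (fan_chain v ts + D)"
    "wide S (fan_chain v ts + D) \<Longrightarrow> wide S (fan_chain v ts')"
    "\<And>us p q f. ts = us @ [(p, q, f)] \<Longrightarrow> edge f p q = u \<Longrightarrow> \<exists>us'. ts' = us' @ [(p, q, f)]"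
proof -
  have "\<exists>D'. chain_equiv A B (fan_chain v ts + D') \<alpha> \<and> D' \<in> chain_group A B 2 \<and>
      chain_length (fan_chain v ts + D') = length ts + chain_length D' \<and> v \<notin> csupp D' \<and>
      boundary (fan_chain v ts + D') = boundary (fan_chain v ts + D) \<and>
      (wide S (fan_chain v ts + D) \<longrightarrow> wide S (fan_chain v ts + D'))"
  proof (cases "v \<in> csupp D")
    case False
    then show ?thesis using eqv D len by blast
  next
    case True
    define c where "c = fan_chain v ts + D"
    have c: "c \<in> chain_group A B 2" using chain_equiv_group[OF eqv] unfolding c_def .
    have "chain_length c = chain_length (fan_chain v ts) + chain_length D"
      using len chain_length_fan_le[of v ts] chain_length_add_le[of "fan_chain v ts" D]
      unfolding c_def by linarith
    then have sub: "subchain D c" unfolding c_def by (rule subchain_add(2))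
    have bD: "boundary D = frag_of u - outer_chain ts"
      using bd unfolding boundary_add fan_boundary[OF fan] by (simp add: algebra_simps)
    have "v \<notin> psupp e" if "e \<in> terms (boundary D)" for e
      using that keys_diff[of "frag_of u" "outer_chain ts"] u(2) fan_outer_psupp[OF fan]
      unfolding bD by auto
    then have "vanishing_support D v" using True unfolding vanishing_support_def csupp_def by blast
    from RS_relabel[OF c sub this] obtain k D' where R: "k \<notin> csupp c" "RS_step c (c - D + D')"
      "D' \<in> chain_group A B 2" "boundary D' = boundary D" "v \<notin> csupp D'"
      "chain_length D' \<le> chain_length D"
      "chain_length (c - D + D') = chain_length c \<Longrightarrow> k \<in> csupp (c - D + D')" by blast
    have cD: "c - D = fan_chain v ts" unfolding c_def by simp
    have st: "CRRS_step A B c (fan_chain v ts + D')" using R(2) unfolding CRRS_step_def cD by blast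
    have g: "fan_chain v ts + D' \<in> chain_group A B 2"
      by (rule chain_group_add[OF fan_chain_group[OF fan] R(3)])
    note eq' = chain_equiv_step[OF eqv[folded c_def] st g]
    have l: "chain_length (fan_chain v ts + D') = length ts + chain_length D'"
      using eq'(2) len R(6) chain_length_fan_le[of v ts] chain_length_add_le[of "fan_chain v ts" D']
      unfolding c_def by linarith
    have "k \<in> csupp (fan_chain v ts + D')" using R(7) eq'(2) unfolding cD by blast
    moreover have "k \<notin> S" using R(1) S csupp_boundary[OF c] unfolding c_def by blast
    ultimately have "wide S (fan_chain v ts + D')" unfolding wide_def csupp_def by blast
    then show ?thesis using eq'(1) R(3,4,5) l by (auto simp: boundary_add)
  qed
  then obtain D' where D': "chain_equiv A B (fan_chain v ts + D') \<alpha>" "D' \<in> chain_group A B 2"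
      "chain_length (fan_chain v ts + D') = length ts + chain_length D'" "v \<notin> csupp D'"
      "boundary (fan_chain v ts + D') = boundary (fan_chain v ts + D)"
      "wide S (fan_chain v ts + D) \<Longrightarrow> wide S (fan_chain v ts + D')" by blast
  from fan_extend_disjoint[OF min u(1) D'(1) fan D'(2,3,4) D'(5)[unfolded bd], of S]
  obtain ts' where ts': "chain_equiv A B (fan_chain v ts') \<alpha>" "fan A B v x g ts' y h"
      "chain_length (fan_chain v ts') = length ts'"
      "boundary (fan_chain v ts') = boundary (fan_chain v ts + D')"
      "wide S (fan_chain v ts + D') \<longrightarrow> wide S (fan_chain v ts')"
      "\<forall>us p q f. ts = us @ [(p, q, f)] \<and> edge f p q = u \<longrightarrow> (\<exists>us'. ts' = us' @ [(p, q, f)])"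
    by blast
  show thesis
  proof (rule that[of ts'])
    show "boundary (fan_chain v ts') = boundary (fan_chain v ts + D)" using ts'(4) D'(5) by simp
    show "wide S (fan_chain v ts')" if "wide S (fan_chain v ts + D)" using that ts'(5) D'(6) by blast
    show "\<exists>us'. ts' = us' @ [(p, q, f)]" if "ts = us @ [(p, q, f)]" "edge f p q = u" for us p q f
      using that ts'(6) by blast
  qed (fact ts'(1-3))+
qed

end

text \<open>If no index \<open>p\<close> had different neighbours, the sequence would alternate and could not run from
  \<open>x\<close> to \<open>y\<close> through a third value.\<close>

lemma shortening_index:
  fixes X :: "nat \<Rightarrow> 'a"
  assumes ends: "X 0 = x" "X n = y" "x \<noteq> y" and i: "0 < i" "i < n" "X i \<notin> {x, y}"
  obtains p where "0 < p" "p < n" "X (p - 1) \<noteq> X (p + 1)"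
    "n = 2 \<or> (\<exists>j. 0 < j \<and> j < n \<and> j \<noteq> p \<and> X j \<notin> {x, y})"
proof (cases "\<exists>j. 0 < j \<and> j < n \<and> j \<noteq> i \<and> X j \<notin> {x, y}")
  case True
  then obtain j where j: "0 < j" "j < n" "j \<noteq> i" "X j \<notin> {x, y}" by blast
  have "\<exists>p. 0 < p \<and> p < n \<and> X (p - 1) \<noteq> X (p + 1)"
  proof (rule ccontr)
    assume no: "\<not> ?thesis"
    have step: "X (m + 2) = X m" if "m + 2 \<le> n" for m
      using no[unfolded not_ex, THEN spec[of _ "m + 1"]] that by simp
    have alt: "X m = (if even m then x else X 1)" if "m \<le> n" for m
      using that
    proof (induction m rule: less_induct)
      case (less m)
      consider "m = 0" | "m = 1" | m' where "m = m' + 2"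
        by (cases m; cases "m - 1") auto
      then show ?case
      proof cases
        case 3
        then show ?thesis using less.IH[of m'] step[of m'] less.prems by auto
      qed (use ends(1) in auto)
    qed
    have "X 1 = y" using alt[of n] ends(2,3) by (auto split: if_splits)
    then show False using alt[of i] i by (auto split: if_splits)
  qed
  then obtain p where p: "0 < p" "p < n" "X (p - 1) \<noteq> X (p + 1)" by blast
  show thesis
  proof (rule that[OF p])
    show "n = 2 \<or> (\<exists>j. 0 < j \<and> j < n \<and> j \<noteq> p \<and> X j \<notin> {x, y})"
      using i j by (cases "p = i") blast+
  qed
next
  case False
  then have other: "X j \<in> {x, y}" if "j \<le> n" "j \<noteq> i" for j
    using that ends False[unfolded not_ex, THEN spec[of _ j]]
    by (cases "j = 0"; cases "j = n") simp_all
  \<comment> \<open>Here \<open>i\<close> is the only inner place with a third value. For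
    \<open>n\<close> above 2 a neighbour of \<open>i\<close> serves as \<open>p\<close>: one of its
    neighbours is \<open>i\<close>, the other has value \<open>x\<close> or \<open>y\<close>, and
    \<open>i\<close> itself is kept for the next round.\<close>
  consider "n = 2" | "i + 1 < n" | "0 < i - 1" "i + 1 = n" using i by linarith
  then show thesis
  proof cases
    case 1
    then have "i = 1" using i by simp
    then show thesis using that[of 1] 1 ends by (simp add: numeral_2_eq_2)
  next
    case 2
    have "X (i + 2) \<in> {x, y}" by (rule other) (use 2 in auto)
    then have "X (i + 1 - 1) \<noteq> X (i + 1 + 1)" using i(3)
      by (metis add.assoc add_diff_cancel_right' one_add_one)
    moreover have "0 < i \<and> i < n \<and> i \<noteq> i + 1 \<and> X i \<notin> {x, y}" using i by simp
    ultimately show thesis using that[of "i + 1"] 2 by blast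
  next
    case 3
    have "X (i - 1 - 1) \<in> {x, y}" by (rule other) (use 3 in auto)
    then have "X (i - 1 - 1) \<noteq> X (i - 1 + 1)" using i 3 by auto
    moreover have "0 < i \<and> i < n \<and> i \<noteq> i - 1 \<and> X i \<notin> {x, y}" using i by simp
    moreover have "i - 1 < n" using 3 by simp
    ultimately show thesis using that[of "i - 1"] 3(1) by blast
  qed
qed

section \<open>Shortening a fan by flips of its inner edges\<close>

context nontrivial_amenable_family
begin

text \<open>Flipping the edge \<open>vm\<close> between two consecutive sectors merges them into one
  from \<open>a\<close> to \<open>b\<close> and sends the triangle on \<open>m\<close>,
  \<open>a\<close>, \<open>b\<close> to the rest. This requires \<open>a\<close> and
  \<open>b\<close> to differ. The last hypothesis keeps the process from getting stuck on a walk
  alternating between \<open>x\<close> and \<open>y\<close>, and it is preserved until only two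
  sectors are left.\<close>

lemma fan_shorten:
  "\<lbrakk>chain_equiv A B (fan_chain v ts + D) \<alpha>; fan A B v x g ts y h; D \<in> chain_group A B 2;
     chain_length (fan_chain v ts + D) = length ts + chain_length D; x \<noteq> y;
     \<exists>t\<in>set ts. fst t \<notin> {x, y}\<rbrakk>
   \<Longrightarrow> \<exists>a D'. chain_equiv A B (fan_chain v [(x, y, a)] + D') \<alpha> \<and> fan A B v x g [(x, y, a)] y h \<and>
     D' \<in> chain_group A B 2 \<and>
     chain_length (fan_chain v [(x, y, a)] + D') = Suc (chain_length D') \<and>
     boundary (fan_chain v [(x, y, a)] + D') = boundary (fan_chain v ts + D)"
proof (induction "length ts" arbitrary: ts D rule: less_induct)
  case less
  note eqv = less.prems(1) and fan = less.prems(2) and D = less.prems(3) and len = less.prems(4)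
    and xy = less.prems(5)
  define n where "n = length ts"
  \<comment> \<open>The indices met by the walk, closed by \<open>y\<close> at position
    \<open>n\<close>, where the list has no entry.\<close>
  define X where "X = (\<lambda>i. if i < n then fst (ts ! i) else y)"
  obtain i where i: "i < n" "fst (ts ! i) \<notin> {x, y}"
    using less.prems(6) unfolding n_def by (metis in_set_conv_nth)
  have X0: "X 0 = x" using i(1) fan unfolding X_def n_def by (cases ts) auto
  have i0: "0 < i" using i X0 unfolding X_def by (metis gr0I insertI1)
  have Xi: "X i \<notin> {x, y}" using i unfolding X_def by simp
  have Xn: "X n = y" unfolding X_def by simp
  obtain p where p: "0 < p" "p < n" "X (p - 1) \<noteq> X (p + 1)"
    "n = 2 \<or> (\<exists>j. 0 < j \<and> j < n \<and> j \<noteq> p \<and> X j \<notin> {x, y})"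
    by (rule shortening_index[OF X0 Xn xy i0 i(1) Xi])
  define r where "r = p - 1"
  have r: "p = Suc r" "Suc r < n" using p unfolding r_def by auto
  obtain a m f where t1: "ts ! r = (a, m, f)" by (cases "ts ! r")
  obtain m' b f' where t2: "ts ! Suc r = (m', b, f')" by (cases "ts ! Suc r")
  define us ws where "us = take r ts" and "ws = drop (Suc (Suc r)) ts"
  have ts: "ts = us @ (a, m, f) # (m', b, f') # ws"
    using id_take_nth_drop[of r ts] Cons_nth_drop_Suc[of "Suc r" ts] r(2) t1 t2
    unfolding us_def ws_def n_def by simp
  have mm: "m' = m" using fan unfolding ts fan_append by auto
  have e: "edge f v m = edge f' v m" using fan unfolding ts fan_append by auto
  note s1 = fan_sector[OF fan, of a m f] and s2 = fan_sector[OF fan, of m b f']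
  have mem: "(a, m, f) \<in> set ts" "(m, b, f') \<in> set ts" unfolding ts mm by auto
  note s1 = s1[OF mem(1)] and s2 = s2[OF mem(2)]
  have "X (p - 1) = a" using r t1 unfolding X_def r_def by simp
  moreover have "X (p + 1) = b"
  proof (cases ws)
    case Nil
    then have "\<not> Suc (Suc r) < n" unfolding ws_def n_def by simp
    moreover have "b = y" using fan Nil unfolding ts fan_append by auto
    ultimately show ?thesis unfolding X_def r(1) by simp
  next
    case (Cons t ws')
    then have "Suc (Suc r) < n" unfolding ws_def n_def by (metis drop_all list.distinct(1) not_le)
    moreover have "ts ! Suc (Suc r) = t"
      using Cons unfolding ws_def by (metis nth_via_drop)
    moreover have "fst t = b" using fan Cons unfolding ts fan_append by (cases t) auto
    ultimately show ?thesis unfolding X_def r(1) by simp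
  qed
  ultimately have ab: "a \<noteq> b" using p(3) by simp
  have dist: "distinct [v, m, a, b]" using s1(3) s2(3) ab by auto
  define c where "c = fan_chain v ts + D"
  define w0 where "w0 = sterm (ort3 v a m) f + sterm (ort3 v m b) f'"
  have cw: "c - w0 = fan_chain v (us @ ws) + D"
    unfolding c_def w0_def ts mm by (simp add: sector_chain_def algebra_simps)
  have nl: "length ts = Suc (Suc (length (us @ ws)))" unfolding ts by simp
  have "chain_length (c - w0) \<le> length (us @ ws) + chain_length D"
    unfolding cw using chain_length_add_le[of "fan_chain v (us @ ws)" D]
      chain_length_fan_le[of v "us @ ws"] by linarith
  moreover have "chain_length w0 \<le> 2"
    unfolding w0_def using chain_length_add_le[of "sterm (ort3 v a m) f" "sterm (ort3 v m b) f'"] by simp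
  moreover have "chain_length c \<le> chain_length w0 + chain_length (c - w0)"
    using chain_length_add_le[of w0 "c - w0"] by simp
  moreover have lc: "chain_length c = length ts + chain_length D" using len unfolding c_def .
  ultimately have "chain_length c = chain_length w0 + chain_length (c - w0)"
    using nl by linarith
  then have sub: "subchain w0 c" unfolding subchain_iff_length .
  have c: "c \<in> chain_group A B 2" using eqv unfolding c_def by (rule chain_equiv_group)
  have p1: "psupp f = {v, m, a}" "psupp f' = {v, m, b}" using s1(2) s2(2) by auto
  have rot: "ort3 v m a = - ort3 v a m" using ort3_swap(2)[of v a m] dist by auto
  \<comment> \<open>The flip is applied to the diagonal \<open>vm\<close>. In the order
    \<open>v\<close>, \<open>m\<close>, \<open>a\<close> the first sector is traversed backwards,
    hence the sign -1.\<close>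
  have \<epsilon>: "- 1 = ort3 v a m * ort3 v m a" unfolding rot by simp
  have sg: "ort3 v a m * ort3 v m a = - (ort3 v m b * ort3 v m b)" unfolding \<epsilon>[symmetric] by simp
  have units: "ort3 v a m \<in> {1, -1}" "ort3 v m b \<in> {1, -1}" by (auto simp: ort3_def ort_def)
  obtain k k' where k: "k \<in> simplices A B 2" "psupp k = {m, a, b}"
    "k' \<in> simplices A B 2" "psupp k' = {v, a, b}"
    "edge k m a = edge f m a" "edge k m b = edge f' m b"
    "edge k' v a = edge f v a" "edge k' v b = edge f' v b" "edge k a b = edge k' a b"
    "CR_step A B c (c - w0 + (sterm (- 1 * ort3 m a b) k - sterm (- 1 * ort3 v a b) k'))"
    "boundary (sterm (- 1 * ort3 m a b) k - sterm (- 1 * ort3 v a b) k') = boundary w0"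
    unfolding w0_def
    by (rule CR_flip[OF c s1(1) p1(1) s2(1) p1(2) dist e units sg sub[unfolded w0_def] \<epsilon>])
  define ts' where "ts' = us @ [(a, b, k')] @ ws"
  define D' where "D' = D + sterm (- ort3 m a b) k"
  let ?c' = "c - w0 + (sterm (- 1 * ort3 m a b) k - sterm (- 1 * ort3 v a b) k')"
  have c': "?c' = fan_chain v ts' + D'"
    unfolding cw ts'_def D'_def by (simp add: sector_chain_def algebra_simps flip: minus_frag_cmul)
  have D': "D' \<in> chain_group A B 2"
    unfolding D'_def by (rule chain_group_add[OF D chain_group_sterm[OF k(1)]])
  have fan': "fan A B v x g ts' y h"
    using fan k(3,4,7,8) dist unfolding ts mm ts'_def fan_append by auto
  have c'g: "?c' \<in> chain_group A B 2"
    unfolding c' by (rule chain_group_add[OF fan_chain_group[OF fan'] D'])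
  have crrs: "CRRS_step A B c ?c'" using k(10) unfolding CRRS_step_def by blast
  note eq' = chain_equiv_step[OF eqv[folded c_def] crrs c'g]
  have nl': "length ts = Suc (length ts')" unfolding nl ts'_def by simp
  have "chain_length D' \<le> Suc (chain_length D)"
    unfolding D'_def using chain_length_add_le[of D "sterm (- ort3 m a b) k"] by simp
  then have len': "chain_length (fan_chain v ts' + D') = length ts' + chain_length D'"
    using eq'(2)[unfolded c'] lc nl' chain_length_fan_le[of v ts']
      chain_length_add_le[of "fan_chain v ts'" D'] by linarith
  have bd': "boundary (fan_chain v ts' + D') = boundary (fan_chain v ts + D)"
    unfolding c'[symmetric] using k(11) unfolding c_def by (simp add: boundary_add boundary_diff)
  show ?case
  \<comment> \<open>From two sectors the flip produces the single sector from \<open>x\<close> to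
    \<open>y\<close>. From more, a third index other than the removed one is still present.\<close>
  proof (cases "n = 2")
    case True
    then have "length us = 0" "length ws = 0" using nl unfolding n_def by auto
    then have ts1: "ts' = [(a, b, k')]" unfolding ts'_def by simp
    then have "a = x" "b = y" using fan' by auto
    then show ?thesis using eq'(1)[unfolded c'] fan' D' len' bd' unfolding ts1 by auto
  next
    case False
    then obtain j where j: "0 < j" "j < n" "j \<noteq> Suc r" "X j \<notin> {x, y}" using p(4) r(1) by blast
    have Xj: "X j = fst (ts ! j)" using j(2) unfolding X_def by simp
    have "\<exists>t\<in>set ts'. fst t = X j"
    proof -
      consider "j < r" | "j = r" | "Suc r < j" using j(3) by linarith
      then show ?thesis
      proof cases
        case 1
        then have "ts ! j \<in> set us" using j(2) unfolding us_def n_def in_set_conv_nth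
          by (intro exI[of _ j]) simp
        then show ?thesis unfolding Xj ts'_def by auto
      next
        case 2
        then show ?thesis unfolding Xj ts'_def using t1 by simp
      next
        case 3
        then obtain l where l: "j = Suc (Suc r) + l" by (metis Suc_leI le_Suc_ex)
        have "ws ! l \<in> set ws" using j(2) unfolding ws_def n_def l by (intro nth_mem) simp
        then have "ts ! j \<in> set ws" using j(2) unfolding ws_def n_def l by simp
        then show ?thesis unfolding Xj ts'_def by auto
      qed
    qed
    then have "\<exists>t\<in>set ts'. fst t \<notin> {x, y}" using j(4) by metis
    from less.hyps[OF _ eq'(1)[unfolded c'] fan' D' len' xy this] nl' show ?thesis
      unfolding bd' by simp
  qed
qed

end

context amenable_family
begin

text \<open>The coefficients in the boundary of a triangle add up to 1, so a chain and its boundary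
  have the same coefficient sum, and this sum has the parity of the length. For a 1-shell boundary
  the length is odd.\<close>

lemma parity_chain_length:
  assumes c: "c \<in> chain_group A B 2"
  shows "even (int (chain_length c) - pairing (\<lambda>_. 1) (boundary c))"
proof -
  have one: "pairing (\<lambda>_. 1) (boundary (frag_of f)) = 1" if f: "f \<in> terms c" for f
  proof -
    have fs: "f \<in> simplices A B 2" using f c unfolding chain_group_def by blast
    obtain v where "v \<in> psupp f" using simplexD(3)[OF fs] by fastforce
    from triangle_with_vertex[OF fs this] obtain x y where
      p: "psupp f = {v, x, y}" "v \<noteq> x" "x \<noteq> y" "v \<noteq> y" .
    have "ort3 v x y * (ort x y - ort v y + ort v x) = 1"
      using p(2-4) unfolding ort3_def ort_def
      by (cases "v < x"; cases "x < y"; cases "v < y") simp_all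
    then show ?thesis unfolding boundary_triangle[OF p] by simp
  qed
  have "pairing (\<lambda>_. 1) (boundary c) = (\<Sum>f\<in>terms c. coeff c f)"
    unfolding boundary_pairing[of _ c] using one by simp
  then have "int (chain_length c) - pairing (\<lambda>_. 1) (boundary c) =
      (\<Sum>f\<in>terms c. \<bar>coeff c f\<bar> - coeff c f)"
    unfolding chain_length_def by (simp add: sum_subtractf)
  also have "even \<dots>" by (rule dvd_sum) (auto simp: abs_if)
  finally show ?thesis .
qed

end

subsection \<open>Chain-walks as fans around 0\<close>

lemma fan_consecutive:
  assumes fan: "fan A B v x g ts y h" and i: "Suc i < length ts"
    and t: "ts ! i = (p, q, f)" "ts ! Suc i = (p', q', f')"
  shows "p' = q" "edge f v q = edge f' v q"
proof -
  have "ts = take i ts @ (p, q, f) # (p', q', f') # drop (Suc (Suc i)) ts"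
    using id_take_nth_drop[of i ts] Cons_nth_drop_Suc[of "Suc i" ts] i t by simp
  with fan have "fan A B v x g (take i ts @ (p, q, f) # (p', q', f') # drop (Suc (Suc i)) ts) y h"
    by simp
  then show "p' = q" "edge f v q = edge f' v q" unfolding fan_append by auto
qed

lemma fan_last: "fan A B v x g (ts @ [(p, q, f)]) y h \<Longrightarrow> q = y \<and> edge f v y = h"
  by (auto simp: fan_append)

lemma fan_map_upt:
  assumes "\<And>i. i \<le> m \<Longrightarrow> b i \<in> simplices A B 2 \<and> psupp (b i) = {v, k i, k (Suc i)} \<and>
      distinct [v, k i, k (Suc i)]"
    and "\<And>i. i < m \<Longrightarrow> edge (b i) v (k (Suc i)) = edge (b (Suc i)) v (k (Suc i))"
  shows "fan A B v (k 0) (edge (b 0) v (k 0)) (map (\<lambda>i. (k i, k (Suc i), b i)) [0..<Suc m])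
    (k (Suc m)) (edge (b m) v (k (Suc m)))"
  using assms
proof (induction m)
  case 0
  then show ?case by auto
next
  case (Suc m)
  have "fan A B v (k 0) (edge (b 0) v (k 0)) (map (\<lambda>i. (k i, k (Suc i), b i)) [0..<Suc m])
    (k (Suc m)) (edge (b m) v (k (Suc m)))"
    by (rule Suc.IH) (use Suc.prems in auto)
  moreover have "fan A B v (k (Suc m)) (edge (b m) v (k (Suc m)))
      [(k (Suc m), k (Suc (Suc m)), b (Suc m))] (k (Suc (Suc m))) (edge (b (Suc m)) v (k (Suc (Suc m))))"
    using Suc.prems(1)[of "Suc m"] Suc.prems(2)[of m] by simp
  ultimately have "fan A B v (k 0) (edge (b 0) v (k 0)) (map (\<lambda>i. (k i, k (Suc i), b i)) [0..<Suc m] @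
      [(k (Suc m), k (Suc (Suc m)), b (Suc m))]) (k (Suc (Suc m))) (edge (b (Suc m)) v (k (Suc (Suc m))))"
    unfolding fan_append by blast
  then show ?case by (simp only: upt_Suc_append[of 0 "Suc m"] le0 map_append list.map)
qed

lemma fan_chain_sum: "length ts = Suc m \<Longrightarrow> fan_chain v ts = (\<Sum>i\<le>m. sector_chain v (ts ! i))"
  unfolding fan_chain_def sum_list_sum_nth by (simp add: atLeast0LessThan lessThan_Suc_atMost)

lemma sterm_eqD: "sterm s g = sterm t h \<Longrightarrow> s \<noteq> 0 \<Longrightarrow> s = t \<and> g = h"
  by (metis keys_cmul_iff keys_frag_of lookup_frag_cmul lookup_frag_of mult_cancel_left1 mult.right_neutral
      singletonD singletonI)

text \<open>The other sectors supply at most one unit each, so in a faithful display the chosen one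
  must contribute its full unit of length.\<close>

lemma fan_sector_subchain:
  assumes "chain_length (fan_chain v ts) = length ts" "t \<in> set ts"
  shows "subchain (sector_chain v t) (fan_chain v ts)"
proof -
  obtain us ws where ts: "ts = us @ t # ws" using assms(2) by (meson split_list)
  have eq: "fan_chain v ts = sector_chain v t + fan_chain v (us @ ws)" unfolding ts by (simp add: algebra_simps)
  have "chain_length (sector_chain v t + fan_chain v (us @ ws)) =
      chain_length (sector_chain v t) + chain_length (fan_chain v (us @ ws))"
    using assms(1) chain_length_fan_le[of v "us @ ws"]
      chain_length_add_le[of "sector_chain v t" "fan_chain v (us @ ws)"]
    unfolding eq by (simp add: ts)
  then show ?thesis unfolding eq by (rule subchain_add(1))
qed

lemma fan_chain_terms: "terms (fan_chain v ts) \<subseteq> (\<lambda>(p, q, f). f) ` set ts"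
proof (induction ts)
  case (Cons t ts)
  obtain p q f where t: "t = (p, q, f)" by (cases t)
  have "terms (sector_chain v t) \<subseteq> {f}" unfolding t sector_chain_def by auto
  moreover have "terms (fan_chain v (t # ts)) \<subseteq> terms (sector_chain v t) \<union> terms (fan_chain v ts)"
    unfolding fan_chain_simps by (rule keys_add)
  moreover have "(\<lambda>(p, q, f). f) ` set (t # ts) = insert f ((\<lambda>(p, q, f). f) ` set ts)"
    unfolding t by simp
  ultimately show ?case using Cons by blast
qed simp

lemma part_on_add: "part_on (c + d) s = part_on c s + part_on d s"
  and part_on_diff: "part_on (c - d) s = part_on c s - part_on d s"
  and part_on_cmul: "part_on (frag_cmul k c) s = frag_cmul k (part_on c s)"
  and part_on_frag_of: "part_on (frag_of e) s = (if psupp e = s then frag_of e else 0)"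
  by (simp_all add: part_on_def frag_extend_add frag_extend_diff frag_extend_cmul)

lemma part_on_boundary:
  assumes f: "f \<in> simplices A B 2" "psupp f = {v, x, z}" "distinct [v, x, z]"
  shows "part_on (boundary (sterm s f)) {v, x} = sterm (s * ort3 v x z * ort v x) (edge f v x)"
proof -
  have ps: "psupp (edge f x z) = {x, z}" "psupp (edge f v z) = {v, z}" "psupp (edge f v x) = {v, x}"
    using psupp_edge[OF f(1)] f(2) by auto
  have ne: "{x, z} \<noteq> {v, x}" "{v, z} \<noteq> {v, x}" using f(3) by (auto simp: doubleton_eq_iff)
  show ?thesis
    unfolding boundary_cmul part_on_cmul boundary_triangle[OF f(2)]
    using f(3) ne by (simp add: boundary_triangle[OF f(2)] part_on_cmul part_on_add part_on_diff
        part_on_frag_of ps mult.assoc)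
qed

lemma ort_0 [simp]: "x \<noteq> 0 \<Longrightarrow> ort 0 x = 1"
  by (simp add: ort_def)

text \<open>The conditions on a walk force its signs: the starting edge fixes the first one, and
  cancellation at each shared edge propagates it. So each triangle occurs with the sign of the order
  0, \<open>k i\<close>, \<open>k (Suc i)\<close>, which is the convention for sectors around
  0.\<close>

lemma chain_walk_imp_fan:
  assumes "chain_walk A B \<alpha> f01 f02 m \<epsilon> b"
  obtains ts where "fan A B 0 1 f01 ts 2 f02" "length ts = Suc m"
    "subchain (fan_chain 0 ts) \<alpha>" "chain_length (fan_chain 0 ts) = length ts"
    "(\<Sum>i\<le>m. sterm (\<epsilon> i) (b i)) = fan_chain 0 ts"
    "\<forall>i\<le>m. \<exists>p q. ts ! i = (p, q, b i) \<and> \<epsilon> i = ort3 0 p q"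
proof -
  have \<epsilon>: "\<epsilon> i \<in> {1, -1}" "b i \<in> simplices A B 2" if "i \<le> m" for i
    using assms that unfolding chain_walk_def by auto
  have sub: "subchain (\<Sum>i\<le>m. sterm (\<epsilon> i) (b i)) \<alpha>"
    and len: "chain_length (\<Sum>i\<le>m. sterm (\<epsilon> i) (b i)) = m + 1"
    using assms unfolding chain_walk_def by blast+
  obtain k :: "nat \<Rightarrow> nat" where k: "\<forall>i\<le>m + 1. k i \<noteq> 0" "k 0 = 1" "k (m + 1) = 2"
    "\<forall>i\<le>m. psupp (b i) = {k i, k (i + 1), 0}"
    "part_on (boundary (sterm (\<epsilon> 0) (b 0))) {0, 1} = frag_of f01"
    "part_on (boundary (sterm (\<epsilon> m) (b m))) {0, 2} = - frag_of f02"
    "\<forall>i<m. part_on (boundary (sterm (\<epsilon> i) (b i))) {0, k (i + 1)} +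
           part_on (boundary (sterm (\<epsilon> (i + 1)) (b (i + 1)))) {0, k (i + 1)} = 0"
    using assms unfolding chain_walk_def by blast
  have ps: "psupp (b i) = {0, k i, k (Suc i)}" "distinct [0, k i, k (Suc i)]"
    "distinct [0, k (Suc i), k i]" if "i \<le> m" for i
  proof -
    show p: "psupp (b i) = {0, k i, k (Suc i)}" using k(4) that by auto
    have "k i \<noteq> 0" "k (Suc i) \<noteq> 0" using k(1) that by auto
    moreover have "card {0, k i, k (Suc i)} = 3" using simplexD(3)[OF \<epsilon>(2)[OF that]] p by simp
    then have "k i \<noteq> k (Suc i)" by (auto simp: card_insert_if split: if_splits)
    ultimately show "distinct [0, k i, k (Suc i)]" "distinct [0, k (Suc i), k i]" by auto
  qed
  define o3 where "o3 = (\<lambda>i. ort3 0 (k i) (k (Suc i)))"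
  have left: "part_on (boundary (sterm (\<epsilon> i) (b i))) {0, k i} = sterm (\<epsilon> i * o3 i) (edge (b i) 0 (k i))"
    if "i \<le> m" for i
    using part_on_boundary[OF \<epsilon>(2)[OF that] ps(1,2)[OF that]] ps(2)[OF that] unfolding o3_def by simp
  have right: "part_on (boundary (sterm (\<epsilon> i) (b i))) {0, k (Suc i)} =
      sterm (- (\<epsilon> i * o3 i)) (edge (b i) 0 (k (Suc i)))" if i: "i \<le> m" for i
  proof -
    have "psupp (b i) = {0, k (Suc i), k i}" using ps(1)[OF i] by auto
    from part_on_boundary[OF \<epsilon>(2)[OF i] this ps(3)[OF i]] show ?thesis
      using ps(2)[OF i] ort3_swap(2)[of 0 "k i" "k (Suc i)"] unfolding o3_def by simp
  qed
  have unit: "\<epsilon> i * o3 i \<noteq> 0" if "i \<le> m" for i using \<epsilon>(1)[OF that] unfolding o3_def by auto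
  have s0: "sterm (\<epsilon> 0 * o3 0) (edge (b 0) 0 1) = sterm 1 f01"
    using left[of 0] k(2,5) by simp
  have start: "\<epsilon> 0 * o3 0 = 1" "edge (b 0) 0 1 = f01" using sterm_eqD[OF s0 unit[OF le0]] by simp_all
  have step: "\<epsilon> i * o3 i = \<epsilon> (Suc i) * o3 (Suc i) \<and> edge (b i) 0 (k (Suc i)) = edge (b (Suc i)) 0 (k (Suc i))"
    if "i < m" for i
  proof -
    have "part_on (boundary (sterm (\<epsilon> i) (b i))) {0, k (Suc i)} +
           part_on (boundary (sterm (\<epsilon> (Suc i)) (b (Suc i)))) {0, k (Suc i)} = 0"
      using k(7) that by simp
    then have "sterm (- (\<epsilon> i * o3 i)) (edge (b i) 0 (k (Suc i))) +
        sterm (\<epsilon> (Suc i) * o3 (Suc i)) (edge (b (Suc i)) 0 (k (Suc i))) = 0"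
      unfolding right[OF less_imp_le[OF that]] left[OF Suc_leI[OF that]] .
    then have "sterm (\<epsilon> i * o3 i) (edge (b i) 0 (k (Suc i))) =
        sterm (\<epsilon> (Suc i) * o3 (Suc i)) (edge (b (Suc i)) 0 (k (Suc i)))"
      by (simp only: minus_frag_cmul[symmetric] neg_eq_iff_add_eq_0[symmetric] minus_minus)
    then show ?thesis by (rule sterm_eqD[OF _ unit[OF less_imp_le[OF that]]])
  qed
  have one: "\<epsilon> i * o3 i = 1" if "i \<le> m" for i
    using that by (induction i) (use start(1) step in auto)
  have \<epsilon>o: "\<epsilon> i = o3 i" if "i \<le> m" for i
  proof -
    have "\<epsilon> i * o3 i * o3 i = \<epsilon> i" unfolding o3_def by (simp add: mult.assoc)
    then show ?thesis using one[OF that] by simp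
  qed
  have "sterm (- 1) (edge (b m) 0 2) = sterm (- 1) f02"
    using right[of m] k(3,6) one[of m] by simp
  then have stop: "edge (b m) 0 2 = f02" by (simp add: frag_of_eq)
  define ts where "ts = map (\<lambda>i. (k i, k (Suc i), b i)) [0..<Suc m]"
  have lts: "length ts = Suc m" unfolding ts_def by simp
  have nth: "ts ! i = (k i, k (Suc i), b i)" if "i \<le> m" for i
    using that unfolding ts_def by (simp del: upt_Suc)
  have "fan A B 0 (k 0) (edge (b 0) 0 (k 0)) ts (k (Suc m)) (edge (b m) 0 (k (Suc m)))"
    unfolding ts_def by (rule fan_map_upt) (use \<epsilon>(2) ps step in auto)
  then have fan: "fan A B 0 1 f01 ts 2 f02" using k(2,3) start(2) stop by simp
  have sum: "(\<Sum>i\<le>m. sterm (\<epsilon> i) (b i)) = fan_chain 0 ts"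
    unfolding fan_chain_sum[OF lts] by (rule sum.cong) (simp_all add: nth sector_chain_def \<epsilon>o o3_def)
  show thesis
  proof (rule that[OF fan lts])
    show "subchain (fan_chain 0 ts) \<alpha>" using sub unfolding sum .
    show "chain_length (fan_chain 0 ts) = length ts" using len unfolding sum lts by simp
    show "\<forall>i\<le>m. \<exists>p q. ts ! i = (p, q, b i) \<and> \<epsilon> i = ort3 0 p q"
      using nth \<epsilon>o unfolding o3_def by blast
  qed (rule sum)
qed

lemma fan_imp_chain_walk:
  assumes fan: "fan A B 0 1 f01 ts 2 f02" and lts: "length ts = Suc m"
    and len: "chain_length (fan_chain 0 ts) = length ts"
    and \<epsilon>: "\<And>i. \<epsilon> i = ort3 0 (fst (ts ! i)) (fst (snd (ts ! i)))" and b: "\<And>i. b i = snd (snd (ts ! i))"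
  shows "chain_walk A B (fan_chain 0 ts) f01 f02 m \<epsilon> b"
    "fan_chain 0 ts = (\<Sum>i\<le>m. sterm (\<epsilon> i) (b i))"
proof -
  show sum: "fan_chain 0 ts = (\<Sum>i\<le>m. sterm (\<epsilon> i) (b i))"
    unfolding fan_chain_sum[OF lts] sector_chain_def \<epsilon> b by (simp add: case_prod_beta)
  \<comment> \<open>Past the last sector, where \<open>ts\<close> has no entry, the index is the end
    point 2.\<close>
  define k where "k = (\<lambda>i. if i \<le> m then fst (ts ! i) else 2)"
  have mem: "ts ! i \<in> set ts" if "i \<le> m" for i using lts that by simp
  have ne: "ts \<noteq> []" using lts by auto
  have hd: "fst (ts ! 0) = 1" "edge (b 0) 0 1 = f01"
    using fan ne unfolding b by (cases ts; auto)+
  have last: "fst (snd (ts ! m)) = 2" "edge (b m) 0 2 = f02"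
  proof -
    have "ts = take m ts @ [ts ! m]" using lts by (metis take_Suc_conv_app_nth lessI order_refl take_all)
    then have "fan A B 0 1 f01 (take m ts @ [(fst (ts ! m), fst (snd (ts ! m)), b m)]) 2 f02"
      using fan unfolding b by simp
    from fan_last[OF this] show "fst (snd (ts ! m)) = 2" "edge (b m) 0 2 = f02" by simp_all
  qed
  have next_k: "fst (snd (ts ! i)) = k (Suc i)"
    and next_e: "i < m \<Longrightarrow> edge (b i) 0 (k (Suc i)) = edge (b (Suc i)) 0 (k (Suc i))" if i: "i \<le> m" for i
  proof -
    have c: "fst (ts ! Suc i) = fst (snd (ts ! i)) \<and>
        edge (b i) 0 (fst (snd (ts ! i))) = edge (b (Suc i)) 0 (fst (snd (ts ! i)))" if "i < m"
    proof -
      obtain p q f where t1: "ts ! i = (p, q, f)" by (cases "ts ! i")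
      obtain p' q' f' where t2: "ts ! Suc i = (p', q', f')" by (cases "ts ! Suc i")
      show ?thesis using fan_consecutive[OF fan _ t1 t2] that lts unfolding b t1 t2 by simp
    qed
    show *: "fst (snd (ts ! i)) = k (Suc i)"
    proof (cases "i < m")
      case True
      then show ?thesis using c unfolding k_def by simp
    next
      case False
      then have "i = m" using i by simp
      then show ?thesis using last(1) unfolding k_def by simp
    qed
    show "edge (b i) 0 (k (Suc i)) = edge (b (Suc i)) 0 (k (Suc i))" if "i < m"
      using c[OF that] * by simp
  qed
  have t: "ts ! i = (k i, k (Suc i), b i)" if "i \<le> m" for i
    using next_k[OF that] that unfolding b k_def by (simp add: prod_eq_iff)
  have sec: "b i \<in> simplices A B 2" "psupp (b i) = {0, k i, k (Suc i)}" "distinct [0, k i, k (Suc i)]"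
    if "i \<le> m" for i
    using fan_sector[OF fan, of "k i" "k (Suc i)" "b i"] mem[OF that] t[OF that] by auto
  have \<epsilon>k: "\<epsilon> i = ort3 0 (k i) (k (Suc i))" if "i \<le> m" for i unfolding \<epsilon> t[OF that] by simp
  have left: "part_on (boundary (sterm (\<epsilon> i) (b i))) {0, k i} = frag_of (edge (b i) 0 (k i))"
    if i: "i \<le> m" for i
    unfolding part_on_boundary[OF sec[OF i]] using sec(3)[OF i] unfolding \<epsilon>k[OF i] by simp
  have right: "part_on (boundary (sterm (\<epsilon> i) (b i))) {0, k (Suc i)} =
      - frag_of (edge (b i) 0 (k (Suc i)))" if i: "i \<le> m" for i
  proof -
    have "psupp (b i) = {0, k (Suc i), k i}" "distinct [0, k (Suc i), k i]" using sec(2,3)[OF i] by auto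
    from part_on_boundary[OF sec(1)[OF i] this] show ?thesis
      using sec(3)[OF i] ort3_swap(2)[of 0 "k i" "k (Suc i)"] unfolding \<epsilon>k[OF i] by simp
  qed
  have k0: "k 0 = 1" using hd(1) unfolding k_def by simp
  have km: "k (m + 1) = 2" unfolding k_def by simp
  show "chain_walk A B (fan_chain 0 ts) f01 f02 m \<epsilon> b"
    unfolding chain_walk_def sum[symmetric]
  proof (intro conjI allI impI exI[of _ k])
    fix i assume "i \<le> m + 1"
    then show "k i \<noteq> 0" using sec(3)[of i] km by (cases "i = m + 1") auto
  next
    show "part_on (boundary (sterm (\<epsilon> 0) (b 0))) {0, 1} = frag_of f01"
      using left[of 0] k0 hd(2) by simp
    show "part_on (boundary (sterm (\<epsilon> m) (b m))) {0, 2} = - frag_of f02"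
      using right[of m] km last(2) by simp
  next
    fix i assume i: "i < m"
    have "k (i + 1) = k (Suc i)" "\<epsilon> (i + 1) = \<epsilon> (Suc i)" "b (i + 1) = b (Suc i)" by simp_all
    then show "part_on (boundary (sterm (\<epsilon> i) (b i))) {0, k (i + 1)} +
      part_on (boundary (sterm (\<epsilon> (i + 1)) (b (i + 1)))) {0, k (i + 1)} = 0"
      using right[of i] left[of "Suc i"] next_e[of i] i by simp
  next
    fix i assume "i \<le> m"
    then show "\<epsilon> i \<in> {1, -1}" "b i \<in> simplices A B 2" "psupp (b i) = {k i, k (i + 1), 0}"
      using sec[of i] \<epsilon>k[of i] by (auto simp: ort3_def ort_def)
  qed (use k0 km len lts subchain_refl in auto)
qed

subsection \<open>Minimal chains with a 1-shell boundary\<close>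

locale minimal_shell_chain = nontrivial_amenable_family C A
  for C :: "('o, 'm) cat" and A :: "('o, 'm) pfun set" +
  fixes B :: 'o and f01 f02 f12 :: "('o, 'm) pfun" and \<alpha> :: "('o, 'm) chain"
  assumes f01: "f01 \<in> simplices A B 1" "psupp f01 = {0, 1}"
    and f02: "f02 \<in> simplices A B 1" "psupp f02 = {0, 2}"
    and f12: "f12 \<in> simplices A B 1" "psupp f12 = {1, 2}"
    and minimal: "minimal_chain A B \<alpha>"
    and boundary_\<alpha>: "boundary \<alpha> = frag_of f12 - frag_of f02 + frag_of f01"
begin

lemma shell_distinct: "f01 \<noteq> f02" "f01 \<noteq> f12" "f02 \<noteq> f12"
proof -
  have "psupp f01 \<noteq> psupp f02" "psupp f01 \<noteq> psupp f12" "psupp f02 \<noteq> psupp f12"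
    unfolding f01(2) f02(2) f12(2) by (simp_all add: doubleton_eq_iff)
  then show "f01 \<noteq> f02" "f01 \<noteq> f12" "f02 \<noteq> f12" by blast+
qed

lemma csupp_boundary_\<alpha>: "csupp (boundary \<alpha>) = {0, 1, 2}"
proof -
  have "terms (boundary \<alpha>) = {f12, f02, f01}"
    unfolding boundary_\<alpha> using shell_distinct
    by (auto simp: in_keys_iff lookup_add lookup_minus split: if_splits)
  then show ?thesis unfolding csupp_def using f01(2) f02(2) f12(2) by auto
qed

lemma shell_bounded: "shell_bounded A B \<alpha>"
  using minimal unfolding minimal_chain_def by blast

lemma \<alpha>_group: "\<alpha> \<in> chain_group A B 2"
  using shell_bounded unfolding shell_bounded_def by blast

lemma \<alpha>_equiv: "chain_equiv A B \<alpha> \<alpha>"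
proof (rule chain_equiv_refl)
  show "proper_chain A B \<alpha>" using minimal unfolding minimal_chain_def by blast
qed

section \<open>Chains without vanishing supports\<close>

lemma not_RN_csupp:
  assumes "\<not> RN_type A B \<alpha>" "subchain \<beta> \<alpha>"
  shows "csupp \<beta> \<subseteq> csupp (boundary \<beta>)"
  using assms shell_bounded unfolding RN_type_def vanishing_support_def by blast

text \<open>The chain is a subchain of itself, so all its indices occur in its boundary and are 0, 1
  or 2; a triangle has to use all three.\<close>

lemma not_RN_psupp:
  assumes nr: "\<not> RN_type A B \<alpha>" and f: "f \<in> terms \<alpha>"
  shows "psupp f = {0, 1, 2}"
proof (rule card_subset_eq)
  have "psupp f \<subseteq> csupp \<alpha>" using f unfolding csupp_def by blast
  also have "\<dots> \<subseteq> {0, 1, 2}"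
    using not_RN_csupp[OF nr subchain_refl] unfolding csupp_boundary_\<alpha> .
  finally show "psupp f \<subseteq> {0, 1, 2}" .
  show "card (psupp f) = card {0, 1, 2 :: nat}"
  proof -
    have "f \<in> simplices A B 2" using f \<alpha>_group unfolding chain_group_def by blast
    then show ?thesis using simplexD(3) by fastforce
  qed
qed simp

lemma not_RN_boundary:
  assumes nr: "\<not> RN_type A B \<alpha>" and sub: "subchain \<beta> \<alpha>" and j: "j \<in> {0, 1, 2}"
    and avoid: "\<And>e. e \<in> terms (boundary \<beta>) \<Longrightarrow> j \<notin> psupp e"
  shows "\<beta> = 0"
proof (rule ccontr)
  assume "\<beta> \<noteq> 0"
  then obtain f where f: "f \<in> terms \<beta>" by fastforce
  then have "psupp f = {0, 1, 2}" using not_RN_psupp[OF nr] subchain_terms[OF sub] by blast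
  then have "j \<in> csupp \<beta>" using j f unfolding csupp_def by blast
  then show False using not_RN_csupp[OF nr sub] avoid unfolding csupp_def by blast
qed

lemma not_RN_boundary_edges:
  assumes "\<not> RN_type A B \<alpha>" "subchain \<beta> \<alpha>" "j \<in> {0, 1, 2}"
    and bd: "boundary \<beta> = frag_of a - frag_of b" and j: "j \<notin> psupp a" "j \<notin> psupp b"
  shows "\<beta> = 0"
proof (rule not_RN_boundary[OF assms(1-3)])
  fix e assume "e \<in> terms (boundary \<beta>)"
  then have "e \<in> terms (frag_of a) \<union> terms (frag_of b)"
    unfolding bd by (rule subsetD[OF keys_diff])
  then show "j \<notin> psupp e" using j by auto
qed

text \<open>A CR-operation needs two triangles with different supports, and an RS-operation needs a
  subchain with a vanishing support. Neither exists here.\<close>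

lemma not_RN_no_step:
  assumes nr: "\<not> RN_type A B \<alpha>"
  shows "\<not> CRRS_step A B \<alpha> c"
proof
  assume "CRRS_step A B \<alpha> c"
  then consider "CR_step A B \<alpha> c" | "RS_step \<alpha> c" unfolding CRRS_step_def by blast
  then show False
  proof cases
    case 1
    then obtain w \<alpha>1 \<alpha>2 e1 e2 l1 l2 k1 k2 where w: "e1 \<in> {1, -1 :: int}" "e2 \<in> {1, -1 :: int}"
      "distinct [l1, l2, k1, k2]" "psupp \<alpha>1 = {l1, l2, k1}" "psupp \<alpha>2 = {l1, l2, k2}"
      "w = sterm e1 \<alpha>1 + sterm e2 \<alpha>2" "subchain w \<alpha>"
      unfolding CR_step_def by blast
    have k: "k1 \<in> psupp \<alpha>1" "k1 \<notin> psupp \<alpha>2" using w(3-5) by auto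
    then have "\<alpha>1 \<noteq> \<alpha>2" by blast
    then have "\<alpha>1 \<in> terms w" "\<alpha>2 \<in> terms w"
      using w(1,2) unfolding w(6) by (auto simp: in_keys_iff lookup_add)
    then show False using not_RN_psupp[OF nr] subchain_terms[OF w(7)] k by blast
  next
    case 2
    then obtain d j where "subchain d \<alpha>" "vanishing_support d j" unfolding RS_step_def by blast
    then show False using nr shell_bounded unfolding RN_type_def by blast
  qed
qed

lemma not_RN_equiv:
  assumes "\<not> RN_type A B \<alpha>" "chain_equiv A B c \<alpha>"
  shows "c = \<alpha>"
  using assms(2) not_RN_no_step[OF assms(1)] unfolding chain_equiv_def by (metis converse_rtranclpE)

text \<open>Without vanishing supports, the complement of the fan around 0, of the first triangle or of the
  last one would have a boundary on a single pair of indices, hence it is 0.\<close>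

lemma not_RN_fan:
  assumes nr: "\<not> RN_type A B \<alpha>" and fan: "fan A B 0 1 f01 ts 2 f02"
    and sub: "subchain (fan_chain 0 ts) \<alpha>" and len: "chain_length (fan_chain 0 ts) = length ts"
  obtains n where "\<alpha> = fan_chain 0 ts" "length ts = Suc (2 * n)"
    "\<forall>i<length ts. ort3 0 (fst (ts ! i)) (fst (snd (ts ! i))) = (-1) ^ i"
    "n \<noteq> 0 \<longrightarrow> (\<exists>j. 1 \<le> j \<and> j + 1 \<le> n \<and> edge (snd (snd (ts ! (2 * j)))) 1 2 = f12)"
proof -
  have "boundary (\<alpha> - fan_chain 0 ts) = frag_of f12 - outer_chain ts"
    unfolding boundary_diff boundary_\<alpha> fan_boundary[OF fan] by simp
  then have "\<alpha> - fan_chain 0 ts = 0"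
    using keys_diff[of "frag_of f12" "outer_chain ts"] f12(2) fan_outer_psupp[OF fan]
    by (intro not_RN_boundary[OF nr subchain_diff[OF sub], of 0]) auto
  then have \<alpha>: "\<alpha> = fan_chain 0 ts" by simp
  have tri: "p \<in> {1, 2} \<and> q \<in> {1, 2} \<and> p \<noteq> q" if "(p, q, f) \<in> set ts" for p q f
  proof -
    have "subchain (sector_chain 0 (p, q, f)) \<alpha>" unfolding \<alpha> by (rule fan_sector_subchain[OF len that])
    moreover have "f \<in> terms (sector_chain 0 (p, q, f))" by (simp add: sector_chain_def)
    ultimately have "psupp f = {0, 1, 2}" using not_RN_psupp[OF nr] subchain_terms by blast
    then have "{0, p, q} = {0, 1, 2}" using fan_sector(2)[OF fan that] by simp
    then have "p \<in> {0, 1, 2}" "q \<in> {0, 1, 2}" by blast+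
    moreover have "distinct [0, p, q]" by (rule fan_sector(3)[OF fan that])
    ultimately show ?thesis by auto
  qed
  have ne: "ts \<noteq> []" using fan by auto
  \<comment> \<open>Around 0 only the indices 1 and 2 are available, so the walk alternates between
    them. Starting at 1 and ending at 2, it has an even last position, and the signs
    alternate.\<close>
  have alt: "fst (ts ! i) = (if even i then 1 else 2) \<and> fst (snd (ts ! i)) = (if even i then 2 else 1)"
    if "i < length ts" for i
    using that
  proof (induction i)
    case 0
    obtain t ts' where tt: "ts = t # ts'" using ne by (cases ts) auto
    obtain p q f where t: "t = (p, q, f)" by (cases t)
    note ts = tt[unfolded t]
    show ?case using tri[of p q f] fan unfolding ts by auto
  next
    case (Suc i)
    obtain p q f where t1: "ts ! i = (p, q, f)" by (cases "ts ! i")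
    obtain p' q' f' where t2: "ts ! Suc i = (p', q', f')" by (cases "ts ! Suc i")
    have "(p', q', f') \<in> set ts" using Suc.prems t2 by (metis nth_mem)
    then show ?case
      using fan_consecutive(1)[OF fan Suc.prems t1 t2] Suc tri[of p' q' f'] unfolding t1 t2 by auto
  qed
  obtain m where m: "length ts = Suc m" using ne by (metis length_Suc_conv neq_Nil_conv)
  obtain p q f where tm: "ts ! m = (p, q, f)" by (cases "ts ! m")
  have tsm: "ts = take m ts @ [(p, q, f)]"
    using m tm by (metis take_Suc_conv_app_nth lessI order_refl take_all)
  then have last: "q = 2" "edge f 0 2 = f02" using fan_last fan by metis+
  then have "even m" using alt[of m] m unfolding tm by (auto split: if_splits)
  then obtain n where n: "m = 2 * n" by (elim evenE)
  have sg: "ort3 0 (fst (ts ! i)) (fst (snd (ts ! i))) = (-1) ^ i" if "i < length ts" for i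
    using alt[OF that] by (auto simp: ort3_def ort_def)
  \<comment> \<open>Since the fan is the whole chain, its outer edges add up to \<open>f12\<close>.
    Some sector thus traverses \<open>f12\<close> from 1 to 2, and the alternation puts it at an
    even position.\<close>
  have "outer_chain ts = frag_of f12"
    using boundary_\<alpha> unfolding \<alpha> fan_boundary[OF fan] by (simp add: algebra_simps)
  then have "coeff (outer_chain ts) f12 * 1 > 0" by simp
  then obtain p1 q1 g where g: "(p1, q1, g) \<in> set ts" "edge g p1 q1 = f12" "ort p1 q1 * 1 > 0"
    by (rule outer_chain_coeff)
  have pq: "p1 = 1" "q1 = 2" using tri[OF g(1)] g(3) by (auto simp: ort_def split: if_splits)
  obtain i where i: "i < length ts" "ts ! i = (1, 2, g)" using g(1) unfolding pq by (metis in_set_conv_nth)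
  then have "even i" using alt[of i] by (auto split: if_splits)
  then obtain j where j: "i = 2 * j" by (elim evenE)
  have g12: "edge g 1 2 = f12" using g(2) unfolding pq .
  have sec: "sector_chain 0 (1, 2, g) = frag_of g" by (simp add: sector_chain_def ort3_def ort_def)
  have subg: "subchain (\<alpha> - frag_of g) \<alpha>"
    using fan_sector_subchain[OF len, of "(1, 2, g)"] g(1)
    unfolding pq sec \<alpha> by (intro subchain_diff) simp
  note gs = fan_sector[OF fan g(1)[unfolded pq]]
  have bg: "boundary (\<alpha> - frag_of g) = (frag_of (edge g 0 2) - frag_of f02) + (frag_of f01 - frag_of (edge g 0 1))"
    unfolding boundary_diff boundary_\<alpha> sec[symmetric] sector_boundary[OF gs(2,3)] g12
    by (simp add: ort_def)
  have pg: "psupp (edge g 0 1) = {0, 1}" "psupp (edge g 0 2) = {0, 2}"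
    using psupp_edge[OF gs(1)] gs(2) by auto
  have nz: "\<alpha> - frag_of g \<noteq> 0" if "n \<noteq> 0"
  proof
    assume "\<alpha> - frag_of g = 0"
    then have "chain_length \<alpha> = 1" by simp
    then show False using len m n that unfolding \<alpha> by simp
  qed
  \<comment> \<open>A first sector over \<open>f12\<close> would contain \<open>f01\<close> too.
    Without it the chain would have a boundary over {0, 2}, missing 1, although for \<open>n\<close>
    above 0 something is left.\<close>
  have j0: "j \<noteq> 0" if "n \<noteq> 0"
  proof
    assume "j = 0"
    then have "ts ! 0 = (1, 2, g)" using i(2) j by simp
    then have "edge g 0 1 = f01" using fan ne by (cases ts) auto
    then have "boundary (\<alpha> - frag_of g) = frag_of (edge g 0 2) - frag_of f02" unfolding bg by simp
    from not_RN_boundary_edges[OF nr subg _ this, of 1] show False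
      using nz[OF that] pg(2) f02(2) by simp
  qed
  \<comment> \<open>Likewise a last sector over \<open>f12\<close> would contain \<open>f02\<close>
    too, and the boundary of the others would lie over {0, 1}, missing 2.\<close>
  have jn: "j \<noteq> n" if "n \<noteq> 0"
  proof
    assume "j = n"
    then have "g = f" using i(2) j n tm by simp
    then have "boundary (\<alpha> - frag_of g) = frag_of f01 - frag_of (edge g 0 1)"
      unfolding bg using last(2) by simp
    from not_RN_boundary_edges[OF nr subg _ this, of 2] show False
      using nz[OF that] pg(1) f01(2) by simp
  qed
  show thesis
  proof (rule that[OF \<alpha>], use m n in simp, use sg in blast, rule impI)
    assume "n \<noteq> 0"
    moreover have "j \<le> n" using i(1) j m n by simp
    moreover have "edge (snd (snd (ts ! (2 * j)))) 1 2 = f12" using i(2) j g12 by simp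
    ultimately show "\<exists>j. 1 \<le> j \<and> j + 1 \<le> n \<and> edge (snd (snd (ts ! (2 * j)))) 1 2 = f12"
      using j0 jn by (intro exI[of _ j]) auto
  qed
qed

lemma fan_around_0:
  obtains ts where "fan A B 0 1 f01 ts 2 f02" "subchain (fan_chain 0 ts) \<alpha>"
    "chain_length (fan_chain 0 ts) = length ts"
proof -
  have e: "coeff (boundary \<alpha>) e = coeff (sterm (ort 0 1) f01 - sterm (ort 0 2) f02) e"
    if "0 \<in> psupp e" for e
    using that f12(2) unfolding boundary_\<alpha> by (auto simp: lookup_add lookup_minus)
  obtain ts D where ts: "fan A B 0 1 f01 ts 2 f02" "\<alpha> = fan_chain 0 ts + D"
    "chain_length \<alpha> = length ts + chain_length D"
    using fan_trail[OF \<alpha>_group f01(2) f02(2) _ _ e] by auto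
  have "chain_length (fan_chain 0 ts) = length ts" "chain_length \<alpha> = chain_length (fan_chain 0 ts) + chain_length D"
    using ts(2,3) chain_length_fan_le[of 0 ts] chain_length_add_le[of "fan_chain 0 ts" D] by auto
  then show thesis using that ts(1) subchain_add(1) unfolding ts(2) by blast
qed

text \<open>Unless there is only one triangle, \<open>f12\<close> lies on a sector at a position
  \<open>2 * j\<close> with \<open>j\<close> between 1 and \<open>n - 1\<close>. This excludes
  length 3, and the next odd length is 5.\<close>

lemma not_RN_length:
  assumes "\<not> RN_type A B \<alpha>"
  shows "chain_length \<alpha> = 1 \<or> chain_length \<alpha> \<ge> 5"
proof -
  obtain ts where ts: "fan A B 0 1 f01 ts 2 f02" "subchain (fan_chain 0 ts) \<alpha>"
    "chain_length (fan_chain 0 ts) = length ts" by (rule fan_around_0)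
  obtain n where n: "\<alpha> = fan_chain 0 ts" "length ts = Suc (2 * n)"
    "\<forall>i<length ts. ort3 0 (fst (ts ! i)) (fst (snd (ts ! i))) = (-1) ^ i"
    "n \<noteq> 0 \<longrightarrow> (\<exists>j. 1 \<le> j \<and> j + 1 \<le> n \<and> edge (snd (snd (ts ! (2 * j)))) 1 2 = f12)"
    by (rule not_RN_fan[OF assms ts])
  show ?thesis
  proof (cases "n = 0")
    case True
    then show ?thesis using ts(3) n(1,2) by simp
  next
    case False
    then have "n \<ge> 2" using n(4) by auto
    then show ?thesis using ts(3) n(1,2) by simp
  qed
qed

lemma not_RN_walk:
  assumes nr: "\<not> RN_type A B \<alpha>" and len: "chain_length \<alpha> \<ge> 5"
    and walk: "chain_walk A B \<alpha> f01 f02 m \<epsilon> a"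
  shows "\<exists>n. m = 2 * n \<and> (\<forall>i\<le>2 * n. \<epsilon> i = (-1) ^ i) \<and>
    (\<Sum>i\<le>2 * n. sterm ((-1) ^ i) (a i)) = \<alpha> \<and>
    (\<exists>j. 1 \<le> j \<and> j + 1 \<le> n \<and> f12 = restr (a (2 * j)) (Pow {1, 2}))"
proof -
  obtain ts where ts: "fan A B 0 1 f01 ts 2 f02" "length ts = Suc m"
    "subchain (fan_chain 0 ts) \<alpha>" "chain_length (fan_chain 0 ts) = length ts"
    "(\<Sum>i\<le>m. sterm (\<epsilon> i) (a i)) = fan_chain 0 ts"
    "\<forall>i\<le>m. \<exists>p q. ts ! i = (p, q, a i) \<and> \<epsilon> i = ort3 0 p q"
    by (rule chain_walk_imp_fan[OF walk])
  obtain n where n: "\<alpha> = fan_chain 0 ts" "length ts = Suc (2 * n)"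
    "\<forall>i<length ts. ort3 0 (fst (ts ! i)) (fst (snd (ts ! i))) = (-1) ^ i"
    "n \<noteq> 0 \<longrightarrow> (\<exists>j. 1 \<le> j \<and> j + 1 \<le> n \<and> edge (snd (snd (ts ! (2 * j)))) 1 2 = f12)"
    by (rule not_RN_fan[OF nr ts(1,3,4)])
  have m: "m = 2 * n" using ts(2) n(2) by simp
  have a: "a i = snd (snd (ts ! i))" and \<epsilon>: "\<epsilon> i = (-1) ^ i" if "i \<le> m" for i
    using ts(6)[rule_format, OF that] n(3)[rule_format, of i] that ts(2) by auto
  have "n \<noteq> 0" using len ts(4) n(1,2) by auto
  then obtain j where j: "1 \<le> j" "j + 1 \<le> n" "edge (snd (snd (ts ! (2 * j)))) 1 2 = f12"
    using n(4) by blast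
  then have "f12 = restr (a (2 * j)) (Pow {1, 2})" using a[of "2 * j"] m unfolding edge_def by simp
  moreover have "(\<Sum>i\<le>2 * n. sterm ((-1) ^ i) (a i)) = \<alpha>"
    unfolding n(1) ts(5)[symmetric] m by (rule sum.cong) (use \<epsilon> m in auto)
  ultimately show ?thesis using m j(1,2) \<epsilon> by blast
qed

text \<open>Without vanishing supports the equivalent chain would be \<alpha> itself. Its last
  triangle accounts for \<open>f12\<close> and \<open>f02\<close>, so the others would have a
  boundary over {0, 1}, missing 2; hence there would be none, against
  \<open>n \<ge> 1\<close>.\<close>

lemma walk_imp_RN:
  assumes eqv: "chain_equiv A B \<alpha>' \<alpha>" and n: "n \<ge> 1"
    and walk: "chain_walk A B \<alpha>' f01 f02 (2 * n) \<epsilon> a"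
    and a: "psupp (a (2 * n)) = {0, 1, 2}" "face 0 (a (2 * n)) = f12" "face 1 (a (2 * n)) = f02"
  shows "RN_type A B \<alpha>"
proof (rule ccontr)
  assume nr: "\<not> RN_type A B \<alpha>"
  have \<alpha>': "\<alpha>' = \<alpha>" by (rule not_RN_equiv[OF nr eqv])
  obtain ts where ts: "fan A B 0 1 f01 ts 2 f02" "length ts = Suc (2 * n)"
    "subchain (fan_chain 0 ts) \<alpha>" "chain_length (fan_chain 0 ts) = length ts"
    "(\<Sum>i\<le>2 * n. sterm (\<epsilon> i) (a i)) = fan_chain 0 ts"
    "\<forall>i\<le>2 * n. \<exists>p q. ts ! i = (p, q, a i) \<and> \<epsilon> i = ort3 0 p q"
    by (rule chain_walk_imp_fan[OF walk[unfolded \<alpha>']])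
  obtain n' where n': "\<alpha> = fan_chain 0 ts" "length ts = Suc (2 * n')"
    "\<forall>i<length ts. ort3 0 (fst (ts ! i)) (fst (snd (ts ! i))) = (-1) ^ i"
    "n' \<noteq> 0 \<longrightarrow> (\<exists>j. 1 \<le> j \<and> j + 1 \<le> n' \<and> edge (snd (snd (ts ! (2 * j)))) 1 2 = f12)"
    by (rule not_RN_fan[OF nr ts(1,3,4)])
  let ?a = "a (2 * n)"
  obtain p q where pq: "ts ! (2 * n) = (p, q, ?a)" using ts(6)[rule_format, of "2 * n"] by blast
  have mem: "(p, q, ?a) \<in> set ts" using pq ts(2) by (metis lessI nth_mem)
  have "ort3 0 p q = 1" using n'(3)[rule_format, of "2 * n"] ts(2) pq by simp
  then have sec: "sector_chain 0 (p, q, ?a) = frag_of ?a" by (simp add: sector_chain_def)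
  have sub: "subchain (\<alpha> - frag_of ?a) \<alpha>"
    using fan_sector_subchain[OF ts(4) mem] unfolding sec n'(1) by (rule subchain_diff)
  note bt = boundary_triangle_sorted[OF a(1)]
  have "boundary (\<alpha> - frag_of ?a) = frag_of f01 - frag_of (edge ?a 0 1)"
    unfolding boundary_diff boundary_\<alpha> using bt a(2,3) by simp
  moreover have "psupp (edge ?a 0 1) = {0, 1}"
    using psupp_edge[OF fan_sector(1)[OF ts(1) mem]] a(1) by auto
  ultimately have "\<alpha> - frag_of ?a = 0"
    using not_RN_boundary_edges[OF nr sub, of 2] f01(2) by simp
  then have "chain_length \<alpha> = 1" by simp
  then show False using ts(2,4) n'(1) n by simp
qed

section \<open>Chains with a vanishing support\<close>

lemma RN_wide:
  assumes "RN_type A B \<alpha>"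
  obtains c where "chain_equiv A B c \<alpha>" "boundary c = boundary \<alpha>" "wide {0, 1, 2} c"
proof (cases "wide {0, 1, 2} \<alpha>")
  case True
  then show thesis using that \<alpha>_equiv by blast
next
  case False
  obtain d j where d: "subchain d \<alpha>" "vanishing_support d j" using assms unfolding RN_type_def by blast
  from RS_relabel[OF \<alpha>_group d] obtain k d' where R: "k \<notin> csupp \<alpha>" "RS_step \<alpha> (\<alpha> - d + d')"
      "d' \<in> chain_group A B 2" "boundary d' = boundary d"
      "chain_length (\<alpha> - d + d') = chain_length \<alpha> \<Longrightarrow> k \<in> csupp (\<alpha> - d + d')" by blast
  have st: "CRRS_step A B \<alpha> (\<alpha> - d + d')" using R(2) unfolding CRRS_step_def by blast
  have g: "\<alpha> - d + d' \<in> chain_group A B 2"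
    by (rule chain_group_add[OF subchain_group[OF subchain_diff[OF d(1)] \<alpha>_group] R(3)])
  note eq' = chain_equiv_step[OF \<alpha>_equiv st g]
  \<comment> \<open>The length is preserved, so the fresh index really occurs. It is none of 0, 1,
    2, because these all lie in the support of \<alpha>.\<close>
  have "k \<in> csupp (\<alpha> - d + d')" by (rule R(5)[OF eq'(2)])
  moreover have "k \<notin> {0, 1, 2}"
    using R(1) csupp_boundary[OF \<alpha>_group] unfolding csupp_boundary_\<alpha> by blast
  ultimately have "wide {0, 1, 2} (\<alpha> - d + d')" unfolding wide_def csupp_def by blast
  moreover have "boundary (\<alpha> - d + d') = boundary \<alpha>" using R(4) by (simp add: boundary_add boundary_diff)
  ultimately show thesis using that eq'(1) by blast
qed

lemma RN_imp_fan:
  assumes rn: "RN_type A B \<alpha>"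
  obtains n us a where "n \<ge> 1" "chain_equiv A B (fan_chain 0 (us @ [(1, 2, a)])) \<alpha>"
    "fan A B 0 1 f01 (us @ [(1, 2, a)]) 2 f02" "length us = 2 * n" "edge a 1 2 = f12"
    "chain_length (fan_chain 0 (us @ [(1, 2, a)])) = length (us @ [(1, 2, a)])"
proof -
  have ort2: "ort 2 0 = -1" "ort 2 1 = -1" "ort 0 1 = 1" "ort 0 2 = 1" "ort 1 2 = 1"
    by (simp_all add: ort_def)
  obtain c1 where c1: "chain_equiv A B c1 \<alpha>" "boundary c1 = boundary \<alpha>" "wide {0, 1, 2} c1"
    by (rule RN_wide[OF rn])
  \<comment> \<open>Since 2 is larger than 0 and 1, both signs \<open>ort\<close> are -1. Seen from
    2 the shell therefore leads from \<open>f02\<close> to \<open>f12\<close>, and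
    \<open>f01\<close> is the opposite edge.\<close>
  have e1: "coeff (boundary c1) e = coeff (sterm (ort 2 0) f02 - sterm (ort 2 1) f12) e"
    if "2 \<in> psupp e" for e
  proof -
    have "e \<noteq> f01"
    proof
      assume "e = f01"
      then have "2 \<in> psupp f01" using that by simp
      then show False unfolding f01(2) by simp
    qed
    then show ?thesis unfolding c1(2) boundary_\<alpha> ort2 by (simp add: lookup_add lookup_minus)
  qed
  have p2: "psupp f02 = {2, 0}" "psupp f12 = {2, 1}" using f02(2) f12(2) by auto
  obtain ts0 D0 where t0: "fan A B 2 0 f02 ts0 1 f12" "c1 = fan_chain 2 ts0 + D0"
    "D0 \<in> chain_group A B 2" "chain_length c1 = length ts0 + chain_length D0"
    using fan_trail[OF chain_equiv_group[OF c1(1)] p2 _ _ e1] by auto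
  have bd1: "boundary (fan_chain 2 ts0 + D0) = sterm (ort 2 0) f02 - sterm (ort 2 1) f12 + frag_of f01"
    unfolding t0(2)[symmetric] c1(2) boundary_\<alpha> ort2 by simp
  have S: "{0, 1, 2} \<subseteq> csupp (boundary (fan_chain 2 ts0 + D0))"
    unfolding t0(2)[symmetric] c1(2) csupp_boundary_\<alpha> by simp
  have nv: "2 \<notin> psupp f01" "0 \<notin> psupp f12" using f01(2) f12(2) by auto
  obtain ts1 where t1: "chain_equiv A B (fan_chain 2 ts1) \<alpha>" "fan A B 2 0 f02 ts1 1 f12"
    "chain_length (fan_chain 2 ts1) = length ts1"
    "boundary (fan_chain 2 ts1) = boundary \<alpha>" "wide {0, 1, 2} (fan_chain 2 ts1)"
  proof (rule fan_extend[OF minimal f01(1) nv(1) c1(1)[unfolded t0(2)] t0(1,3)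
        t0(4)[unfolded t0(2)] bd1 S])
    fix ts' assume "chain_equiv A B (fan_chain 2 ts') \<alpha>" "fan A B 2 0 f02 ts' 1 f12"
      "chain_length (fan_chain 2 ts') = length ts'"
      "boundary (fan_chain 2 ts') = boundary (fan_chain 2 ts0 + D0)"
      "wide {0, 1, 2} (fan_chain 2 ts0 + D0) \<Longrightarrow> wide {0, 1, 2} (fan_chain 2 ts')"
    then show thesis using that[of ts'] c1(2,3) unfolding t0(2) by simp
  qed
  \<comment> \<open>The fan is the whole chain and has a triangle off {0, 1, 2}. Each index of a
    sector is the first index of some sector or the end point 1, so first indices 0 and 1 alone
    would put all triangles on {0, 1, 2}.\<close>
  have inner: "\<exists>t\<in>set ts1. fst t \<notin> {0, 1}"
  proof (rule ccontr)
    assume no: "\<not> ?thesis"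
    obtain f where f: "f \<in> terms (fan_chain 2 ts1)" "psupp f \<noteq> {0, 1, 2}"
      using t1(5) unfolding wide_def by blast
    then obtain t' where t': "t' \<in> set ts1" "f = (\<lambda>(p, q, f). f) t'"
      using subsetD[OF fan_chain_terms f(1)] by blast
    obtain p q f' where "t' = (p, q, f')" by (cases t')
    then have t: "(p, q, f) \<in> set ts1" using t' by simp
    have "p \<in> {0, 1}" using no t by force
    moreover have "q \<in> {0, 1}" using fan_vertices[OF t1(2) t] no by auto
    moreover have "p \<noteq> q" using fan_sector(3)[OF t1(2) t] by simp
    ultimately have "{2, p, q} = {0, 1, 2}" by auto
    then show False using fan_sector(2)[OF t1(2) t] f(2) by simp
  qed
  have long: "length ts1 \<ge> 2"
  proof (rule ccontr)
    assume "\<not> ?thesis"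
    then consider "ts1 = []" | t where "ts1 = [t]" by (cases ts1; cases "tl ts1") auto
    then show False using t1(2) inner by cases auto
  qed
  have z: "(0 :: ('o, 'm) chain) \<in> chain_group A B 2" by (simp add: chain_group_def)
  have p0: "chain_equiv A B (fan_chain 2 ts1 + 0) \<alpha>"
    "chain_length (fan_chain 2 ts1 + 0) = length ts1 + chain_length (0 :: ('o, 'm) chain)"
    "boundary (fan_chain 2 ts1 + 0) = boundary \<alpha>"
    using t1(1,3,4) by simp_all
  \<comment> \<open>The shortening begins with rest 0 and collects the cut-off triangles in
    \<open>D\<close>. It leaves one triangle at 2, whose edges there are \<open>f02\<close> and
    \<open>f12\<close>.\<close>
  from fan_shorten[OF p0(1) t1(2) z p0(2) zero_neq_one inner, unfolded p0(3)]
  obtain a D where a: "chain_equiv A B (fan_chain 2 [(0, 1, a)] + D) \<alpha>"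
    "fan A B 2 0 f02 [(0, 1, a)] 1 f12" "D \<in> chain_group A B 2"
    "chain_length (fan_chain 2 [(0, 1, a)] + D) = Suc (chain_length D)"
    "boundary (fan_chain 2 [(0, 1, a)] + D) = boundary \<alpha>"
    by blast
  have as: "a \<in> simplices A B 2" "psupp a = {0, 1, 2}" "edge a 0 2 = f02" "edge a 1 2 = f12"
    using a(2) by (auto simp: edge_commute[of a 2])
  have sec: "fan_chain 2 [(0, 1, a)] = frag_of a" "sector_chain 0 (1, 2, a) = frag_of a"
    by (simp_all add: sector_chain_def ort3_def ort_def)
  \<comment> \<open>The corner triangle takes over \<open>f12\<close> and \<open>f02\<close>, which
    leaves two edges over {0, 1}. Hence \<open>D\<close> contains a walk around 0 from
    \<open>f01\<close> to the edge \<open>01\<close> of the corner triangle, and the corner triangle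
    continues it to \<open>f02\<close>.\<close>
  have bD: "boundary D = frag_of f01 - frag_of (edge a 0 1)"
    using a(5) boundary_triangle_sorted(4)[OF as(2)]
    unfolding sec boundary_add boundary_\<alpha> as(3,4) by (simp add: algebra_simps)
  have pa: "psupp (edge a 0 1) = {0, 1}" using psupp_edge[OF as(1)] as(2) by auto
  obtain ts2 D2 where t2: "fan A B 0 1 f01 ts2 1 (edge a 0 1)" "D = fan_chain 0 ts2 + D2"
    "D2 \<in> chain_group A B 2" "chain_length D = length ts2 + chain_length D2"
    using fan_trail[OF a(3) f01(2) pa] unfolding bD ort2 by auto
  let ?ts = "ts2 @ [(1, 2, a)]"
  have c2: "fan_chain 2 [(0, 1, a)] + D = fan_chain 0 ?ts + D2"
    unfolding t2(2) sec using sec(2) by (simp add: algebra_simps)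
  have fan2: "fan A B 0 1 f01 ?ts 2 f02" unfolding fan_append using t2(1) as by auto
  have len2: "chain_length (fan_chain 0 ?ts + D2) = length ?ts + chain_length D2"
    using a(4) t2(4) unfolding c2 by simp
  have bd2: "boundary (fan_chain 0 ?ts + D2) = sterm (ort 0 1) f01 - sterm (ort 0 2) f02 + frag_of f12"
    using a(5) unfolding c2 boundary_\<alpha> ort2 by (simp add: algebra_simps)
  obtain ts3 where t3: "chain_equiv A B (fan_chain 0 ts3) \<alpha>" "fan A B 0 1 f01 ts3 2 f02"
    "chain_length (fan_chain 0 ts3) = length ts3" "boundary (fan_chain 0 ts3) = boundary \<alpha>"
    "\<exists>us. ts3 = us @ [(1, 2, a)]"
  proof (rule fan_extend[OF minimal f12(1) nv(2) a(1)[unfolded c2] fan2 t2(3) len2 bd2 empty_subsetI])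
    fix ts' assume *: "chain_equiv A B (fan_chain 0 ts') \<alpha>" "fan A B 0 1 f01 ts' 2 f02"
      "chain_length (fan_chain 0 ts') = length ts'"
      "boundary (fan_chain 0 ts') = boundary (fan_chain 0 ?ts + D2)"
      "\<And>us p q f. ?ts = us @ [(p, q, f)] \<Longrightarrow> edge f p q = f12 \<Longrightarrow> \<exists>us'. ts' = us' @ [(p, q, f)]"
    show thesis using that[of ts'] *(1-3) *(4)[folded c2, unfolded a(5)] *(5)[OF refl as(4)] by blast
  qed
  obtain us where us: "ts3 = us @ [(1, 2, a)]" using t3(5) by blast
  \<comment> \<open>Both lists faithfully display chains equivalent to \<alpha>. The bound 2 known
    for the fan around 2 thus passes to the one around 0; together with the parity of the length it
    makes the number of sectors before the corner triangle even and positive.\<close>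
  have l3: "length ts3 = length ts1"
    using t1(1,3) t3(1,3) chain_equiv_length by metis
  have "even (int (length ts3) - pairing (\<lambda>_. 1) (boundary \<alpha>))"
    using parity_chain_length[OF chain_equiv_group[OF t3(1)]] unfolding t3(3,4) .
  then have "even (int (length us))" unfolding boundary_\<alpha> us by simp
  then have "even (length us)" by simp
  then obtain n where n: "length us = 2 * n" by (elim evenE)
  have "n \<ge> 1" using long l3 n unfolding us by simp
  then show thesis using that[of n us a] t3(1-3) n as(4) unfolding us by blast
qed

lemma RN_imp_walk:
  assumes "RN_type A B \<alpha>"
  shows "\<exists>\<alpha>' n \<epsilon> a. chain_equiv A B \<alpha>' \<alpha> \<and> n \<ge> 1 \<and> \<epsilon> 0 = 1 \<and> \<epsilon> (2 * n) = 1 \<and>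
    \<alpha>' = frag_of (a 0) + (\<Sum>i = 1..2 * n - 1. sterm (\<epsilon> i) (a i)) + frag_of (a (2 * n)) \<and>
    chain_walk A B \<alpha>' f01 f02 (2 * n) \<epsilon> a \<and>
    psupp (a (2 * n)) = {0, 1, 2} \<and> face 0 (a (2 * n)) = f12 \<and> face 1 (a (2 * n)) = f02"
proof -
  obtain n us t where n: "n \<ge> 1" and eqv: "chain_equiv A B (fan_chain 0 (us @ [(1, 2, t)])) \<alpha>"
    and fan: "fan A B 0 1 f01 (us @ [(1, 2, t)]) 2 f02" and lus: "length us = 2 * n"
    and t12: "edge t 1 2 = f12"
    and len: "chain_length (fan_chain 0 (us @ [(1, 2, t)])) = length (us @ [(1, 2, t)])"
    by (rule RN_imp_fan[OF assms])
  define ts where "ts = us @ [(1, 2, t)]"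
  define \<epsilon> where "\<epsilon> = (\<lambda>i. ort3 0 (fst (ts ! i)) (fst (snd (ts ! i))))"
  define a where "a = (\<lambda>i. snd (snd (ts ! i)))"
  have lts: "length ts = Suc (2 * n)" unfolding ts_def using lus by simp
  note walk = fan_imp_chain_walk[OF fan[folded ts_def] lts len[folded ts_def], of \<epsilon> a]
  have w: "chain_walk A B (fan_chain 0 ts) f01 f02 (2 * n) \<epsilon> a"
    "fan_chain 0 ts = (\<Sum>i\<le>2 * n. sterm (\<epsilon> i) (a i))"
    by (rule walk; simp add: \<epsilon>_def a_def)+
  have last: "ts ! (2 * n) = (1, 2, t)" unfolding ts_def lus[symmetric] by (rule nth_append_length)
  have an: "a (2 * n) = t" "\<epsilon> (2 * n) = 1" unfolding a_def \<epsilon>_def last by (simp_all add: ort3_def ort_def)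
  have mem: "(1, 2, t) \<in> set ts" unfolding ts_def by simp
  note s = fan_sector[OF fan[folded ts_def] mem]
  \<comment> \<open>The first sector goes from 1 to an index other than 0 and 1, hence to a larger
    one, and the order is increasing.\<close>
  have e0: "\<epsilon> 0 = 1"
  proof -
    obtain p q f us' where us: "us = (p, q, f) # us'" using lus n by (cases us) auto
    have "p = 1" "q \<noteq> 0" "q \<noteq> 1" using fan unfolding us by auto
    then show ?thesis unfolding \<epsilon>_def ts_def us by (simp add: ort3_def ort_def)
  qed
  \<comment> \<open>Since \<open>n \<ge> 1\<close>, the positions 0 and \<open>2 * n\<close> are
    different and can be split off separately.\<close>
  have "{..2 * n} = insert 0 (insert (2 * n) {1..2 * n - 1})" using n by auto
  then have "(\<Sum>i\<le>2 * n. sterm (\<epsilon> i) (a i)) = sterm (\<epsilon> 0) (a 0) +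
      (sterm (\<epsilon> (2 * n)) (a (2 * n)) + (\<Sum>i = 1..2 * n - 1. sterm (\<epsilon> i) (a i)))"
    using n by simp
  then have sum: "fan_chain 0 ts = frag_of (a 0) + (\<Sum>i = 1..2 * n - 1. sterm (\<epsilon> i) (a i)) + frag_of (a (2 * n))"
    unfolding w(2) e0 an(2) by (simp add: algebra_simps)
  have t02: "edge t 0 2 = f02" using fan_last[OF fan] by blast
  have faces: "face 0 t = f12" "face 1 t = f02"
    using boundary_triangle_sorted(1,2)[OF s(2)] t12 t02 by simp_all
  show ?thesis
    using eqv[folded ts_def] n e0 an sum w(1) s(2) faces by blast
qed

end

theorem theorem3p14:
  fixes C :: "('o, 'm) cat" and A :: "('o, 'm) pfun set" and B :: 'o
    and f01 f02 f12 :: "('o, 'm) pfun" and \<alpha> :: "('o, 'm) chain"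
  assumes "nontrivial_amenable_family C A"
    and "B \<in> Obj C"
    and "f01 \<in> simplices A B 1" and "psupp f01 = {0, 1}"
    and "f02 \<in> simplices A B 1" and "psupp f02 = {0, 2}"
    and "f12 \<in> simplices A B 1" and "psupp f12 = {1, 2}"
    and "one_shell A B (frag_of f12 - frag_of f02 + frag_of f01)"
    and "\<alpha> \<in> chain_group A B 2"
    and "minimal_chain A B \<alpha>"
    and "boundary \<alpha> = frag_of f12 - frag_of f02 + frag_of f01"
  shows
    "(NR_type A B \<alpha> \<longrightarrow>
        (chain_length \<alpha> = 1 \<or> chain_length \<alpha> \<ge> 5) \<and>
        (chain_length \<alpha> \<ge> 5 \<longrightarrow>
          (\<forall>m \<epsilon> a. chain_walk A B \<alpha> f01 f02 m \<epsilon> a \<longrightarrow>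
            (\<exists>n. m = 2 * n \<and>
              (\<forall>i\<le>2 * n. \<epsilon> i = (-1) ^ i) \<and>
              (\<Sum>i\<le>2 * n. frag_cmul ((-1) ^ i) (frag_of (a i))) = \<alpha> \<and>
              (\<exists>j. 1 \<le> j \<and> j + 1 \<le> n \<and> f12 = restr (a (2 * j)) (Pow {1, 2}))))))
     \<and>
     (RN_type A B \<alpha> \<longleftrightarrow>
        (\<exists>\<alpha>' n \<epsilon> a.
          chain_equiv A B \<alpha>' \<alpha> \<and>
          n \<ge> 1 \<and>
          \<epsilon> 0 = 1 \<and> \<epsilon> (2 * n) = 1 \<and>
          \<alpha>' = frag_of (a 0) + (\<Sum>i = 1..2 * n - 1. frag_cmul (\<epsilon> i) (frag_of (a i)))
               + frag_of (a (2 * n)) \<and>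
          chain_walk A B \<alpha>' f01 f02 (2 * n) \<epsilon> a \<and>
          psupp (a (2 * n)) = {0, 1, 2} \<and>
          face 0 (a (2 * n)) = f12 \<and>
          face 1 (a (2 * n)) = f02))"
proof -
  interpret nontrivial_amenable_family C A by (rule assms(1))
  interpret minimal_shell_chain C A B f01 f02 f12 \<alpha>
    by unfold_locales (use assms in auto)
  have NR: "\<not> RN_type A B \<alpha>" if "NR_type A B \<alpha>" using that unfolding NR_type_def by blast
  show ?thesis
    using NR not_RN_length not_RN_walk RN_imp_walk walk_imp_RN by (intro conjI impI iffI allI) blast+
qed

end
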